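(* For any restriction species $R:\mathbb{I}^{\mathrm{op}}\to\mathbf{Grpd}$ with associated right fibration $\mathbb{R}\to\mathbb{I}$, the comma category projection $\mathbb{R}\downarrow\underline{\Delta}\to\underline{\Delta}$ is an iesq sesquicartesian fibration.
   Context: $\mathbb{I}$ is the category of finite sets and injections. A restriction species is a pseudo-functor $R:\mathbb{I}^{\mathrm{op}}\to\mathbf{Grpd}$ into groupoids, assumed to have locally finite values (all automorphism groups finite). Its Grothendieck construction is the right fibration (cartesian fibration with groupoid fibres) $\mathbb{R}\to\mathbb{I}$, with objects pairs $(A,X)$, $A$ a finite set and $X\in R[A]$, and morphisms $(A',X')\to(A,X)$ given by an injection $A'\to A$ together with an isomorphism from $X'$ to the restriction $X|A'$ in $R[A']$. $\underline{\Delta}$ is the category with objects the ordered sets $\underline n=\{1,\dots,n\}$, $n\ge 0$, and monotone maps. A map $j$ in $\underline\Delta$ is convex if $j(x+1)=j(x)+1$ for all $x$ for which this makes sense; pullbacks along convex maps exist and are convex. An identity-extension square is a commutative square in $\underline\Delta$ consisting of $f:\underline n\to\underline k$, $g=\mathrm{id}_a+f+\mathrm{id}_b:\underline a+\underline n+\underline b\to\underline a+\underline k+\underline b$ and the canonical convex inclusions $j:\underline n\to\underline a+\underline n+\underline b$, $i:\underline k\to\underline a+\underline k+\underline b$. The comma category $\mathbb{R}\downarrow\underline\Delta$ is taken over the category of posets (finite sets being regarded as discrete posets): objects are triples of an object $(A,X)$ of $\mathbb{R}$, an object $\underline k$, and a map $A\to\underline k$; morphisms are pairs of a morphism in $\mathbb{R}$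 and a morphism in $\underline\Delta$ making the evident square commute. A sesquicartesian fibration is a cocartesian fibration $X\to\underline\Delta$ that is also cartesian over the subcategory of convex maps and satisfies Beck–Chevalley: for each pullback square $\tau\sigma'=\sigma\tau'$ in $\underline\Delta$ with $\tau$ (hence $\tau'$) convex, the comparison map $\sigma'_!\tau'^*\to\tau^*\sigma_!$ is an isomorphism (lower shriek: cocartesian pushforward; upper star: cartesian pullback). It is iesq if for every identity-extension square, consisting of $f:\underline n\to\underline k$, $g=\mathrm{id}_a+f+\mathrm{id}_b:\underline a+\underline n+\underline b\to\underline a+\underline k+\underline b$ and the canonical convex inclusions $j:\underline n\to\underline a+\underline n+\underline b$, $i:\underline k\to\underline a+\underline k+\underline b$, the square with sides $j^*:X_{a+n+b}\to X_n$, $f_!:X_n\to X_k$, $g_!:X_{a+n+b}\to X_{a+k+b}$, $i^*:X_{a+k+b}\to X_k$ is a homotopy pullback of categories (equivalent to an iso-comma square), where $X_n$ denotes the fibre over $\underline n$. *)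

theory Defs
  imports "HOL-Library.FuncSet"
begin

section \<open>Categories, functors, equivalences\<close>

text \<open>\<open>Cmp C g f\<close>, written \<open>g \<odot>\<^bsub>C\<^esub> f\<close>, is ``\<open>g\<close> after \<open>f\<close>''.\<close>

record ('o, 'm) cat =
  Ob :: "'o set"
  Ar :: "'m set"
  Dom :: "'m \<Rightarrow> 'o"
  Cod :: "'m \<Rightarrow> 'o"
  Idn :: "'o \<Rightarrow> 'm"
  Cmp :: "'m \<Rightarrow> 'm \<Rightarrow> 'm"  (infixr "\<odot>\<index>" 70)

definition hom :: "('o, 'm) cat \<Rightarrow> 'o \<Rightarrow> 'o \<Rightarrow> 'm set" where
  "hom C x y = {f \<in> Ar C. Dom C f = x \<and> Cod C f = y}"

locale category =
  fixes C :: "('o, 'm) cat" (structure)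
  assumes Dom_in: "f \<in> Ar C \<Longrightarrow> Dom C f \<in> Ob C"
    and Cod_in: "f \<in> Ar C \<Longrightarrow> Cod C f \<in> Ob C"
    and Idn_in: "x \<in> Ob C \<Longrightarrow> Idn C x \<in> hom C x x"
    and Cmp_in: "f \<in> hom C x y \<Longrightarrow> g \<in> hom C y z \<Longrightarrow> g \<odot> f \<in> hom C x z"
    and Idn_left: "f \<in> hom C x y \<Longrightarrow> Idn C y \<odot> f = f"
    and Idn_right: "f \<in> hom C x y \<Longrightarrow> f \<odot> Idn C x = f"
    and assoc: "f \<in> hom C w x \<Longrightarrow> g \<in> hom C x y \<Longrightarrow> h \<in> hom C y z \<Longrightarrow>
      h \<odot> (g \<odot> f) = (h \<odot> g) \<odot> f"

definition iso_arrow :: "('o, 'm) cat \<Rightarrow> 'm \<Rightarrow> bool" where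
  "iso_arrow C f \<longleftrightarrow> f \<in> Ar C \<and>
     (\<exists>g \<in> hom C (Cod C f) (Dom C f).
        g \<odot>\<^bsub>C\<^esub> f = Idn C (Dom C f) \<and> f \<odot>\<^bsub>C\<^esub> g = Idn C (Cod C f))"

definition groupoid :: "('o, 'm) cat \<Rightarrow> bool" where
  "groupoid C \<longleftrightarrow> category C \<and> (\<forall>f \<in> Ar C. iso_arrow C f)"

record ('o, 'm, 'p, 'n) fctr =
  Src :: "('o, 'm) cat"
  Tgt :: "('p, 'n) cat"
  FO :: "'o \<Rightarrow> 'p"
  FA :: "'m \<Rightarrow> 'n"

definition is_functor :: "('o, 'm, 'p, 'n) fctr \<Rightarrow> bool" where
  "is_functor F \<longleftrightarrow> category (Src F) \<and> category (Tgt F) \<and>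
     (\<forall>x \<in> Ob (Src F). FO F x \<in> Ob (Tgt F)) \<and>
     (\<forall>f \<in> Ar (Src F). FA F f \<in> hom (Tgt F) (FO F (Dom (Src F) f)) (FO F (Cod (Src F) f))) \<and>
     (\<forall>x \<in> Ob (Src F). FA F (Idn (Src F) x) = Idn (Tgt F) (FO F x)) \<and>
     (\<forall>f \<in> Ar (Src F). \<forall>g \<in> Ar (Src F). Dom (Src F) g = Cod (Src F) f \<longrightarrow>
        FA F (g \<odot>\<^bsub>Src F\<^esub> f) = FA F g \<odot>\<^bsub>Tgt F\<^esub> FA F f)"

definition id_fctr :: "('o, 'm) cat \<Rightarrow> ('o, 'm, 'o, 'm) fctr" where
  "id_fctr C = \<lparr>Src = C, Tgt = C, FO = (\<lambda>x. x), FA = (\<lambda>f. f)\<rparr>"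

definition comp_fctr ::
    "('p, 'n, 'q, 'k) fctr \<Rightarrow> ('o, 'm, 'p, 'n) fctr \<Rightarrow> ('o, 'm, 'q, 'k) fctr"
    (infixr "\<circ>\<^sub>F" 70) where
  "G \<circ>\<^sub>F F = \<lparr>Src = Src F, Tgt = Tgt G, FO = FO G \<circ> FO F, FA = FA G \<circ> FA F\<rparr>"

definition nat_iso ::
    "('o, 'm, 'p, 'n) fctr \<Rightarrow> ('o, 'm, 'p, 'n) fctr \<Rightarrow> ('o \<Rightarrow> 'n) \<Rightarrow> bool" where
  "nat_iso F G \<eta> \<longleftrightarrow> is_functor F \<and> is_functor G \<and> Src F = Src G \<and> Tgt F = Tgt G \<and>
     (\<forall>x \<in> Ob (Src F). \<eta> x \<in> hom (Tgt F) (FO F x) (FO G x) \<and> iso_arrow (Tgt F) (\<eta> x)) \<and>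
     (\<forall>f \<in> Ar (Src F). FA G f \<odot>\<^bsub>Tgt F\<^esub> \<eta> (Dom (Src F) f) = \<eta> (Cod (Src F) f) \<odot>\<^bsub>Tgt F\<^esub> FA F f)"

definition is_equivalence :: "('o, 'm, 'p, 'n) fctr \<Rightarrow> bool" where
  "is_equivalence F \<longleftrightarrow> is_functor F \<and>
     (\<exists>G \<eta> \<epsilon>. is_functor G \<and> Src G = Tgt F \<and> Tgt G = Src F \<and>
        nat_iso (id_fctr (Src F)) (G \<circ>\<^sub>F F) \<eta> \<and> nat_iso (F \<circ>\<^sub>F G) (id_fctr (Tgt F)) \<epsilon>)"

text \<open>\<open>is_pullback C \<tau>' \<sigma>' \<tau> \<sigma>\<close>: the square \<open>\<tau> \<odot> \<sigma>' = \<sigma> \<odot> \<tau>'\<close> is a pullback.\<close>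

definition is_pullback :: "('o, 'm) cat \<Rightarrow> 'm \<Rightarrow> 'm \<Rightarrow> 'm \<Rightarrow> 'm \<Rightarrow> bool" where
  "is_pullback C \<tau>' \<sigma>' \<tau> \<sigma> \<longleftrightarrow>
     \<tau>' \<in> Ar C \<and> \<sigma>' \<in> Ar C \<and> \<tau> \<in> Ar C \<and> \<sigma> \<in> Ar C \<and>
     Dom C \<tau>' = Dom C \<sigma>' \<and> Cod C \<sigma>' = Dom C \<tau> \<and> Cod C \<tau>' = Dom C \<sigma> \<and> Cod C \<tau> = Cod C \<sigma> \<and>
     \<tau> \<odot>\<^bsub>C\<^esub> \<sigma>' = \<sigma> \<odot>\<^bsub>C\<^esub> \<tau>' \<and>
     (\<forall>w \<in> Ob C. \<forall>u \<in> hom C w (Dom C \<tau>). \<forall>v \<in> hom C w (Dom C \<sigma>).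
        \<tau> \<odot>\<^bsub>C\<^esub> u = \<sigma> \<odot>\<^bsub>C\<^esub> v \<longrightarrow>
        (\<exists>!h. h \<in> hom C w (Dom C \<tau>') \<and> \<sigma>' \<odot>\<^bsub>C\<^esub> h = u \<and> \<tau>' \<odot>\<^bsub>C\<^esub> h = v))"

text \<open>Arrows of the concrete categories below record their source and target.\<close>

datatype ('o, 'd) arrow = Arrow (src: 'o) (dat: 'd) (tgt: 'o)

section \<open>Homotopy pullbacks of categories\<close>

definition isocomma ::
    "('o1, 'm1, 'p, 'n) fctr \<Rightarrow> ('o2, 'm2, 'p, 'n) fctr \<Rightarrow>
     ('o1 \<times> 'o2 \<times> 'n, ('o1 \<times> 'o2 \<times> 'n, 'm1 \<times> 'm2) arrow) cat" where
  "isocomma F G =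
    (let E = Tgt F;
         obs = {(c, d, \<theta>). c \<in> Ob (Src F) \<and> d \<in> Ob (Src G) \<and>
                  \<theta> \<in> hom E (FO F c) (FO G d) \<and> iso_arrow E \<theta>}
     in \<lparr>Ob = obs,
         Ar = {Arrow (c, d, \<theta>) (u, v) (c', d', \<theta>') | c d \<theta> u v c' d' \<theta>'.
                 (c, d, \<theta>) \<in> obs \<and> (c', d', \<theta>') \<in> obs \<and>
                 u \<in> hom (Src F) c c' \<and> v \<in> hom (Src G) d d' \<and>
                 FA G v \<odot>\<^bsub>E\<^esub> \<theta> = \<theta>' \<odot>\<^bsub>E\<^esub> FA F u},
         Dom = src,
         Cod = tgt,
         Idn = (\<lambda>(c, d, \<theta>). Arrow (c, d, \<theta>) (Idn (Src F) c, Idn (Src G) d) (c, d, \<theta>)),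
         Cmp = (\<lambda>g f. Arrow (src f)
                  (fst (dat g) \<odot>\<^bsub>Src F\<^esub> fst (dat f), snd (dat g) \<odot>\<^bsub>Src G\<^esub> snd (dat f)) (tgt g))\<rparr>)"

definition isocomma_pairing ::
    "('w, 'l, 'o1, 'm1) fctr \<Rightarrow> ('w, 'l, 'o2, 'm2) fctr \<Rightarrow>
     ('o1, 'm1, 'p, 'n) fctr \<Rightarrow> ('o2, 'm2, 'p, 'n) fctr \<Rightarrow> ('w \<Rightarrow> 'n) \<Rightarrow>
     ('w, 'l, 'o1 \<times> 'o2 \<times> 'n, ('o1 \<times> 'o2 \<times> 'n, 'm1 \<times> 'm2) arrow) fctr" where
  "isocomma_pairing P Q F G \<theta> =
    (let fo = (\<lambda>w. (FO P w, FO Q w, \<theta> w))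
     in \<lparr>Src = Src P, Tgt = isocomma F G, FO = fo,
         FA = (\<lambda>l. Arrow (fo (Dom (Src P) l)) (FA P l, FA Q l) (fo (Cod (Src P) l)))\<rparr>)"

text \<open>The square \<open>F \<circ> P \<cong> G \<circ> Q\<close>, filled by \<open>\<theta>\<close>, is a homotopy pullback.\<close>

definition homotopy_pullback ::
    "('w, 'l, 'o1, 'm1) fctr \<Rightarrow> ('w, 'l, 'o2, 'm2) fctr \<Rightarrow>
     ('o1, 'm1, 'p, 'n) fctr \<Rightarrow> ('o2, 'm2, 'p, 'n) fctr \<Rightarrow> ('w \<Rightarrow> 'n) \<Rightarrow> bool" where
  "homotopy_pullback P Q F G \<theta> \<longleftrightarrow>
     is_functor P \<and> is_functor Q \<and> is_functor F \<and> is_functor G \<and>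
     Src P = Src Q \<and> Tgt P = Src F \<and> Tgt Q = Src G \<and> Tgt F = Tgt G \<and>
     nat_iso (F \<circ>\<^sub>F P) (G \<circ>\<^sub>F Q) \<theta> \<and>
     is_equivalence (isocomma_pairing P Q F G \<theta>)"

section \<open>Cartesian and cocartesian lifts\<close>

definition fibre :: "('o, 'm, 'p, 'n) fctr \<Rightarrow> 'p \<Rightarrow> ('o, 'm) cat" where
  "fibre p b = (Src p)\<lparr>Ob := {x \<in> Ob (Src p). FO p x = b},
                       Ar := {f \<in> Ar (Src p). FA p f = Idn (Tgt p) b}\<rparr>"

definition cocartesian_arrow :: "('o, 'm, 'p, 'n) fctr \<Rightarrow> 'm \<Rightarrow> bool" where
  "cocartesian_arrow p e \<longleftrightarrow> e \<in> Ar (Src p) \<and>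
     (\<forall>g \<in> Ar (Src p). \<forall>v \<in> hom (Tgt p) (FO p (Cod (Src p) e)) (FO p (Cod (Src p) g)).
        Dom (Src p) g = Dom (Src p) e \<longrightarrow> v \<odot>\<^bsub>Tgt p\<^esub> FA p e = FA p g \<longrightarrow>
        (\<exists>!h. h \<in> hom (Src p) (Cod (Src p) e) (Cod (Src p) g) \<and> FA p h = v \<and>
              h \<odot>\<^bsub>Src p\<^esub> e = g))"

definition cartesian_arrow :: "('o, 'm, 'p, 'n) fctr \<Rightarrow> 'm \<Rightarrow> bool" where
  "cartesian_arrow p e \<longleftrightarrow> e \<in> Ar (Src p) \<and>
     (\<forall>g \<in> Ar (Src p). \<forall>v \<in> hom (Tgt p) (FO p (Dom (Src p) g)) (FO p (Dom (Src p) e)).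
        Cod (Src p) g = Cod (Src p) e \<longrightarrow> FA p e \<odot>\<^bsub>Tgt p\<^esub> v = FA p g \<longrightarrow>
        (\<exists>!h. h \<in> hom (Src p) (Dom (Src p) g) (Dom (Src p) e) \<and> FA p h = v \<and>
              e \<odot>\<^bsub>Src p\<^esub> h = g))"

definition cocartesian_fibration :: "('o, 'm, 'p, 'n) fctr \<Rightarrow> bool" where
  "cocartesian_fibration p \<longleftrightarrow> is_functor p \<and>
     (\<forall>f \<in> Ar (Tgt p). \<forall>x \<in> Ob (Src p). FO p x = Dom (Tgt p) f \<longrightarrow>
        (\<exists>e. cocartesian_arrow p e \<and> Dom (Src p) e = x \<and> FA p e = f))"

definition cartesian_over :: "('o, 'm, 'p, 'n) fctr \<Rightarrow> 'n set \<Rightarrow> bool" where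
  "cartesian_over p S \<longleftrightarrow>
     (\<forall>f \<in> S. \<forall>x \<in> Ob (Src p). FO p x = Cod (Tgt p) f \<longrightarrow>
        (\<exists>e. cartesian_arrow p e \<and> Cod (Src p) e = x \<and> FA p e = f))"

text \<open>The functors \<open>f\<^sub>!\<close> and \<open>f\<^sup>*\<close> between fibres depend on a choice of lifts, which is
  irrelevant up to unique isomorphism; it is made here once and for all with Hilbert choice.\<close>

definition cocart_lift :: "('o, 'm, 'p, 'n) fctr \<Rightarrow> 'n \<Rightarrow> 'o \<Rightarrow> 'm" where
  "cocart_lift p f x = (SOME e. cocartesian_arrow p e \<and> Dom (Src p) e = x \<and> FA p e = f)"

definition cart_lift :: "('o, 'm, 'p, 'n) fctr \<Rightarrow> 'n \<Rightarrow> 'o \<Rightarrow> 'm" where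
  "cart_lift p f x = (SOME e. cartesian_arrow p e \<and> Cod (Src p) e = x \<and> FA p e = f)"

definition push :: "('o, 'm, 'p, 'n) fctr \<Rightarrow> 'n \<Rightarrow> ('o, 'm, 'o, 'm) fctr" where
  "push p f =
    (let fo = (\<lambda>x. Cod (Src p) (cocart_lift p f x))
     in \<lparr>Src = fibre p (Dom (Tgt p) f), Tgt = fibre p (Cod (Tgt p) f), FO = fo,
         FA = (\<lambda>u. THE v.
            v \<in> hom (fibre p (Cod (Tgt p) f)) (fo (Dom (Src p) u)) (fo (Cod (Src p) u)) \<and>
            v \<odot>\<^bsub>Src p\<^esub> cocart_lift p f (Dom (Src p) u)
              = cocart_lift p f (Cod (Src p) u) \<odot>\<^bsub>Src p\<^esub> u)\<rparr>)"

definition pull :: "('o, 'm, 'p, 'n) fctr \<Rightarrow> 'n \<Rightarrow> ('o, 'm, 'o, 'm) fctr" where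
  "pull p f =
    (let fo = (\<lambda>x. Dom (Src p) (cart_lift p f x))
     in \<lparr>Src = fibre p (Cod (Tgt p) f), Tgt = fibre p (Dom (Tgt p) f), FO = fo,
         FA = (\<lambda>u. THE v.
            v \<in> hom (fibre p (Dom (Tgt p) f)) (fo (Dom (Src p) u)) (fo (Cod (Src p) u)) \<and>
            cart_lift p f (Cod (Src p) u) \<odot>\<^bsub>Src p\<^esub> v
              = u \<odot>\<^bsub>Src p\<^esub> cart_lift p f (Dom (Src p) u))\<rparr>)"

text \<open>For a square \<open>\<tau> \<odot> \<sigma>' = \<sigma> \<odot> \<tau>'\<close> in the base, the component at \<open>x\<close> of the comparison map
  \<open>\<sigma>'\<^sub>! \<tau>'\<^sup>* \<rightarrow> \<tau>\<^sup>* \<sigma>\<^sub>!\<close>: the unique vertical map through which the composite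
  \<open>\<tau>'\<^sup>* x \<rightarrow> x \<rightarrow> \<sigma>\<^sub>! x\<close> of lifts factors.\<close>

definition bc_comparison ::
    "('o, 'm, 'p, 'n) fctr \<Rightarrow> 'n \<Rightarrow> 'n \<Rightarrow> 'n \<Rightarrow> 'n \<Rightarrow> 'o \<Rightarrow> 'm" where
  "bc_comparison p \<tau>' \<sigma>' \<tau> \<sigma> x = (THE u.
     u \<in> hom (fibre p (Dom (Tgt p) \<tau>))
            (FO (push p \<sigma>' \<circ>\<^sub>F pull p \<tau>') x) (FO (pull p \<tau> \<circ>\<^sub>F push p \<sigma>) x) \<and>
     cart_lift p \<tau> (FO (push p \<sigma>) x) \<odot>\<^bsub>Src p\<^esub> u \<odot>\<^bsub>Src p\<^esub> cocart_lift p \<sigma>' (FO (pull p \<tau>') x)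
       = cocart_lift p \<sigma> x \<odot>\<^bsub>Src p\<^esub> cart_lift p \<tau>' x)"

section \<open>The simplex category and iesq sesquicartesian fibrations\<close>

text \<open>The object \<open>n\<close> stands for the ordered set \<open>{1..n}\<close>; \<open>n = 0\<close> is included. Maps are
  extensional functions.\<close>

definition Simplex :: "(nat, (nat, nat \<Rightarrow> nat) arrow) cat" where
  "Simplex =
    \<lparr>Ob = UNIV,
     Ar = {Arrow m f n | m f n. f \<in> {1..m} \<rightarrow>\<^sub>E {1..n} \<and> mono_on {1..m} f},
     Dom = src,
     Cod = tgt,
     Idn = (\<lambda>n. Arrow n (\<lambda>x\<in>{1..n}. x) n),
     Cmp = (\<lambda>g f. Arrow (src f) (compose {1..src f} (dat g) (dat f)) (tgt g))\<rparr>"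

definition convex_maps :: "(nat, nat \<Rightarrow> nat) arrow set" where
  "convex_maps = {j \<in> Ar Simplex. \<forall>x. 1 \<le> x \<and> x + 1 \<le> src j \<longrightarrow> dat j (x + 1) = dat j x + 1}"

definition beck_chevalley ::
    "('o, 'm, nat, (nat, nat \<Rightarrow> nat) arrow) fctr \<Rightarrow> bool" where
  "beck_chevalley p \<longleftrightarrow>
     (\<forall>\<tau>' \<sigma>' \<tau> \<sigma>. is_pullback Simplex \<tau>' \<sigma>' \<tau> \<sigma> \<and> \<tau> \<in> convex_maps \<longrightarrow>
        nat_iso (push p \<sigma>' \<circ>\<^sub>F pull p \<tau>') (pull p \<tau> \<circ>\<^sub>F push p \<sigma>)
          (bc_comparison p \<tau>' \<sigma>' \<tau> \<sigma>))"

definition sesquicartesian_fibration ::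
    "('o, 'm, nat, (nat, nat \<Rightarrow> nat) arrow) fctr \<Rightarrow> bool" where
  "sesquicartesian_fibration p \<longleftrightarrow> Tgt p = Simplex \<and>
     cocartesian_fibration p \<and> cartesian_over p convex_maps \<and> beck_chevalley p"

definition block_inclusion :: "nat \<Rightarrow> nat \<Rightarrow> nat \<Rightarrow> (nat, nat \<Rightarrow> nat) arrow" where
  "block_inclusion a n b = Arrow n (\<lambda>x\<in>{1..n}. a + x) (a + n + b)"

text \<open>The ordinal sum \<open>id\<^sub>a + f + id\<^sub>b\<close>.\<close>

definition identity_extension ::
    "nat \<Rightarrow> (nat, nat \<Rightarrow> nat) arrow \<Rightarrow> nat \<Rightarrow> (nat, nat \<Rightarrow> nat) arrow" where
  "identity_extension a f b =
     Arrow (a + src f + b)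
       (\<lambda>x\<in>{1..a + src f + b}.
          if x \<le> a then x
          else if x \<le> a + src f then a + dat f (x - a)
          else x - src f + tgt f)
       (a + tgt f + b)"

text \<open>Identity-extension squares are pullbacks along a convex map, so the 2-cell filling the
  square of fibres is the Beck--Chevalley comparison \<open>f\<^sub>! j\<^sup>* \<cong> i\<^sup>* g\<^sub>!\<close>.\<close>

definition iesq :: "('o, 'm, nat, (nat, nat \<Rightarrow> nat) arrow) fctr \<Rightarrow> bool" where
  "iesq p \<longleftrightarrow>
     (\<forall>a b. \<forall>f \<in> Ar Simplex.
        let j = block_inclusion a (src f) b;
            i = block_inclusion a (tgt f) b;
            g = identity_extension a f b
        in homotopy_pullback (pull p j) (push p g) (push p f) (pull p i)
             (bc_comparison p j f i g))"

section \<open>Restriction species\<close>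

text \<open>Finite sets are finite subsets of an ambient type \<open>'a\<close>; when \<open>'a\<close> is infinite, every
  finite set is in bijection with one of these.\<close>

definition FinInj :: "('a set, ('a set, 'a \<Rightarrow> 'a) arrow) cat" where
  "FinInj =
    \<lparr>Ob = {A. finite A},
     Ar = {Arrow A f B | A f B. finite A \<and> finite B \<and> f \<in> A \<rightarrow>\<^sub>E B \<and> inj_on f A},
     Dom = src,
     Cod = tgt,
     Idn = (\<lambda>A. Arrow A (\<lambda>x\<in>A. x) A),
     Cmp = (\<lambda>g f. Arrow (src f) (compose (src f) (dat g) (dat f)) (tgt g))\<rparr>"

text \<open>Contravariant pseudofunctor data on a base category:
  \<open>Unt A X : X \<rightarrow> R[id\<^sub>A] X\<close> and \<open>Mul g f X : R[f] (R[g] X) \<rightarrow> R[g \<odot> f] X\<close>.\<close>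

record ('b, 'n, 'o, 'm) pseudofctr =
  Val :: "'b \<Rightarrow> ('o, 'm) cat"
  Res :: "'n \<Rightarrow> ('o, 'm, 'o, 'm) fctr"
  Unt :: "'b \<Rightarrow> 'o \<Rightarrow> 'm"
  Mul :: "'n \<Rightarrow> 'n \<Rightarrow> 'o \<Rightarrow> 'm"

locale grpd_pseudofunctor =
  fixes B :: "('b, 'n) cat" and R :: "('b, 'n, 'o, 'm) pseudofctr"
  assumes base: "category B"
    and groupoid_val: "A \<in> Ob B \<Longrightarrow> groupoid (Val R A)"
    and restr: "f \<in> hom B A' A \<Longrightarrow>
      is_functor (Res R f) \<and> Src (Res R f) = Val R A \<and> Tgt (Res R f) = Val R A'"
    and unit: "A \<in> Ob B \<Longrightarrow> nat_iso (id_fctr (Val R A)) (Res R (Idn B A)) (Unt R A)"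
    and mult: "f \<in> hom B A'' A' \<Longrightarrow> g \<in> hom B A' A \<Longrightarrow>
      nat_iso (Res R f \<circ>\<^sub>F Res R g) (Res R (g \<odot>\<^bsub>B\<^esub> f)) (Mul R g f)"
    and unit_left: "f \<in> hom B A' A \<Longrightarrow> X \<in> Ob (Val R A) \<Longrightarrow>
      Mul R (Idn B A) f X \<odot>\<^bsub>Val R A'\<^esub> FA (Res R f) (Unt R A X) = Idn (Val R A') (FO (Res R f) X)"
    and unit_right: "f \<in> hom B A' A \<Longrightarrow> X \<in> Ob (Val R A) \<Longrightarrow>
      Mul R f (Idn B A') X \<odot>\<^bsub>Val R A'\<^esub> Unt R A' (FO (Res R f) X) = Idn (Val R A') (FO (Res R f) X)"
    and mult_assoc: "f \<in> hom B A\<^sub>0 A\<^sub>1 \<Longrightarrow> g \<in> hom B A\<^sub>1 A\<^sub>2 \<Longrightarrow> h \<in> hom B A\<^sub>2 A\<^sub>3 \<Longrightarrow>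
      X \<in> Ob (Val R A\<^sub>3) \<Longrightarrow>
      Mul R h (g \<odot>\<^bsub>B\<^esub> f) X \<odot>\<^bsub>Val R A\<^sub>0\<^esub> Mul R g f (FO (Res R h) X)
        = Mul R (h \<odot>\<^bsub>B\<^esub> g) f X \<odot>\<^bsub>Val R A\<^sub>0\<^esub> FA (Res R f) (Mul R h g X)"

definition restriction_species ::
    "('a set, ('a set, 'a \<Rightarrow> 'a) arrow, 'o, 'm) pseudofctr \<Rightarrow> bool" where
  "restriction_species R \<longleftrightarrow> grpd_pseudofunctor FinInj R \<and>
     (\<forall>A. finite A \<longrightarrow> (\<forall>X \<in> Ob (Val R A). finite (hom (Val R A) X X)))"

text \<open>Values are groupoids, so the second component of an arrow is automatically an
  isomorphism \<open>X' \<cong> R[f] X\<close>.\<close>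

definition grothendieck ::
    "('b, 'n) cat \<Rightarrow> ('b, 'n, 'o, 'm) pseudofctr \<Rightarrow>
     ('b \<times> 'o, ('b \<times> 'o, 'n \<times> 'm) arrow) cat" where
  "grothendieck B R =
    (let obs = {(A, X). A \<in> Ob B \<and> X \<in> Ob (Val R A)}
     in \<lparr>Ob = obs,
         Ar = {Arrow (A', X') (f, \<phi>) (A, X) | A' X' f \<phi> A X.
                 (A', X') \<in> obs \<and> (A, X) \<in> obs \<and>
                 f \<in> hom B A' A \<and> \<phi> \<in> hom (Val R A') X' (FO (Res R f) X)},
         Dom = src,
         Cod = tgt,
         Idn = (\<lambda>(A, X). Arrow (A, X) (Idn B A, Unt R A X) (A, X)),
         Cmp = (\<lambda>s t. case (s, t) of
                  (Arrow _ (g, \<psi>) (A, X), Arrow (A'', X'') (f, \<phi>) _) \<Rightarrow>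
                    Arrow (A'', X'')
                      (g \<odot>\<^bsub>B\<^esub> f,
                       Mul R g f X \<odot>\<^bsub>Val R A''\<^esub> FA (Res R f) \<psi> \<odot>\<^bsub>Val R A''\<^esub> \<phi>)
                      (A, X))\<rparr>)"

definition grothendieck_proj ::
    "('b, 'n) cat \<Rightarrow> ('b, 'n, 'o, 'm) pseudofctr \<Rightarrow>
     ('b \<times> 'o, ('b \<times> 'o, 'n \<times> 'm) arrow, 'b, 'n) fctr" where
  "grothendieck_proj B R =
     \<lparr>Src = grothendieck B R, Tgt = B, FO = fst, FA = (\<lambda>s. fst (dat s))\<rparr>"

text \<open>The comma category over posets of \<open>U : E \<rightarrow> FinInj\<close> and the simplex category. Monotone
  maps out of a discrete poset are arbitrary (extensional) functions.\<close>

definition comma_simplex ::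
    "('e, 'n, 'a set, ('a set, 'a \<Rightarrow> 'a) arrow) fctr \<Rightarrow>
     ('e \<times> nat \<times> ('a \<Rightarrow> nat),
      ('e \<times> nat \<times> ('a \<Rightarrow> nat), 'n \<times> (nat, nat \<Rightarrow> nat) arrow) arrow) cat" where
  "comma_simplex U =
    (let obs = {(c, k, \<alpha>). c \<in> Ob (Src U) \<and> k \<in> Ob Simplex \<and> \<alpha> \<in> FO U c \<rightarrow>\<^sub>E {1..k}}
     in \<lparr>Ob = obs,
         Ar = {Arrow (c, k, \<alpha>) (\<rho>, h) (c', k', \<alpha>') | c k \<alpha> \<rho> h c' k' \<alpha>'.
                 (c, k, \<alpha>) \<in> obs \<and> (c', k', \<alpha>') \<in> obs \<and>
                 \<rho> \<in> hom (Src U) c c' \<and> h \<in> hom Simplex k k' \<and>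
                 (\<forall>x \<in> FO U c. \<alpha>' (dat (FA U \<rho>) x) = dat h (\<alpha> x))},
         Dom = src,
         Cod = tgt,
         Idn = (\<lambda>(c, k, \<alpha>). Arrow (c, k, \<alpha>) (Idn (Src U) c, Idn Simplex k) (c, k, \<alpha>)),
         Cmp = (\<lambda>g f. Arrow (src f)
                  (fst (dat g) \<odot>\<^bsub>Src U\<^esub> fst (dat f), snd (dat g) \<odot>\<^bsub>Simplex\<^esub> snd (dat f)) (tgt g))\<rparr>)"

definition comma_simplex_proj ::
    "('e, 'n, 'a set, ('a set, 'a \<Rightarrow> 'a) arrow) fctr \<Rightarrow>
     ('e \<times> nat \<times> ('a \<Rightarrow> nat),
      ('e \<times> nat \<times> ('a \<Rightarrow> nat), 'n \<times> (nat, nat \<Rightarrow> nat) arrow) arrow,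
      nat, (nat, nat \<Rightarrow> nat) arrow) fctr" where
  "comma_simplex_proj U =
     \<lparr>Src = comma_simplex U, Tgt = Simplex,
      FO = (\<lambda>(c, k, \<alpha>). k), FA = (\<lambda>s. snd (dat s))\<rparr>"

end

theory Submission
  imports Defs
begin

text \<open>
  Write \<open>\<rho>\<close> for the component of an arrow of the comma category in the total category of the right
  fibration, and \<open>h\<close> for its component in the simplex category. An arrow is cocartesian iff \<open>\<rho>\<close> is
  invertible; over a convex, hence injective, \<open>h\<close> it is cartesian iff the injection under \<open>\<rho>\<close> has
  image the preimage of the image of \<open>h\<close>. Since an arrow of a right fibration over finite injections
  is invertible as soon as its underlying injection is surjective, Beck--Chevalley reduces to the
  fact that the image of \<open>\<tau>'\<close> is the preimage under \<open>\<sigma>\<close> of the image of \<open>\<tau>\<close>. For an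
  identity-extension square the pairing into the isocomma category is an equivalence: a map to
  \<open>a + k + b\<close> together with a lift along \<open>f\<close> of its middle part glues to a map to \<open>a + n + b\<close>,
  because \<open>id\<^sub>a + f + id\<^sub>b\<close> is injective outside the middle block.
\<close>

section \<open>Categories and functors\<close>

text \<open>The pseudo-functor enters through two consequences collected in
  \<open>right_fibration\<close>: injections lift with prescribed target, and every arrow of the
  total category is cartesian. The second holds because multiplications and restricted arrows are
  invertible in the groupoids. Since injections are monic, it turns factorization in the total
  category into inclusion of images; this is why surjectivity decides invertibility. The obstacle is
  that \<open>push\<close> and \<open>pull\<close> are built from lifts picked by Hilbert choice, of
  which only the universal property is known. Explicit lifts are therefore constructed, and their
  concrete features (invertible \<open>rho\<close>, full image) are transferred to arbitrary lifts
  along the vertical isomorphism between two lifts. What remains are element chases on underlying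
  sets and one cancellation principle, \<open>push_pull_cancel\<close>. Beck-Chevalley assumes
  convexity of \<tau> alone, so convexity of \<tau>' has to be derived before cartesian lifts along
  it are available.\<close>

lemma hom_Dom: "f \<in> hom C x y \<Longrightarrow> Dom C f = x"
  and hom_Cod: "f \<in> hom C x y \<Longrightarrow> Cod C f = y"
  and hom_Ar: "f \<in> hom C x y \<Longrightarrow> f \<in> Ar C"
  by (auto simp: hom_def)

lemma Ar_hom: "f \<in> Ar C \<Longrightarrow> f \<in> hom C (Dom C f) (Cod C f)"
  by (simp add: hom_def)

lemma iso_arrow_iff:
  assumes "f \<in> hom C x y"
  shows "iso_arrow C f \<longleftrightarrow> (\<exists>g \<in> hom C y x. g \<odot>\<^bsub>C\<^esub> f = Idn C x \<and> f \<odot>\<^bsub>C\<^esub> g = Idn C y)"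
  using assms by (auto simp: iso_arrow_def hom_def)

lemma iso_arrow_inverse:
  assumes "iso_arrow C f" "f \<in> hom C x y"
  shows "\<exists>g \<in> hom C y x. g \<odot>\<^bsub>C\<^esub> f = Idn C x \<and> f \<odot>\<^bsub>C\<^esub> g = Idn C y \<and> iso_arrow C g"
  using assms iso_arrow_iff by metis

context category
begin

lemma hom_Ob1: "f \<in> hom C x y \<Longrightarrow> x \<in> Ob C"
  and hom_Ob2: "f \<in> hom C x y \<Longrightarrow> y \<in> Ob C"
  using Dom_in Cod_in by (auto simp: hom_def)

lemma iso_Idn: "x \<in> Ob C \<Longrightarrow> iso_arrow C (Idn C x)"
  using Idn_in[of x] Idn_left[OF Idn_in[of x]] iso_arrow_iff[of "Idn C x" C x x] by auto

lemma iso_Cmp: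
  assumes f: "f \<in> hom C x y" "iso_arrow C f" and g: "g \<in> hom C y z" "iso_arrow C g"
  shows "iso_arrow C (g \<odot> f)"
proof -
  obtain f' where f': "f' \<in> hom C y x" "f' \<odot> f = Idn C x" "f \<odot> f' = Idn C y"
    using iso_arrow_inverse[OF f(2,1)] by blast
  obtain g' where g': "g' \<in> hom C z y" "g' \<odot> g = Idn C y" "g \<odot> g' = Idn C z"
    using iso_arrow_inverse[OF g(2,1)] by blast
  have "(f' \<odot> g') \<odot> (g \<odot> f) = f' \<odot> ((g' \<odot> g) \<odot> f)"
    by (simp only: assoc[OF Cmp_in[OF f(1) g(1)] g'(1) f'(1), symmetric] assoc[OF f(1) g(1) g'(1)])
  also have "\<dots> = Idn C x"
    by (simp only: g'(2) f'(2) Idn_left[OF f(1)])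
  finally have 1: "(f' \<odot> g') \<odot> (g \<odot> f) = Idn C x" .
  have "(g \<odot> f) \<odot> (f' \<odot> g') = g \<odot> ((f \<odot> f') \<odot> g')"
    by (simp only: assoc[OF Cmp_in[OF g'(1) f'(1)] f(1) g(1), symmetric] assoc[OF g'(1) f'(1) f(1)])
  also have "\<dots> = Idn C z"
    by (simp only: f'(3) g'(3) Idn_left[OF g'(1)])
  finally show ?thesis
    using 1 iso_arrow_iff[OF Cmp_in[OF f(1) g(1)]] Cmp_in[OF g'(1) f'(1)] by blast
qed

lemma iso_cancel_left:
  assumes "iso_arrow C e" "e \<in> hom C y z" "f \<in> hom C x y" "g \<in> hom C x y" "e \<odot> f = e \<odot> g"
  shows "f = g"
proof -
  obtain e' where e': "e' \<in> hom C z y" "e' \<odot> e = Idn C y"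
    using iso_arrow_inverse[OF assms(1,2)] by blast
  have "e' \<odot> (e \<odot> f) = f" "e' \<odot> (e \<odot> g) = g"
    unfolding assoc[OF assms(3,2) e'(1)] assoc[OF assms(4,2) e'(1)] e'(2)
    by (simp_all only: Idn_left[OF assms(3)] Idn_left[OF assms(4)])
  then show ?thesis using assms(5) by metis
qed

lemma iso_cancel_right:
  assumes "iso_arrow C e" "e \<in> hom C x y" "f \<in> hom C y z" "g \<in> hom C y z" "f \<odot> e = g \<odot> e"
  shows "f = g"
proof -
  obtain e' where e': "e' \<in> hom C y x" "e \<odot> e' = Idn C y"
    using iso_arrow_inverse[OF assms(1,2)] by blast
  have "(f \<odot> e) \<odot> e' = f" "(g \<odot> e) \<odot> e' = g"
    unfolding assoc[OF e'(1) assms(2,3), symmetric] assoc[OF e'(1) assms(2,4), symmetric] e'(2)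
    by (simp_all only: Idn_right[OF assms(3)] Idn_right[OF assms(4)])
  then show ?thesis using assms(5) by metis
qed

lemma iso_factor_left:
  assumes "iso_arrow C e" "e \<in> hom C y z" "g \<in> hom C x z"
  shows "\<exists>f \<in> hom C x y. e \<odot> f = g"
proof -
  obtain e' where "e' \<in> hom C z y" "e \<odot> e' = Idn C z"
    using iso_arrow_inverse[OF assms(1,2)] by blast
  then show ?thesis
    using assoc[OF assms(3) _ assms(2), of e'] Idn_left[OF assms(3)]
      Cmp_in[OF assms(3), of e'] by metis
qed

lemma iso_factor_right:
  assumes "iso_arrow C e" "e \<in> hom C x y" "g \<in> hom C x z"
  shows "\<exists>f \<in> hom C y z. f \<odot> e = g"
proof -
  obtain e' where "e' \<in> hom C y x" "e' \<odot> e = Idn C x"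
    using iso_arrow_inverse[OF assms(1,2)] by blast
  then show ?thesis
    using assoc[OF assms(2) _ assms(3), of e'] Idn_right[OF assms(3)]
      Cmp_in[OF _ assms(3), of e'] by metis
qed

end

lemma is_functor_category_Src: "is_functor F \<Longrightarrow> category (Src F)"
  and is_functor_category_Tgt: "is_functor F \<Longrightarrow> category (Tgt F)"
  and is_functor_Ob: "is_functor F \<Longrightarrow> x \<in> Ob (Src F) \<Longrightarrow> FO F x \<in> Ob (Tgt F)"
  and is_functor_Idn: "is_functor F \<Longrightarrow> x \<in> Ob (Src F) \<Longrightarrow>
    FA F (Idn (Src F) x) = Idn (Tgt F) (FO F x)"
  by (auto simp: is_functor_def)

lemma is_functor_hom:
  "is_functor F \<Longrightarrow> f \<in> hom (Src F) x y \<Longrightarrow> FA F f \<in> hom (Tgt F) (FO F x) (FO F y)"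
  by (auto simp: is_functor_def hom_def)

lemma is_functor_Cmp:
  "is_functor F \<Longrightarrow> f \<in> hom (Src F) x y \<Longrightarrow> g \<in> hom (Src F) y z \<Longrightarrow>
    FA F (g \<odot>\<^bsub>Src F\<^esub> f) = FA F g \<odot>\<^bsub>Tgt F\<^esub> FA F f"
  by (auto simp: is_functor_def hom_def)

lemma is_functorI:
  assumes "category (Src F)" "category (Tgt F)"
    and "\<And>x. x \<in> Ob (Src F) \<Longrightarrow> FO F x \<in> Ob (Tgt F)"
    and "\<And>f x y. f \<in> hom (Src F) x y \<Longrightarrow> FA F f \<in> hom (Tgt F) (FO F x) (FO F y)"
    and "\<And>x. x \<in> Ob (Src F) \<Longrightarrow> FA F (Idn (Src F) x) = Idn (Tgt F) (FO F x)"
    and "\<And>f g x y z. f \<in> hom (Src F) x y \<Longrightarrow> g \<in> hom (Src F) y z \<Longrightarrow>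
      FA F (g \<odot>\<^bsub>Src F\<^esub> f) = FA F g \<odot>\<^bsub>Tgt F\<^esub> FA F f"
  shows "is_functor F"
  unfolding is_functor_def using assms by (auto intro: Ar_hom simp: hom_def)

lemma id_fctr_simps [simp]:
  "Src (id_fctr C) = C" "Tgt (id_fctr C) = C" "FO (id_fctr C) = (\<lambda>x. x)"
  "FA (id_fctr C) = (\<lambda>x. x)"
  by (simp_all add: id_fctr_def)

lemma is_functor_id: "category C \<Longrightarrow> is_functor (id_fctr C)"
  by (rule is_functorI) (auto simp: hom_def category.Dom_in category.Cod_in)

lemma comp_fctr_simps [simp]:
  "Src (G \<circ>\<^sub>F F) = Src F" "Tgt (G \<circ>\<^sub>F F) = Tgt G" "FO (G \<circ>\<^sub>F F) x = FO G (FO F x)"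
  "FA (G \<circ>\<^sub>F F) f = FA G (FA F f)"
  by (simp_all add: comp_fctr_def)

lemma is_functor_comp:
  assumes F: "is_functor F" and G: "is_functor G" and FG: "Tgt F = Src G"
  shows "is_functor (G \<circ>\<^sub>F F)"
proof (rule is_functorI; simp)
  note G' = is_functor_Ob[OF G, folded FG] is_functor_hom[OF G, folded FG]
    is_functor_Idn[OF G, folded FG] is_functor_Cmp[OF G, folded FG]
  show "FO G (FO F x) \<in> Ob (Tgt G)" if "x \<in> Ob (Src F)" for x
    using that by (intro G' is_functor_Ob[OF F])
  show "FA G (FA F f) \<in> hom (Tgt G) (FO G (FO F x)) (FO G (FO F y))"
    if "f \<in> hom (Src F) x y" for f x y
    using that by (intro G' is_functor_hom[OF F])
  show "FA G (FA F (Idn (Src F) x)) = Idn (Tgt G) (FO G (FO F x))" if "x \<in> Ob (Src F)" for x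
    using that by (simp add: is_functor_Idn[OF F] G' is_functor_Ob[OF F])
  show "FA G (FA F (g \<odot>\<^bsub>Src F\<^esub> f)) = FA G (FA F g) \<odot>\<^bsub>Tgt G\<^esub> FA G (FA F f)"
    if "f \<in> hom (Src F) x y" "g \<in> hom (Src F) y z" for f g x y z
    using that by (simp add: is_functor_Cmp[OF F that] G'(4)[OF is_functor_hom[OF F] is_functor_hom[OF F]])
qed (use F G in \<open>auto intro: is_functor_category_Src is_functor_category_Tgt\<close>)

lemma nat_isoI:
  assumes "is_functor F" "is_functor G" "Src F = Src G" "Tgt F = Tgt G"
    and "\<And>x. x \<in> Ob (Src F) \<Longrightarrow> \<eta> x \<in> hom (Tgt F) (FO F x) (FO G x)"
    and "\<And>x. x \<in> Ob (Src F) \<Longrightarrow> iso_arrow (Tgt F) (\<eta> x)"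
    and "\<And>f x y. f \<in> hom (Src F) x y \<Longrightarrow> FA G f \<odot>\<^bsub>Tgt F\<^esub> \<eta> x = \<eta> y \<odot>\<^bsub>Tgt F\<^esub> FA F f"
  shows "nat_iso F G \<eta>"
  unfolding nat_iso_def using assms(1-6) assms(7)[OF Ar_hom] assms(3) by auto

lemma nat_iso_hom: "nat_iso F G \<eta> \<Longrightarrow> x \<in> Ob (Src F) \<Longrightarrow> \<eta> x \<in> hom (Tgt F) (FO F x) (FO G x)"
  and nat_iso_iso: "nat_iso F G \<eta> \<Longrightarrow> x \<in> Ob (Src F) \<Longrightarrow> iso_arrow (Tgt F) (\<eta> x)"
  by (auto simp: nat_iso_def)

lemma nat_iso_natural:
  "nat_iso F G \<eta> \<Longrightarrow> f \<in> hom (Src F) x y \<Longrightarrow> FA G f \<odot>\<^bsub>Tgt F\<^esub> \<eta> x = \<eta> y \<odot>\<^bsub>Tgt F\<^esub> FA F f"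
  by (auto simp: nat_iso_def hom_def)

text \<open>A quasi-inverse is assembled by choice: objects from essential surjectivity, which also
  supplies \<epsilon>; arrows from fullness, as solutions of the naturality equation for \<epsilon>,
  unique by faithfulness. The unit is a preimage under \<open>F\<close> of the inverse of
  \<epsilon>.\<close>

lemma is_equivalence_if_fully_faithful_ess_surj:
  assumes F: "is_functor F"
    and faithful: "\<And>x y f g. f \<in> hom (Src F) x y \<Longrightarrow> g \<in> hom (Src F) x y \<Longrightarrow> FA F f = FA F g \<Longrightarrow> f = g"
    and full: "\<And>x y h. x \<in> Ob (Src F) \<Longrightarrow> y \<in> Ob (Src F) \<Longrightarrow> h \<in> hom (Tgt F) (FO F x) (FO F y) \<Longrightarrow>
      \<exists>f \<in> hom (Src F) x y. FA F f = h"
    and ess_surj: "\<And>d. d \<in> Ob (Tgt F) \<Longrightarrow>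
      \<exists>x \<in> Ob (Src F). \<exists>e \<in> hom (Tgt F) (FO F x) d. iso_arrow (Tgt F) e"
  shows "is_equivalence F"
proof -
  interpret C: category "Src F" using F by (rule is_functor_category_Src)
  interpret D: category "Tgt F" using F by (rule is_functor_category_Tgt)
  note Fhom = is_functor_hom[OF F] and FCmp = is_functor_Cmp[OF F] and FIdn = is_functor_Idn[OF F]
  have "\<forall>d. \<exists>x e. d \<in> Ob (Tgt F) \<longrightarrow> x \<in> Ob (Src F) \<and> e \<in> hom (Tgt F) (FO F x) d \<and> iso_arrow (Tgt F) e"
    using ess_surj by metis
  then obtain go \<epsilon> where go: "\<And>d. d \<in> Ob (Tgt F) \<Longrightarrow> go d \<in> Ob (Src F)"
    and \<epsilon>: "\<And>d. d \<in> Ob (Tgt F) \<Longrightarrow> \<epsilon> d \<in> hom (Tgt F) (FO F (go d)) d"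
    and \<epsilon>_iso: "\<And>d. d \<in> Ob (Tgt F) \<Longrightarrow> iso_arrow (Tgt F) (\<epsilon> d)"
    by metis
  have "\<exists>u. h \<in> hom (Tgt F) d d' \<longrightarrow> u \<in> hom (Src F) (go d) (go d') \<and>
      \<epsilon> d' \<odot>\<^bsub>Tgt F\<^esub> FA F u = h \<odot>\<^bsub>Tgt F\<^esub> \<epsilon> d" for h d d'
  proof (cases "h \<in> hom (Tgt F) d d'")
    case True
    then have d: "d \<in> Ob (Tgt F)" "d' \<in> Ob (Tgt F)"
      by (auto intro: D.hom_Ob1 D.hom_Ob2)
    obtain k where "k \<in> hom (Tgt F) (FO F (go d)) (FO F (go d'))"
      "\<epsilon> d' \<odot>\<^bsub>Tgt F\<^esub> k = h \<odot>\<^bsub>Tgt F\<^esub> \<epsilon> d"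
      using D.iso_factor_left[OF \<epsilon>_iso \<epsilon> D.Cmp_in[OF \<epsilon> True]] d by metis
    then show ?thesis using full[OF go go] d by metis
  qed auto
  \<comment> \<open>\<open>d\<close> and \<open>d'\<close> are the domain and codomain of
    \<open>h\<close>, so the solution can be chosen as a function of \<open>h\<close> alone.\<close>
  then have "\<forall>h. \<exists>u. \<forall>d d'. h \<in> hom (Tgt F) d d' \<longrightarrow> u \<in> hom (Src F) (go d) (go d') \<and>
      \<epsilon> d' \<odot>\<^bsub>Tgt F\<^esub> FA F u = h \<odot>\<^bsub>Tgt F\<^esub> \<epsilon> d"
    by (metis hom_Cod hom_Dom)
  then obtain ga where ga: "\<And>h d d'. h \<in> hom (Tgt F) d d' \<Longrightarrow> ga h \<in> hom (Src F) (go d) (go d')"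
    and ga_eq: "\<And>h d d'. h \<in> hom (Tgt F) d d' \<Longrightarrow> \<epsilon> d' \<odot>\<^bsub>Tgt F\<^esub> FA F (ga h) = h \<odot>\<^bsub>Tgt F\<^esub> \<epsilon> d"
    by metis
  have ga_unique: "ga h = u" if "h \<in> hom (Tgt F) d d'" "u \<in> hom (Src F) (go d) (go d')"
    "\<epsilon> d' \<odot>\<^bsub>Tgt F\<^esub> FA F u = h \<odot>\<^bsub>Tgt F\<^esub> \<epsilon> d" for h u d d'
    using faithful[OF ga that(2)] D.iso_cancel_left[OF \<epsilon>_iso \<epsilon> Fhom[OF ga] Fhom] that ga_eq
    by (metis D.hom_Ob2)
  define G where "G = \<lparr>Src = Tgt F, Tgt = Src F, FO = go, FA = ga\<rparr>"
  have G_simps [simp]: "Src G = Tgt F" "Tgt G = Src F" "FO G = go" "FA G = ga"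
    by (simp_all add: G_def)
  have G: "is_functor G"
  proof (rule is_functorI; simp; (elim conjE)?)
    show "ga (Idn (Tgt F) d) = Idn (Src F) (go d)" if d: "d \<in> Ob (Tgt F)" for d
      using ga_unique[OF D.Idn_in[OF d] C.Idn_in[OF go[OF d]]] FIdn[OF go[OF d]]
        D.Idn_left[OF \<epsilon>] D.Idn_right[OF \<epsilon>] d by metis
    show "ga (g \<odot>\<^bsub>Tgt F\<^esub> f) = ga g \<odot>\<^bsub>Src F\<^esub> ga f"
      if f: "f \<in> hom (Tgt F) x y" and g: "g \<in> hom (Tgt F) y z" for f g x y z
    proof (rule ga_unique[OF D.Cmp_in[OF f g] C.Cmp_in[OF ga[OF f] ga[OF g]]])
      have Ob: "x \<in> Ob (Tgt F)" "y \<in> Ob (Tgt F)" "z \<in> Ob (Tgt F)"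
        using f g by (auto intro: D.hom_Ob1 D.hom_Ob2)
      show "\<epsilon> z \<odot>\<^bsub>Tgt F\<^esub> FA F (ga g \<odot>\<^bsub>Src F\<^esub> ga f) = (g \<odot>\<^bsub>Tgt F\<^esub> f) \<odot>\<^bsub>Tgt F\<^esub> \<epsilon> x"
        using ga_eq[OF f] ga_eq[OF g] FCmp[OF ga[OF f] ga[OF g]]
          D.assoc[OF Fhom[OF ga[OF f]] Fhom[OF ga[OF g]] \<epsilon>[OF Ob(3)]]
          D.assoc[OF Fhom[OF ga[OF f]] \<epsilon>[OF Ob(2)] g] D.assoc[OF \<epsilon>[OF Ob(1)] f g]
        by metis
    qed
  qed (use C.category_axioms D.category_axioms go ga in auto)
  have FG: "nat_iso (F \<circ>\<^sub>F G) (id_fctr (Tgt F)) \<epsilon>"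
    by (rule nat_isoI)
      (use is_functor_comp[OF G F] is_functor_id[OF D.category_axioms] \<epsilon> \<epsilon>_iso ga_eq in auto)
  have FO: "FO F x \<in> Ob (Tgt F)" if "x \<in> Ob (Src F)" for x
    using F that by (rule is_functor_Ob)
  have "\<forall>x. \<exists>u. x \<in> Ob (Src F) \<longrightarrow> u \<in> hom (Src F) x (go (FO F x)) \<and>
      \<epsilon> (FO F x) \<odot>\<^bsub>Tgt F\<^esub> FA F u = Idn (Tgt F) (FO F x)"
    using full[OF _ go] FO D.iso_factor_left[OF \<epsilon>_iso \<epsilon> D.Idn_in] by (metis (no_types))
  then obtain \<eta> where \<eta>: "\<And>x. x \<in> Ob (Src F) \<Longrightarrow> \<eta> x \<in> hom (Src F) x (go (FO F x))"
    and \<eta>_eq: "\<And>x. x \<in> Ob (Src F) \<Longrightarrow> \<epsilon> (FO F x) \<odot>\<^bsub>Tgt F\<^esub> FA F (\<eta> x) = Idn (Tgt F) (FO F x)"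
    by metis
  \<comment> \<open>Arrows into \<open>go (FO F y)\<close> can be compared after applying
    \<open>F\<close> and composing with the invertible \<epsilon>. This settles naturality of \<eta>
    and one of the two inverse laws.\<close>
  have cancel: "f = g" if "y \<in> Ob (Src F)" "f \<in> hom (Src F) x (go (FO F y))"
      "g \<in> hom (Src F) x (go (FO F y))"
      "\<epsilon> (FO F y) \<odot>\<^bsub>Tgt F\<^esub> FA F f = \<epsilon> (FO F y) \<odot>\<^bsub>Tgt F\<^esub> FA F g" for x y f g
    using faithful[OF that(2,3)] D.iso_cancel_left[OF \<epsilon>_iso \<epsilon> Fhom[OF that(2)] Fhom[OF that(3)]]
      that FO by blast
  have GF: "nat_iso (id_fctr (Src F)) (G \<circ>\<^sub>F F) \<eta>"
  proof (rule nat_isoI; (simp only: id_fctr_simps comp_fctr_simps G_simps)?)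
    show "iso_arrow (Src F) (\<eta> x)" if x: "x \<in> Ob (Src F)" for x
    proof -
      \<comment> \<open>The inverse of \<open>\<eta> x\<close> is a preimage of
        \<open>\<epsilon> (FO F x)\<close> under \<open>F\<close>.\<close>
      obtain v where v: "v \<in> hom (Src F) (go (FO F x)) x" "FA F v = \<epsilon> (FO F x)"
        using full[OF go x \<epsilon>] FO x by blast
      have "v \<odot>\<^bsub>Src F\<^esub> \<eta> x = Idn (Src F) x"
        using faithful[OF C.Cmp_in[OF \<eta> v(1)] C.Idn_in] FCmp[OF \<eta> v(1)] v(2) \<eta>_eq FIdn x by metis
      moreover have "\<eta> x \<odot>\<^bsub>Src F\<^esub> v = Idn (Src F) (go (FO F x))"
      proof (rule cancel[OF x C.Cmp_in[OF v(1) \<eta>[OF x]] C.Idn_in[OF go[OF FO[OF x]]]])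
        have "\<epsilon> (FO F x) \<odot>\<^bsub>Tgt F\<^esub> FA F (\<eta> x \<odot>\<^bsub>Src F\<^esub> v) = Idn (Tgt F) (FO F x) \<odot>\<^bsub>Tgt F\<^esub> \<epsilon> (FO F x)"
          using FCmp[OF v(1) \<eta>[OF x]] v(2) \<eta>_eq[OF x]
            D.assoc[OF Fhom[OF v(1)] Fhom[OF \<eta>[OF x]] \<epsilon>[OF FO[OF x]]] by metis
        then show "\<epsilon> (FO F x) \<odot>\<^bsub>Tgt F\<^esub> FA F (\<eta> x \<odot>\<^bsub>Src F\<^esub> v)
            = \<epsilon> (FO F x) \<odot>\<^bsub>Tgt F\<^esub> FA F (Idn (Src F) (go (FO F x)))"
          using D.Idn_left[OF \<epsilon>] D.Idn_right[OF \<epsilon>] FIdn[OF go] FO x by metis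
      qed
      ultimately show ?thesis using iso_arrow_iff[OF \<eta>[OF x]] v(1) by blast
    qed
    show "ga (FA F f) \<odot>\<^bsub>Src F\<^esub> \<eta> x = \<eta> y \<odot>\<^bsub>Src F\<^esub> f" if f: "f \<in> hom (Src F) x y" for f x y
    proof -
      have x: "x \<in> Ob (Src F)" and y: "y \<in> Ob (Src F)"
        using f by (auto intro: C.hom_Ob1 C.hom_Ob2)
      note gf = ga[OF Fhom[OF f]]
      show ?thesis
      proof (rule cancel[OF y C.Cmp_in[OF \<eta>[OF x] gf] C.Cmp_in[OF f \<eta>[OF y]]])
        have "\<epsilon> (FO F y) \<odot>\<^bsub>Tgt F\<^esub> FA F (ga (FA F f) \<odot>\<^bsub>Src F\<^esub> \<eta> x)
            = (\<epsilon> (FO F y) \<odot>\<^bsub>Tgt F\<^esub> FA F (ga (FA F f))) \<odot>\<^bsub>Tgt F\<^esub> FA F (\<eta> x)"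
          using FCmp[OF \<eta>[OF x] gf] D.assoc[OF Fhom[OF \<eta>[OF x]] Fhom[OF gf] \<epsilon>[OF FO[OF y]]] by metis
        also have "\<dots> = FA F f \<odot>\<^bsub>Tgt F\<^esub> (\<epsilon> (FO F x) \<odot>\<^bsub>Tgt F\<^esub> FA F (\<eta> x))"
          using ga_eq[OF Fhom[OF f]] D.assoc[OF Fhom[OF \<eta>[OF x]] \<epsilon>[OF FO[OF x]] Fhom[OF f]] by metis
        also have "\<dots> = (\<epsilon> (FO F y) \<odot>\<^bsub>Tgt F\<^esub> FA F (\<eta> y)) \<odot>\<^bsub>Tgt F\<^esub> FA F f"
          using \<eta>_eq x y D.Idn_left[OF Fhom[OF f]] D.Idn_right[OF Fhom[OF f]] by metis
        also have "\<dots> = \<epsilon> (FO F y) \<odot>\<^bsub>Tgt F\<^esub> FA F (\<eta> y \<odot>\<^bsub>Src F\<^esub> f)"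
          using FCmp[OF f \<eta>[OF y]] D.assoc[OF Fhom[OF f] Fhom[OF \<eta>[OF y]] \<epsilon>[OF FO[OF y]]] by metis
        finally show "\<epsilon> (FO F y) \<odot>\<^bsub>Tgt F\<^esub> FA F (ga (FA F f) \<odot>\<^bsub>Src F\<^esub> \<eta> x)
          = \<epsilon> (FO F y) \<odot>\<^bsub>Tgt F\<^esub> FA F (\<eta> y \<odot>\<^bsub>Src F\<^esub> f)" .
      qed
    qed
  qed (use is_functor_comp[OF F G] is_functor_id[OF C.category_axioms] \<eta> in auto)
  show ?thesis
    unfolding is_equivalence_def using F G FG GF G_simps(1,2) by blast
qed

section \<open>Isocomma categories\<close>

context
  fixes F :: "('o1, 'm1, 'p, 'n) fctr" and G :: "('o2, 'm2, 'p, 'n) fctr"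
  assumes F: "is_functor F" and G: "is_functor G" and FG: "Tgt F = Tgt G"
begin

lemma isocomma_Ob: "(c, d, \<theta>) \<in> Ob (isocomma F G) \<longleftrightarrow>
    c \<in> Ob (Src F) \<and> d \<in> Ob (Src G) \<and> \<theta> \<in> hom (Tgt F) (FO F c) (FO G d) \<and> iso_arrow (Tgt F) \<theta>"
  by (simp add: isocomma_def Let_def)

lemma isocomma_hom: "l \<in> hom (isocomma F G) (c, d, \<theta>) (c', d', \<theta>') \<longleftrightarrow>
    (\<exists>u v. l = Arrow (c, d, \<theta>) (u, v) (c', d', \<theta>') \<and>
      (c, d, \<theta>) \<in> Ob (isocomma F G) \<and> (c', d', \<theta>') \<in> Ob (isocomma F G) \<and>
      u \<in> hom (Src F) c c' \<and> v \<in> hom (Src G) d d' \<and>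
      FA G v \<odot>\<^bsub>Tgt F\<^esub> \<theta> = \<theta>' \<odot>\<^bsub>Tgt F\<^esub> FA F u)"
  unfolding hom_def[of "isocomma F G"] by (auto simp: isocomma_def Let_def)

lemma isocomma_Cmp: "Arrow y (u', v') z \<odot>\<^bsub>isocomma F G\<^esub> Arrow x (u, v) y'
    = Arrow x (u' \<odot>\<^bsub>Src F\<^esub> u, v' \<odot>\<^bsub>Src G\<^esub> v) z"
  by (simp add: isocomma_def Let_def)

lemma isocomma_Idn: "Idn (isocomma F G) (c, d, \<theta>) = Arrow (c, d, \<theta>) (Idn (Src F) c, Idn (Src G) d) (c, d, \<theta>)"
  by (simp add: isocomma_def Let_def)

lemma category_isocomma: "category (isocomma F G)"
proof -
  interpret S: category "Src F" using F by (rule is_functor_category_Src)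
  interpret T: category "Src G" using G by (rule is_functor_category_Src)
  interpret E: category "Tgt F" using F by (rule is_functor_category_Tgt)
  note GC = is_functor_Cmp[OF G, folded FG] and Gh = is_functor_hom[OF G, folded FG]
    and GI = is_functor_Idn[OF G, folded FG]
  note FC = is_functor_Cmp[OF F] and Fh = is_functor_hom[OF F]
    and FI = is_functor_Idn[OF F]
  show ?thesis
  proof
    show "Dom (isocomma F G) f \<in> Ob (isocomma F G)" "Cod (isocomma F G) f \<in> Ob (isocomma F G)"
      if "f \<in> Ar (isocomma F G)" for f
      using that by (auto simp: isocomma_def Let_def)
    show "Idn (isocomma F G) x \<in> hom (isocomma F G) x x" if "x \<in> Ob (isocomma F G)" for x
    proof (cases x)
      case (fields c d \<theta>)
      with that show ?thesis
        using S.Idn_in T.Idn_in by (simp add: isocomma_hom isocomma_Idn isocomma_Ob FI GI)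
          (metis E.Idn_left E.Idn_right)
    qed
    show "g \<odot>\<^bsub>isocomma F G\<^esub> f \<in> hom (isocomma F G) x z"
      if fg: "f \<in> hom (isocomma F G) x y" "g \<in> hom (isocomma F G) y z" for f g x y z
    proof -
      obtain c d \<theta> c' d' \<theta>' c'' d'' \<theta>'' where [simp]: "x = (c, d, \<theta>)" "y = (c', d', \<theta>')" "z = (c'', d'', \<theta>'')"
        by (metis prod_cases3)
      obtain u v where f: "f = Arrow x (u, v) y" "x \<in> Ob (isocomma F G)" "y \<in> Ob (isocomma F G)"
        "u \<in> hom (Src F) c c'" "v \<in> hom (Src G) d d'"
        "FA G v \<odot>\<^bsub>Tgt F\<^esub> \<theta> = \<theta>' \<odot>\<^bsub>Tgt F\<^esub> FA F u" using fg by (auto simp: isocomma_hom)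
      obtain u' v' where g: "g = Arrow y (u', v') z" "z \<in> Ob (isocomma F G)"
        "u' \<in> hom (Src F) c' c''" "v' \<in> hom (Src G) d' d''"
        "FA G v' \<odot>\<^bsub>Tgt F\<^esub> \<theta>' = \<theta>'' \<odot>\<^bsub>Tgt F\<^esub> FA F u'" using fg by (auto simp: isocomma_hom)
      have \<theta>: "\<theta> \<in> hom (Tgt F) (FO F c) (FO G d)" "\<theta>' \<in> hom (Tgt F) (FO F c') (FO G d')"
        "\<theta>'' \<in> hom (Tgt F) (FO F c'') (FO G d'')"
        using f g by (auto simp: isocomma_Ob)
      have "FA G (v' \<odot>\<^bsub>Src G\<^esub> v) \<odot>\<^bsub>Tgt F\<^esub> \<theta> = \<theta>'' \<odot>\<^bsub>Tgt F\<^esub> FA F (u' \<odot>\<^bsub>Src F\<^esub> u)"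
        using GC[OF f(5) g(4)] FC[OF f(4) g(3)] f(6) g(5)
          E.assoc[OF \<theta>(1) Gh[OF f(5)] Gh[OF g(4)]] E.assoc[OF Fh[OF f(4)] \<theta>(2) Gh[OF g(4)]]
          E.assoc[OF Fh[OF f(4)] Fh[OF g(3)] \<theta>(3)] by metis
      then show ?thesis
        using f g S.Cmp_in T.Cmp_in by (auto simp: isocomma_Cmp isocomma_hom)
    qed
    show "Idn (isocomma F G) y \<odot>\<^bsub>isocomma F G\<^esub> f = f" "f \<odot>\<^bsub>isocomma F G\<^esub> Idn (isocomma F G) x = f"
      if "f \<in> hom (isocomma F G) x y" for f x y
      using that S.Idn_left T.Idn_left S.Idn_right T.Idn_right
      by (cases x; cases y; auto simp: isocomma_hom isocomma_Idn isocomma_Cmp)+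
    show "h \<odot>\<^bsub>isocomma F G\<^esub> (g \<odot>\<^bsub>isocomma F G\<^esub> f) = (h \<odot>\<^bsub>isocomma F G\<^esub> g) \<odot>\<^bsub>isocomma F G\<^esub> f"
      if "f \<in> hom (isocomma F G) w x" "g \<in> hom (isocomma F G) x y" "h \<in> hom (isocomma F G) y z"
      for f g h w x y z
      using that S.assoc T.assoc
      by (cases w; cases x; cases y; cases z; auto simp: isocomma_hom isocomma_Cmp)
  qed
qed

text \<open>The componentwise inverses form an arrow because the compatibility square can be read
  backwards once \<open>u\<close> and \<open>v\<close> are invertible.\<close>

lemma isocomma_iso:
  assumes l: "Arrow (c, d, \<theta>) (u, v) (c', d', \<theta>') \<in> hom (isocomma F G) (c, d, \<theta>) (c', d', \<theta>')"
    and u: "iso_arrow (Src F) u" and v: "iso_arrow (Src G) v"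
  shows "iso_arrow (isocomma F G) (Arrow (c, d, \<theta>) (u, v) (c', d', \<theta>'))"
proof -
  interpret E: category "Tgt F" using F by (rule is_functor_category_Tgt)
  note GC = is_functor_Cmp[OF G, folded FG] and Gh = is_functor_hom[OF G, folded FG]
    and GI = is_functor_Idn[OF G, folded FG]
  note FC = is_functor_Cmp[OF F] and Fh = is_functor_hom[OF F]
    and FI = is_functor_Idn[OF F]
  have Ob: "(c, d, \<theta>) \<in> Ob (isocomma F G)" "(c', d', \<theta>') \<in> Ob (isocomma F G)"
    and uh: "u \<in> hom (Src F) c c'" and vh: "v \<in> hom (Src G) d d'"
    and eq: "FA G v \<odot>\<^bsub>Tgt F\<^esub> \<theta> = \<theta>' \<odot>\<^bsub>Tgt F\<^esub> FA F u"
    using l by (auto simp: isocomma_hom)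
  have \<theta>: "\<theta> \<in> hom (Tgt F) (FO F c) (FO G d)" "\<theta>' \<in> hom (Tgt F) (FO F c') (FO G d')"
    using Ob by (auto simp: isocomma_Ob)
  have cd: "c \<in> Ob (Src F)" "d \<in> Ob (Src G)" "c' \<in> Ob (Src F)" "d' \<in> Ob (Src G)"
    using Ob by (auto simp: isocomma_Ob)
  obtain u' where u': "u' \<in> hom (Src F) c' c" "u' \<odot>\<^bsub>Src F\<^esub> u = Idn (Src F) c"
      "u \<odot>\<^bsub>Src F\<^esub> u' = Idn (Src F) c'"
    using iso_arrow_inverse[OF u uh] by blast
  obtain v' where v': "v' \<in> hom (Src G) d' d" "v' \<odot>\<^bsub>Src G\<^esub> v = Idn (Src G) d"
      "v \<odot>\<^bsub>Src G\<^esub> v' = Idn (Src G) d'"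
    using iso_arrow_inverse[OF v vh] by blast
  have "FA G v' \<odot>\<^bsub>Tgt F\<^esub> \<theta>' = (FA G v' \<odot>\<^bsub>Tgt F\<^esub> \<theta>') \<odot>\<^bsub>Tgt F\<^esub> (FA F u \<odot>\<^bsub>Tgt F\<^esub> FA F u')"
    using FC[OF u'(1) uh] u'(3) FI[OF cd(3)] E.Idn_right[OF E.Cmp_in[OF \<theta>(2) Gh[OF v'(1)]]] by metis
  also have "\<dots> = (FA G v' \<odot>\<^bsub>Tgt F\<^esub> (FA G v \<odot>\<^bsub>Tgt F\<^esub> \<theta>)) \<odot>\<^bsub>Tgt F\<^esub> FA F u'"
    using eq E.assoc[OF Fh[OF u'(1)] Fh[OF uh] E.Cmp_in[OF \<theta>(2) Gh[OF v'(1)]]]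
      E.assoc[OF Fh[OF uh] \<theta>(2) Gh[OF v'(1)]] by metis
  also have "\<dots> = \<theta> \<odot>\<^bsub>Tgt F\<^esub> FA F u'"
    using GC[OF vh v'(1)] v'(2) GI[OF cd(2)] E.assoc[OF \<theta>(1) Gh[OF vh] Gh[OF v'(1)]]
      E.Idn_left[OF \<theta>(1)] by metis
  finally have "Arrow (c', d', \<theta>') (u', v') (c, d, \<theta>) \<in> hom (isocomma F G) (c', d', \<theta>') (c, d, \<theta>)"
    using Ob u' v' by (simp add: isocomma_hom)
  then show ?thesis
    using iso_arrow_iff[OF l] u' v' by (metis isocomma_Cmp isocomma_Idn)
qed

lemma isocomma_pairing_simps:
  "Src (isocomma_pairing P Q F G \<theta>) = Src P" "Tgt (isocomma_pairing P Q F G \<theta>) = isocomma F G"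
  "FO (isocomma_pairing P Q F G \<theta>) w = (FO P w, FO Q w, \<theta> w)"
  "l \<in> hom (Src P) w w' \<Longrightarrow> FA (isocomma_pairing P Q F G \<theta>) l
     = Arrow (FO P w, FO Q w, \<theta> w) (FA P l, FA Q l) (FO P w', FO Q w', \<theta> w')"
  by (simp_all add: isocomma_pairing_def hom_def Let_def)

text \<open>Naturality of \<theta> is the compatibility required of arrows of the isocomma category,
  and its invertibility is the condition on objects.\<close>

lemma is_functor_isocomma_pairing:
  assumes P: "is_functor P" "Tgt P = Src F" and Q: "is_functor Q" "Tgt Q = Src G" and PQ: "Src P = Src Q"
    and \<theta>: "nat_iso (F \<circ>\<^sub>F P) (G \<circ>\<^sub>F Q) \<theta>"
  shows "is_functor (isocomma_pairing P Q F G \<theta>)"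
proof -
  interpret W: category "Src P" using P(1) by (rule is_functor_category_Src)
  have Ob: "(FO P w, FO Q w, \<theta> w) \<in> Ob (isocomma F G)" if "w \<in> Ob (Src P)" for w
    using that nat_iso_hom[OF \<theta>, of w] nat_iso_iso[OF \<theta>, of w]
      is_functor_Ob[OF P(1)] is_functor_Ob[OF Q(1)] P Q PQ by (auto simp: isocomma_Ob)
  show ?thesis
  proof (rule is_functorI; (simp add: isocomma_pairing_simps(1-3))?)
    show "FA (isocomma_pairing P Q F G \<theta>) f \<in>
       hom (isocomma F G) (FO P x, FO Q x, \<theta> x) (FO P y, FO Q y, \<theta> y)"
      if f: "f \<in> hom (Src P) x y" for f x y
      using f Ob[OF W.hom_Ob1[OF f]] Ob[OF W.hom_Ob2[OF f]] nat_iso_natural[OF \<theta>, of f x y]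
        is_functor_hom[OF P(1) f] is_functor_hom[OF Q(1), of f x y] P Q PQ
      by (simp add: isocomma_pairing_simps isocomma_hom)
    show "FA (isocomma_pairing P Q F G \<theta>) (Idn (Src P) x) = Idn (isocomma F G) (FO P x, FO Q x, \<theta> x)"
      if x: "x \<in> Ob (Src P)" for x
      using x W.Idn_in[OF x] is_functor_Idn[OF P(1)] is_functor_Idn[OF Q(1)] P Q PQ
      by (simp add: isocomma_pairing_simps(4) isocomma_Idn)
    show "FA (isocomma_pairing P Q F G \<theta>) (g \<odot>\<^bsub>Src P\<^esub> f) =
       FA (isocomma_pairing P Q F G \<theta>) g \<odot>\<^bsub>isocomma F G\<^esub> FA (isocomma_pairing P Q F G \<theta>) f"
      if f: "f \<in> hom (Src P) x y" and g: "g \<in> hom (Src P) y z" for f g x y z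
      using f g W.Cmp_in[OF f g] is_functor_Cmp[OF P(1) f g] is_functor_Cmp[OF Q(1), of f x y g z] P Q PQ
      by (simp add: isocomma_pairing_simps(4)[of _ P] isocomma_Cmp)
  qed (use Ob W.category_axioms category_isocomma in auto)
qed

end

section \<open>Fibres and lifts\<close>

lemma fibre_Ob: "x \<in> Ob (fibre p b) \<longleftrightarrow> x \<in> Ob (Src p) \<and> FO p x = b"
  and fibre_hom: "f \<in> hom (fibre p b) x y \<longleftrightarrow> f \<in> hom (Src p) x y \<and> FA p f = Idn (Tgt p) b"
  and fibre_Idn [simp]: "Idn (fibre p b) = Idn (Src p)"
  and fibre_Cmp [simp]: "g \<odot>\<^bsub>fibre p b\<^esub> f = g \<odot>\<^bsub>Src p\<^esub> f"
  by (auto simp: fibre_def hom_def)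

locale base_functor =
  fixes p :: "('o, 'm, 'p, 'n) fctr"
  assumes functorial: "is_functor p"
begin

abbreviation (input) "X \<equiv> Src p"
abbreviation (input) "B \<equiv> Tgt p"

sublocale X: category X using functorial by (rule is_functor_category_Src)
sublocale B: category B using functorial by (rule is_functor_category_Tgt)

lemmas FA_hom = is_functor_hom[OF functorial]
  and FA_Cmp = is_functor_Cmp[OF functorial]
  and FA_Idn = is_functor_Idn[OF functorial]
  and FO_Ob = is_functor_Ob[OF functorial]

text \<open>\<open>fibre\<close> constrains an arrow only by its image being \<open>Idn b\<close>;
  its endpoints lie over \<open>b\<close> since both ends of \<open>Idn b\<close> are
  \<open>b\<close>.\<close>

lemma FO_fibre:
  assumes "u \<in> hom (fibre p b) x y" "b \<in> Ob B"
  shows "FO p x = b" "FO p y = b"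
proof -
  have "Idn B b \<in> hom B (FO p x) (FO p y)"
    using assms(1) FA_hom fibre_hom by metis
  then show "FO p x = b" "FO p y = b"
    using B.Idn_in[OF assms(2)] by (auto simp: hom_def)
qed

lemma category_fibre:
  assumes b: "b \<in> Ob B"
  shows "category (fibre p b)"
proof
  note bb = B.Idn_in[OF b]
  show "Dom (fibre p b) f \<in> Ob (fibre p b)" "Cod (fibre p b) f \<in> Ob (fibre p b)"
    if "f \<in> Ar (fibre p b)" for f
  proof -
    have "f \<in> hom (fibre p b) (Dom (fibre p b) f) (Cod (fibre p b) f)"
      using that by (rule Ar_hom)
    then show "Dom (fibre p b) f \<in> Ob (fibre p b)" "Cod (fibre p b) f \<in> Ob (fibre p b)"
      using FO_fibre[OF _ b] X.hom_Ob1 X.hom_Ob2 fibre_hom fibre_Ob by metis+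
  qed
  show "Idn (fibre p b) x \<in> hom (fibre p b) x x" if "x \<in> Ob (fibre p b)" for x
    using that X.Idn_in FA_Idn by (simp add: fibre_Ob fibre_hom)
  show "g \<odot>\<^bsub>fibre p b\<^esub> f \<in> hom (fibre p b) x z"
    if "f \<in> hom (fibre p b) x y" "g \<in> hom (fibre p b) y z" for f g x y z
    using that X.Cmp_in[of f x y g z] FA_Cmp[of f x y g z] B.Idn_left[OF bb] by (simp add: fibre_hom)
qed (auto simp: fibre_hom X.Idn_left X.Idn_right intro: X.assoc)

text \<open>The inverse taken in the total category is automatically vertical: its image is inverse
  to an identity.\<close>

lemma fibre_iso:
  assumes f: "f \<in> hom (fibre p b) x y" and b: "b \<in> Ob B" and iso: "iso_arrow X f"
  shows "iso_arrow (fibre p b) f"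
proof -
  have fh: "f \<in> hom X x y" "FA p f = Idn B b"
    using f by (auto simp: fibre_hom)
  note FO = FO_fibre[OF f b]
  obtain g where g: "g \<in> hom X y x" "g \<odot>\<^bsub>X\<^esub> f = Idn X x" "f \<odot>\<^bsub>X\<^esub> g = Idn X y"
    using iso_arrow_inverse[OF iso fh(1)] by blast
  have "FA p g \<in> hom B b b"
    using FA_hom[OF g(1)] FO by simp
  then have "FA p g = FA p g \<odot>\<^bsub>B\<^esub> FA p f"
    using B.Idn_right fh(2) by metis
  also have "\<dots> = Idn B b"
    using FA_Cmp[OF fh(1) g(1)] g(2) FA_Idn X.hom_Ob1[OF fh(1)] FO by metis
  finally have "g \<in> hom (fibre p b) y x"
    using g(1) by (simp add: fibre_hom)
  then show ?thesis
    using iso_arrow_iff[OF f] g(2,3) by auto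
qed

lemma iso_of_fibre_iso:
  assumes f: "f \<in> hom (fibre p b) x y" and iso: "iso_arrow (fibre p b) f"
  shows "iso_arrow X f"
proof -
  have fh: "f \<in> hom X x y"
    using f by (auto simp: fibre_hom)
  obtain g where "g \<in> hom (fibre p b) y x" "g \<odot>\<^bsub>fibre p b\<^esub> f = Idn X x" "f \<odot>\<^bsub>fibre p b\<^esub> g = Idn X y"
    using iso_arrow_inverse[OF iso f] by auto
  then show ?thesis
    using iso_arrow_iff[OF fh] fibre_hom fibre_Cmp by metis
qed

text \<open>The unique-existence clause is split into an existence part and a cancellation part,
  here and dually for cartesian arrows, phrased with hom-sets instead of \<open>Dom\<close> and
  \<open>Cod\<close>.\<close>

lemma cocartesian_factor:
  assumes e: "cocartesian_arrow p e" "e \<in> hom X x y" and g: "g \<in> hom X x z"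
    and v: "v \<in> hom B (FO p y) (FO p z)" "v \<odot>\<^bsub>B\<^esub> FA p e = FA p g"
  shows "\<exists>h \<in> hom X y z. FA p h = v \<and> h \<odot>\<^bsub>X\<^esub> e = g"
proof -
  have "\<exists>!h. h \<in> hom X (Cod X e) (Cod X g) \<and> FA p h = v \<and> h \<odot>\<^bsub>X\<^esub> e = g"
    using e(1) hom_Ar[OF g] v unfolding cocartesian_arrow_def
    by (metis hom_Dom[OF e(2)] hom_Dom[OF g] hom_Cod[OF e(2)] hom_Cod[OF g])
  then show ?thesis
    by (metis hom_Cod[OF e(2)] hom_Cod[OF g])
qed

lemma cocartesian_cancel:
  assumes e: "cocartesian_arrow p e" "e \<in> hom X x y"
    and h: "h \<in> hom X y z" "h' \<in> hom X y z" "FA p h = FA p h'" "h \<odot>\<^bsub>X\<^esub> e = h' \<odot>\<^bsub>X\<^esub> e"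
  shows "h = h'"
proof -
  note g = X.Cmp_in[OF e(2) h(1)]
  have "\<exists>!k. k \<in> hom X (Cod X e) (Cod X (h \<odot>\<^bsub>X\<^esub> e)) \<and> FA p k = FA p h \<and> k \<odot>\<^bsub>X\<^esub> e = h \<odot>\<^bsub>X\<^esub> e"
    using e(1) hom_Ar[OF g] FA_hom[OF h(1)] FA_Cmp[OF e(2) h(1)] unfolding cocartesian_arrow_def
    by (metis hom_Dom[OF e(2)] hom_Dom[OF g] hom_Cod[OF e(2)] hom_Cod[OF g])
  then show ?thesis
    using h by (metis hom_Cod[OF e(2)] hom_Cod[OF g])
qed

lemma cartesian_factor:
  assumes e: "cartesian_arrow p e" "e \<in> hom X y z" and g: "g \<in> hom X x z"
    and v: "v \<in> hom B (FO p x) (FO p y)" "FA p e \<odot>\<^bsub>B\<^esub> v = FA p g"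
  shows "\<exists>h \<in> hom X x y. FA p h = v \<and> e \<odot>\<^bsub>X\<^esub> h = g"
proof -
  have "\<exists>!h. h \<in> hom X (Dom X g) (Dom X e) \<and> FA p h = v \<and> e \<odot>\<^bsub>X\<^esub> h = g"
    using e(1) hom_Ar[OF g] v unfolding cartesian_arrow_def
    by (metis hom_Dom[OF e(2)] hom_Dom[OF g] hom_Cod[OF e(2)] hom_Cod[OF g])
  then show ?thesis
    by (metis hom_Dom[OF e(2)] hom_Dom[OF g])
qed

lemma cartesian_cancel:
  assumes e: "cartesian_arrow p e" "e \<in> hom X y z"
    and h: "h \<in> hom X x y" "h' \<in> hom X x y" "FA p h = FA p h'" "e \<odot>\<^bsub>X\<^esub> h = e \<odot>\<^bsub>X\<^esub> h'"
  shows "h = h'"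
proof -
  note g = X.Cmp_in[OF h(1) e(2)]
  have "\<exists>!k. k \<in> hom X (Dom X (e \<odot>\<^bsub>X\<^esub> h)) (Dom X e) \<and> FA p k = FA p h \<and> e \<odot>\<^bsub>X\<^esub> k = e \<odot>\<^bsub>X\<^esub> h"
    using e(1) hom_Ar[OF g] FA_hom[OF h(1)] FA_Cmp[OF h(1) e(2)] unfolding cartesian_arrow_def
    by (metis hom_Dom[OF e(2)] hom_Dom[OF g] hom_Cod[OF e(2)] hom_Cod[OF g])
  then show ?thesis
    using h by (metis hom_Dom[OF e(2)] hom_Dom[OF g])
qed

text \<open>Two arrows over the same \<open>f\<close> differ by a vertical arrow: the factorization
  is taken over the identity of \<open>b\<close>.\<close>

lemma cocartesian_factor_fibre:
  assumes e: "cocartesian_arrow p e" "e \<in> hom X x y" and g: "g \<in> hom X x z"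
    and f: "FA p e = f" "FA p g = f" "f \<in> hom B a b"
  shows "\<exists>h \<in> hom (fibre p b) y z. h \<odot>\<^bsub>X\<^esub> e = g"
proof -
  have FO: "FO p y = b" "FO p z = b"
    using FA_hom[OF e(2)] FA_hom[OF g] f by (auto simp: hom_def)
  show ?thesis
    using cocartesian_factor[OF e g, of "Idn B b"] f FO B.Idn_left[OF f(3)]
      B.Idn_in[OF B.hom_Ob2[OF f(3)]] by (auto simp: fibre_hom)
qed

lemma cartesian_factor_fibre:
  assumes e: "cartesian_arrow p e" "e \<in> hom X y z" and g: "g \<in> hom X x z"
    and f: "FA p e = f" "FA p g = f" "f \<in> hom B a b"
  shows "\<exists>h \<in> hom (fibre p a) x y. e \<odot>\<^bsub>X\<^esub> h = g"
proof -
  have FO: "FO p x = a" "FO p y = a"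
    using FA_hom[OF e(2)] FA_hom[OF g] f by (auto simp: hom_def)
  show ?thesis
    using cartesian_factor[OF e g, of "Idn B a"] f FO B.Idn_right[OF f(3)]
      B.Idn_in[OF B.hom_Ob1[OF f(3)]] by (auto simp: fibre_hom)
qed

lemma cocartesian_cancel_fibre:
  assumes "cocartesian_arrow p e" "e \<in> hom X x y"
    and "h \<in> hom (fibre p b) y z" "h' \<in> hom (fibre p b) y z" "h \<odot>\<^bsub>X\<^esub> e = h' \<odot>\<^bsub>X\<^esub> e"
  shows "h = h'"
  using assms by (auto simp: fibre_hom intro: cocartesian_cancel)

lemma cartesian_cancel_fibre:
  assumes "cartesian_arrow p e" "e \<in> hom X y z"
    and "h \<in> hom (fibre p b) x y" "h' \<in> hom (fibre p b) x y" "e \<odot>\<^bsub>X\<^esub> h = e \<odot>\<^bsub>X\<^esub> h'"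
  shows "h = h'"
  using assms by (auto simp: fibre_hom intro: cartesian_cancel)

text \<open>Each lift factors vertically through the other, and both composites are identities by
  cancellation. This makes the choice of lifts harmless: a property stable under vertical
  isomorphism can be checked on one explicit lift.\<close>

lemma cocartesian_unique:
  assumes e: "cocartesian_arrow p e" "e \<in> hom X x y" and g: "cocartesian_arrow p g" "g \<in> hom X x z"
    and f: "FA p e = f" "FA p g = f" "f \<in> hom B a b"
  shows "\<exists>h \<in> hom (fibre p b) y z. h \<odot>\<^bsub>X\<^esub> e = g \<and> iso_arrow X h"
proof -
  obtain h where h: "h \<in> hom (fibre p b) y z" "h \<odot>\<^bsub>X\<^esub> e = g"
    using cocartesian_factor_fibre[OF e g(2) f] by blast
  obtain k where k: "k \<in> hom (fibre p b) z y" "k \<odot>\<^bsub>X\<^esub> g = e"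
    using cocartesian_factor_fibre[OF g e(2) f(2,1,3)] by blast
  have hk: "h \<in> hom X y z" "k \<in> hom X z y"
    using h k by (auto simp: fibre_hom)
  interpret Fb: category "fibre p b"
    using category_fibre[OF B.hom_Ob2[OF f(3)]] .
  have "k \<odot>\<^bsub>X\<^esub> h = Idn X y"
    using cocartesian_cancel_fibre[OF e Fb.Cmp_in[OF h(1) k(1)] Fb.Idn_in[OF Fb.hom_Ob1[OF h(1)]]]
      X.assoc[OF e(2) hk] h(2) k(2) X.Idn_left[OF e(2)] by simp
  moreover have "h \<odot>\<^bsub>X\<^esub> k = Idn X z"
    using cocartesian_cancel_fibre[OF g Fb.Cmp_in[OF k(1) h(1)] Fb.Idn_in[OF Fb.hom_Ob1[OF k(1)]]]
      X.assoc[OF g(2) hk(2,1)] h(2) k(2) X.Idn_left[OF g(2)] by simp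
  ultimately show ?thesis
    using h iso_arrow_iff[OF hk(1)] hk(2) by blast
qed

lemma cartesian_unique:
  assumes e: "cartesian_arrow p e" "e \<in> hom X y z" and g: "cartesian_arrow p g" "g \<in> hom X x z"
    and f: "FA p e = f" "FA p g = f" "f \<in> hom B a b"
  shows "\<exists>h \<in> hom (fibre p a) x y. e \<odot>\<^bsub>X\<^esub> h = g \<and> iso_arrow X h"
proof -
  obtain h where h: "h \<in> hom (fibre p a) x y" "e \<odot>\<^bsub>X\<^esub> h = g"
    using cartesian_factor_fibre[OF e g(2) f] by blast
  obtain k where k: "k \<in> hom (fibre p a) y x" "g \<odot>\<^bsub>X\<^esub> k = e"
    using cartesian_factor_fibre[OF g e(2) f(2,1,3)] by blast
  have hk: "h \<in> hom X x y" "k \<in> hom X y x"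
    using h k by (auto simp: fibre_hom)
  interpret Fb: category "fibre p a"
    using category_fibre[OF B.hom_Ob1[OF f(3)]] .
  have "h \<odot>\<^bsub>X\<^esub> k = Idn X y"
    using cartesian_cancel_fibre[OF e Fb.Cmp_in[OF k(1) h(1)] Fb.Idn_in[OF Fb.hom_Ob1[OF k(1)]]]
      X.assoc[OF hk(2,1) e(2)] h(2) k(2) X.Idn_right[OF e(2)] by simp
  moreover have "k \<odot>\<^bsub>X\<^esub> h = Idn X x"
    using cartesian_cancel_fibre[OF g Fb.Cmp_in[OF h(1) k(1)] Fb.Idn_in[OF Fb.hom_Ob1[OF h(1)]]]
      X.assoc[OF hk g(2)] h(2) k(2) X.Idn_right[OF g(2)] by simp
  ultimately show ?thesis
    using h iso_arrow_iff[OF hk(1)] hk(2) by blast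
qed

end

section \<open>Push, pull and the Beck--Chevalley comparison\<close>

text \<open>\<open>S\<close> keeps the theory independent of the simplex category; it later becomes
  the set of convex maps.\<close>

locale lifts =
  fixes p :: "('o, 'm, 'p, 'n) fctr" and S :: "'n set"
  assumes cocartesian: "cocartesian_fibration p"
    and cartesian: "cartesian_over p S"
begin

sublocale base_functor p
  using cocartesian by unfold_locales (simp add: cocartesian_fibration_def)

lemma push_simps:
  "f \<in> hom B a b \<Longrightarrow> Src (push p f) = fibre p a" "f \<in> hom B a b \<Longrightarrow> Tgt (push p f) = fibre p b"
  "FO (push p f) x = Cod X (cocart_lift p f x)"
  by (auto simp: push_def Let_def hom_def)

lemma pull_simps:
  "f \<in> hom B a b \<Longrightarrow> Src (pull p f) = fibre p b" "f \<in> hom B a b \<Longrightarrow> Tgt (pull p f) = fibre p a"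
  "FO (pull p f) x = Dom X (cart_lift p f x)"
  by (auto simp: pull_def Let_def hom_def)

lemma cocart_lift:
  assumes f: "f \<in> hom B a b" and x: "x \<in> Ob (fibre p a)"
  shows "cocartesian_arrow p (cocart_lift p f x)"
    and "cocart_lift p f x \<in> hom X x (FO (push p f) x)"
    and "FA p (cocart_lift p f x) = f"
    and "FO (push p f) x \<in> Ob (fibre p b)"
proof -
  have "\<exists>e. cocartesian_arrow p e \<and> Dom X e = x \<and> FA p e = f"
    using cocartesian f x by (auto simp: cocartesian_fibration_def fibre_Ob hom_def)
  then have *: "cocartesian_arrow p (cocart_lift p f x) \<and> Dom X (cocart_lift p f x) = x \<and>
      FA p (cocart_lift p f x) = f"
    unfolding cocart_lift_def by (rule someI_ex)
  then show "cocartesian_arrow p (cocart_lift p f x)" and f': "FA p (cocart_lift p f x) = f" by auto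
  from * show h: "cocart_lift p f x \<in> hom X x (FO (push p f) x)"
    by (auto simp: push_simps hom_def cocartesian_arrow_def)
  show "FO (push p f) x \<in> Ob (fibre p b)"
    using X.hom_Ob2[OF h] FA_hom[OF h] f f' by (auto simp: fibre_Ob hom_def)
qed

lemma cart_lift:
  assumes f: "f \<in> hom B a b" "f \<in> S" and x: "x \<in> Ob (fibre p b)"
  shows "cartesian_arrow p (cart_lift p f x)"
    and "cart_lift p f x \<in> hom X (FO (pull p f) x) x"
    and "FA p (cart_lift p f x) = f"
    and "FO (pull p f) x \<in> Ob (fibre p a)"
proof -
  have "\<exists>e. cartesian_arrow p e \<and> Cod X e = x \<and> FA p e = f"
    using cartesian f x by (auto simp: cartesian_over_def fibre_Ob hom_def)
  then have *: "cartesian_arrow p (cart_lift p f x) \<and> Cod X (cart_lift p f x) = x \<and>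
      FA p (cart_lift p f x) = f"
    unfolding cart_lift_def by (rule someI_ex)
  then show "cartesian_arrow p (cart_lift p f x)" and f': "FA p (cart_lift p f x) = f" by auto
  from * show h: "cart_lift p f x \<in> hom X (FO (pull p f) x) x"
    by (auto simp: pull_simps hom_def cartesian_arrow_def)
  show "FO (pull p f) x \<in> Ob (fibre p a)"
    using X.hom_Ob1[OF h] FA_hom[OF h] f f' by (auto simp: fibre_Ob hom_def)
qed

text \<open>The definite description in \<open>push\<close> is well defined: existence is a vertical
  factorization through the cocartesian lift, uniqueness is cancellation.\<close>

lemma push_FA:
  assumes f: "f \<in> hom B a b" and u: "u \<in> hom (fibre p a) x y"
  shows "FA (push p f) u \<in> hom (fibre p b) (FO (push p f) x) (FO (push p f) y)"
    and "FA (push p f) u \<odot>\<^bsub>X\<^esub> cocart_lift p f x = cocart_lift p f y \<odot>\<^bsub>X\<^esub> u"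
proof -
  interpret Fa: category "fibre p a" by (rule category_fibre[OF B.hom_Ob1[OF f]])
  note x = cocart_lift[OF f Fa.hom_Ob1[OF u]] and y = cocart_lift[OF f Fa.hom_Ob2[OF u]]
  have uX: "u \<in> hom X x y" "FA p u = Idn B a"
    using u by (auto simp: fibre_hom)
  have "FA p (cocart_lift p f y \<odot>\<^bsub>X\<^esub> u) = f"
    using FA_Cmp[OF uX(1) y(2)] uX(2) y(3) B.Idn_right[OF f] by simp
  then obtain h where h: "h \<in> hom (fibre p b) (FO (push p f) x) (FO (push p f) y)"
    "h \<odot>\<^bsub>X\<^esub> cocart_lift p f x = cocart_lift p f y \<odot>\<^bsub>X\<^esub> u"
    using cocartesian_factor_fibre[OF x(1,2) X.Cmp_in[OF uX(1) y(2)] x(3) _ f] by blast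
  have "FA (push p f) u = (THE v. v \<in> hom (fibre p b) (FO (push p f) x) (FO (push p f) y) \<and>
      v \<odot>\<^bsub>X\<^esub> cocart_lift p f x = cocart_lift p f y \<odot>\<^bsub>X\<^esub> u)"
    using hom_Cod[OF f] hom_Dom[OF uX(1)] hom_Cod[OF uX(1)] by (simp add: push_def Let_def)
  also have "\<dots> = h"
    by (rule the_equality) (use h cocartesian_cancel_fibre[OF x(1,2)] in auto)
  finally show "FA (push p f) u \<in> hom (fibre p b) (FO (push p f) x) (FO (push p f) y)"
    and "FA (push p f) u \<odot>\<^bsub>X\<^esub> cocart_lift p f x = cocart_lift p f y \<odot>\<^bsub>X\<^esub> u"
    using h by auto
qed

text \<open>Any vertical arrow filling the square is the value of \<open>push\<close>, so
  functoriality reduces to pasting squares.\<close>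

lemma push_FA_eqI:
  assumes f: "f \<in> hom B a b" and u: "u \<in> hom (fibre p a) x y"
    and v: "v \<in> hom (fibre p b) (FO (push p f) x) (FO (push p f) y)"
    "v \<odot>\<^bsub>X\<^esub> cocart_lift p f x = cocart_lift p f y \<odot>\<^bsub>X\<^esub> u"
  shows "FA (push p f) u = v"
proof -
  interpret Fa: category "fibre p a" by (rule category_fibre[OF B.hom_Ob1[OF f]])
  note x = cocart_lift[OF f Fa.hom_Ob1[OF u]]
  show ?thesis
    using cocartesian_cancel_fibre[OF x(1,2) push_FA(1)[OF f u] v(1)] push_FA(2)[OF f u] v(2) by simp
qed

lemma pull_FA:
  assumes f: "f \<in> hom B a b" "f \<in> S" and u: "u \<in> hom (fibre p b) x y"
  shows "FA (pull p f) u \<in> hom (fibre p a) (FO (pull p f) x) (FO (pull p f) y)"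
    and "cart_lift p f y \<odot>\<^bsub>X\<^esub> FA (pull p f) u = u \<odot>\<^bsub>X\<^esub> cart_lift p f x"
proof -
  interpret Fb: category "fibre p b" by (rule category_fibre[OF B.hom_Ob2[OF f(1)]])
  note x = cart_lift[OF f Fb.hom_Ob1[OF u]] and y = cart_lift[OF f Fb.hom_Ob2[OF u]]
  have uX: "u \<in> hom X x y" "FA p u = Idn B b"
    using u by (auto simp: fibre_hom)
  have "FA p (u \<odot>\<^bsub>X\<^esub> cart_lift p f x) = f"
    using FA_Cmp[OF x(2) uX(1)] uX(2) x(3) B.Idn_left[OF f(1)] by simp
  then obtain h where h: "h \<in> hom (fibre p a) (FO (pull p f) x) (FO (pull p f) y)"
    "cart_lift p f y \<odot>\<^bsub>X\<^esub> h = u \<odot>\<^bsub>X\<^esub> cart_lift p f x"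
    using cartesian_factor_fibre[OF y(1,2) X.Cmp_in[OF x(2) uX(1)] y(3) _ f(1)] by blast
  have "FA (pull p f) u = (THE v. v \<in> hom (fibre p a) (FO (pull p f) x) (FO (pull p f) y) \<and>
      cart_lift p f y \<odot>\<^bsub>X\<^esub> v = u \<odot>\<^bsub>X\<^esub> cart_lift p f x)"
    using hom_Dom[OF f(1)] hom_Dom[OF uX(1)] hom_Cod[OF uX(1)] by (simp add: pull_def Let_def)
  also have "\<dots> = h"
    by (rule the_equality) (use h cartesian_cancel_fibre[OF y(1,2)] in auto)
  finally show "FA (pull p f) u \<in> hom (fibre p a) (FO (pull p f) x) (FO (pull p f) y)"
    and "cart_lift p f y \<odot>\<^bsub>X\<^esub> FA (pull p f) u = u \<odot>\<^bsub>X\<^esub> cart_lift p f x"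
    using h by auto
qed

lemma pull_FA_eqI:
  assumes f: "f \<in> hom B a b" "f \<in> S" and u: "u \<in> hom (fibre p b) x y"
    and v: "v \<in> hom (fibre p a) (FO (pull p f) x) (FO (pull p f) y)"
    "cart_lift p f y \<odot>\<^bsub>X\<^esub> v = u \<odot>\<^bsub>X\<^esub> cart_lift p f x"
  shows "FA (pull p f) u = v"
proof -
  interpret Fb: category "fibre p b" by (rule category_fibre[OF B.hom_Ob2[OF f(1)]])
  note y = cart_lift[OF f Fb.hom_Ob2[OF u]]
  show ?thesis
    using cartesian_cancel_fibre[OF y(1,2) pull_FA(1)[OF f u] v(1)] pull_FA(2)[OF f u] v(2) by simp
qed

lemma is_functor_push:
  assumes f: "f \<in> hom B a b"
  shows "is_functor (push p f)"
proof -
  interpret Fa: category "fibre p a" by (rule category_fibre[OF B.hom_Ob1[OF f]])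
  interpret Fb: category "fibre p b" by (rule category_fibre[OF B.hom_Ob2[OF f]])
  note lift = cocart_lift[OF f]
  show ?thesis
  proof (rule is_functorI; (simp only: push_simps(1,2)[OF f] fibre_Idn fibre_Cmp)?)
    show "FA (push p f) (Idn X x) = Idn X (FO (push p f) x)" if x: "x \<in> Ob (fibre p a)" for x
      by (rule push_FA_eqI[OF f Fa.Idn_in[OF x, simplified] Fb.Idn_in[OF lift(4)[OF x], simplified]])
        (simp add: X.Idn_left[OF lift(2)[OF x]] X.Idn_right[OF lift(2)[OF x]])
    show "FA (push p f) (v \<odot>\<^bsub>X\<^esub> u) = FA (push p f) v \<odot>\<^bsub>X\<^esub> FA (push p f) u"
      if u: "u \<in> hom (fibre p a) x y" and v: "v \<in> hom (fibre p a) y z" for u v x y z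
    proof (rule push_FA_eqI[OF f Fa.Cmp_in[OF u v, simplified]
            Fb.Cmp_in[OF push_FA(1)[OF f u] push_FA(1)[OF f v], simplified]])
      have uv: "u \<in> hom X x y" "v \<in> hom X y z"
        "FA (push p f) u \<in> hom X (FO (push p f) x) (FO (push p f) y)"
        "FA (push p f) v \<in> hom X (FO (push p f) y) (FO (push p f) z)"
        using u v push_FA(1)[OF f] by (auto simp: fibre_hom)
      note l = lift(2)[OF Fa.hom_Ob1[OF u]] lift(2)[OF Fa.hom_Ob2[OF u]] lift(2)[OF Fa.hom_Ob2[OF v]]
      show "(FA (push p f) v \<odot>\<^bsub>X\<^esub> FA (push p f) u) \<odot>\<^bsub>X\<^esub> cocart_lift p f x
          = cocart_lift p f z \<odot>\<^bsub>X\<^esub> (v \<odot>\<^bsub>X\<^esub> u)"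
        using push_FA(2)[OF f u] push_FA(2)[OF f v] X.assoc[OF l(1) uv(3,4)] X.assoc[OF uv(1) l(2) uv(4)]
          X.assoc[OF uv(1,2) l(3)] by metis
    qed
  qed (use lift(4) push_FA(1)[OF f] Fa.category_axioms Fb.category_axioms in auto)
qed

lemma is_functor_pull:
  assumes f: "f \<in> hom B a b" "f \<in> S"
  shows "is_functor (pull p f)"
proof -
  interpret Fa: category "fibre p a" by (rule category_fibre[OF B.hom_Ob1[OF f(1)]])
  interpret Fb: category "fibre p b" by (rule category_fibre[OF B.hom_Ob2[OF f(1)]])
  note lift = cart_lift[OF f]
  show ?thesis
  proof (rule is_functorI; (simp only: pull_simps(1,2)[OF f(1)] fibre_Idn fibre_Cmp)?)
    show "FA (pull p f) (Idn X x) = Idn X (FO (pull p f) x)" if x: "x \<in> Ob (fibre p b)" for x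
      by (rule pull_FA_eqI[OF f Fb.Idn_in[OF x, simplified] Fa.Idn_in[OF lift(4)[OF x], simplified]])
        (simp add: X.Idn_left[OF lift(2)[OF x]] X.Idn_right[OF lift(2)[OF x]])
    show "FA (pull p f) (v \<odot>\<^bsub>X\<^esub> u) = FA (pull p f) v \<odot>\<^bsub>X\<^esub> FA (pull p f) u"
      if u: "u \<in> hom (fibre p b) x y" and v: "v \<in> hom (fibre p b) y z" for u v x y z
    proof (rule pull_FA_eqI[OF f Fb.Cmp_in[OF u v, simplified]
            Fa.Cmp_in[OF pull_FA(1)[OF f u] pull_FA(1)[OF f v], simplified]])
      have uv: "u \<in> hom X x y" "v \<in> hom X y z"
        "FA (pull p f) u \<in> hom X (FO (pull p f) x) (FO (pull p f) y)"
        "FA (pull p f) v \<in> hom X (FO (pull p f) y) (FO (pull p f) z)"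
        using u v pull_FA(1)[OF f] by (auto simp: fibre_hom)
      note l = lift(2)[OF Fb.hom_Ob1[OF u]] lift(2)[OF Fb.hom_Ob2[OF u]] lift(2)[OF Fb.hom_Ob2[OF v]]
      show "cart_lift p f z \<odot>\<^bsub>X\<^esub> (FA (pull p f) v \<odot>\<^bsub>X\<^esub> FA (pull p f) u)
          = (v \<odot>\<^bsub>X\<^esub> u) \<odot>\<^bsub>X\<^esub> cart_lift p f x"
        using pull_FA(2)[OF f u] pull_FA(2)[OF f v] X.assoc[OF uv(3,4) l(3)] X.assoc[OF uv(3) l(2) uv(2)]
          X.assoc[OF l(1) uv(1,2)] by metis
    qed
  qed (use lift(4) pull_FA(1)[OF f] Fa.category_axioms Fb.category_axioms in auto)
qed

text \<open>Composing with the lifts on both sides loses nothing: the cartesian lift is cancelled on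
  the left, then the cocartesian one on the right. Uniqueness and naturality of the comparison, and
  later the compatibility square for essential surjectivity, are decided by this test.\<close>

lemma push_pull_cancel:
  assumes f: "f \<in> hom B a b" and g: "g \<in> hom B b c" "g \<in> S"
    and x: "x \<in> Ob (fibre p a)" and y: "y \<in> Ob (fibre p c)"
    and u: "u \<in> hom (fibre p b) (FO (push p f) x) (FO (pull p g) y)"
    and v: "v \<in> hom (fibre p b) (FO (push p f) x) (FO (pull p g) y)"
    and eq: "cart_lift p g y \<odot>\<^bsub>X\<^esub> u \<odot>\<^bsub>X\<^esub> cocart_lift p f x
      = cart_lift p g y \<odot>\<^bsub>X\<^esub> v \<odot>\<^bsub>X\<^esub> cocart_lift p f x"
  shows "u = v"
proof -
  note 1 = cocart_lift[OF f x] and 2 = cart_lift[OF g y]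
  have uv: "u \<in> hom X (FO (push p f) x) (FO (pull p g) y)"
    "v \<in> hom X (FO (push p f) x) (FO (pull p g) y)" "FA p u = FA p v"
    using u v by (auto simp: fibre_hom)
  have "u \<odot>\<^bsub>X\<^esub> cocart_lift p f x = v \<odot>\<^bsub>X\<^esub> cocart_lift p f x"
    by (rule cartesian_cancel[OF 2(1,2) X.Cmp_in[OF 1(2) uv(1)] X.Cmp_in[OF 1(2) uv(2)] _ eq])
      (simp add: FA_Cmp[OF 1(2) uv(1)] FA_Cmp[OF 1(2) uv(2)] uv(3))
  then show ?thesis
    by (rule cocartesian_cancel_fibre[OF 1(1,2) u v])
qed

section \<open>The comparison map of a commutative square in the base\<close>

context
  fixes \<tau>' \<sigma>' \<tau> \<sigma> a b c d
  assumes \<tau>': "\<tau>' \<in> hom B a b" "\<tau>' \<in> S" and \<sigma>': "\<sigma>' \<in> hom B a c"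
    and \<tau>: "\<tau> \<in> hom B c d" "\<tau> \<in> S" and \<sigma>: "\<sigma> \<in> hom B b d"
    and square: "\<tau> \<odot>\<^bsub>B\<^esub> \<sigma>' = \<sigma> \<odot>\<^bsub>B\<^esub> \<tau>'"
begin

text \<open>The composite of the lifts over \<tau>' and \<sigma> lies over
  \<open>\<tau> \<odot> \<sigma>'\<close> by commutativity. The cartesian lift of \<tau> therefore
  splits off, and the remaining arrow over \<sigma>' factors through the cocartesian lift.\<close>

lemma bc_comparison:
  assumes x: "x \<in> Ob (fibre p b)"
  defines "\<theta> \<equiv> bc_comparison p \<tau>' \<sigma>' \<tau> \<sigma> x"
  shows "\<theta> \<in> hom (fibre p c) (FO (push p \<sigma>') (FO (pull p \<tau>') x)) (FO (pull p \<tau>) (FO (push p \<sigma>) x))"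
    and "cart_lift p \<tau> (FO (push p \<sigma>) x) \<odot>\<^bsub>X\<^esub> \<theta> \<odot>\<^bsub>X\<^esub> cocart_lift p \<sigma>' (FO (pull p \<tau>') x)
      = cocart_lift p \<sigma> x \<odot>\<^bsub>X\<^esub> cart_lift p \<tau>' x"
proof -
  note 0 = cart_lift[OF \<tau>' x] and 3 = cocart_lift[OF \<sigma> x]
  note 1 = cocart_lift[OF \<sigma>' 0(4)] and 2 = cart_lift[OF \<tau> 3(4)]
  let ?P = "\<lambda>u. u \<in> hom (fibre p c) (FO (push p \<sigma>') (FO (pull p \<tau>') x)) (FO (pull p \<tau>) (FO (push p \<sigma>) x)) \<and>
    cart_lift p \<tau> (FO (push p \<sigma>) x) \<odot>\<^bsub>X\<^esub> u \<odot>\<^bsub>X\<^esub> cocart_lift p \<sigma>' (FO (pull p \<tau>') x)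
      = cocart_lift p \<sigma> x \<odot>\<^bsub>X\<^esub> cart_lift p \<tau>' x"
  have FO: "FO p (FO (pull p \<tau>') x) = a" "FO p (FO (pull p \<tau>) (FO (push p \<sigma>) x)) = c"
    using 0(4) 2(4) by (auto simp: fibre_Ob)
  obtain w where w: "w \<in> hom X (FO (pull p \<tau>') x) (FO (pull p \<tau>) (FO (push p \<sigma>) x))" "FA p w = \<sigma>'"
    "cart_lift p \<tau> (FO (push p \<sigma>) x) \<odot>\<^bsub>X\<^esub> w = cocart_lift p \<sigma> x \<odot>\<^bsub>X\<^esub> cart_lift p \<tau>' x"
    using cartesian_factor[OF 2(1,2) X.Cmp_in[OF 0(2) 3(2)], of \<sigma>'] \<sigma>' FO
      FA_Cmp[OF 0(2) 3(2)] 0(3) 2(3) 3(3) square by auto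
  obtain u where u: "u \<in> hom (fibre p c) (FO (push p \<sigma>') (FO (pull p \<tau>') x)) (FO (pull p \<tau>) (FO (push p \<sigma>) x))"
    "u \<odot>\<^bsub>X\<^esub> cocart_lift p \<sigma>' (FO (pull p \<tau>') x) = w"
    using cocartesian_factor_fibre[OF 1(1,2) w(1) 1(3) w(2) \<sigma>'] by blast
  have "?P u" using u w by simp
  moreover have "v = u" if "?P v" for v
    using push_pull_cancel[OF \<sigma>' \<tau> 0(4) 3(4)] that \<open>?P u\<close> by simp
  ultimately have "?P (THE u. ?P u)"
    by (rule theI)
  also have "(THE u. ?P u) = \<theta>"
    using hom_Dom[OF \<tau>(1)] by (simp add: \<theta>_def bc_comparison_def)
  finally show
    "\<theta> \<in> hom (fibre p c) (FO (push p \<sigma>') (FO (pull p \<tau>') x)) (FO (pull p \<tau>) (FO (push p \<sigma>) x))"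
    "cart_lift p \<tau> (FO (push p \<sigma>) x) \<odot>\<^bsub>X\<^esub> \<theta> \<odot>\<^bsub>X\<^esub> cocart_lift p \<sigma>' (FO (pull p \<tau>') x)
      = cocart_lift p \<sigma> x \<odot>\<^bsub>X\<^esub> cart_lift p \<tau>' x"
    by auto
qed

text \<open>Naturality is formal: both sides become equal after composing with the lifts.
  Invertibility is left as a hypothesis because it is where the geometry of the square
  enters.\<close>

lemma nat_iso_bc_comparison:
  assumes iso: "\<And>x. x \<in> Ob (fibre p b) \<Longrightarrow> iso_arrow X (bc_comparison p \<tau>' \<sigma>' \<tau> \<sigma> x)"
  shows "nat_iso (push p \<sigma>' \<circ>\<^sub>F pull p \<tau>') (pull p \<tau> \<circ>\<^sub>F push p \<sigma>) (bc_comparison p \<tau>' \<sigma>' \<tau> \<sigma>)"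
proof -
  let ?\<theta> = "bc_comparison p \<tau>' \<sigma>' \<tau> \<sigma>"
  note simps = push_simps(1,2)[OF \<sigma>'] push_simps(1,2)[OF \<sigma>] pull_simps(1,2)[OF \<tau>'(1)] pull_simps(1,2)[OF \<tau>(1)]
  interpret Fb: category "fibre p b" by (rule category_fibre[OF B.hom_Ob1[OF \<sigma>]])
  interpret Fc: category "fibre p c" by (rule category_fibre[OF B.hom_Ob1[OF \<tau>(1)]])
  show ?thesis
  proof (rule nat_isoI; (simp only: comp_fctr_simps simps fibre_Cmp)?)
    show "FA (pull p \<tau>) (FA (push p \<sigma>) l) \<odot>\<^bsub>X\<^esub> ?\<theta> x = ?\<theta> y \<odot>\<^bsub>X\<^esub> FA (push p \<sigma>') (FA (pull p \<tau>') l)"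
      if l: "l \<in> hom (fibre p b) x y" for l x y
    proof -
      note x = Fb.hom_Ob1[OF l] and y = Fb.hom_Ob2[OF l]
      note x0 = cart_lift[OF \<tau>' x] and x3 = cocart_lift[OF \<sigma> x]
      note x1 = cocart_lift[OF \<sigma>' x0(4)] and x2 = cart_lift[OF \<tau> x3(4)]
      note y0 = cart_lift[OF \<tau>' y] and y3 = cocart_lift[OF \<sigma> y]
      note y1 = cocart_lift[OF \<sigma>' y0(4)] and y2 = cart_lift[OF \<tau> y3(4)]
      note l0 = pull_FA[OF \<tau>' l] and l3 = push_FA[OF \<sigma> l]
      note l1 = push_FA[OF \<sigma>' l0(1)] and l2 = pull_FA[OF \<tau> l3(1)]
      note \<theta>x = bc_comparison[OF x] and \<theta>y = bc_comparison[OF y]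
      note h = l[unfolded fibre_hom, THEN conjunct1] l0(1)[unfolded fibre_hom, THEN conjunct1]
        l1(1)[unfolded fibre_hom, THEN conjunct1] l2(1)[unfolded fibre_hom, THEN conjunct1]
        l3(1)[unfolded fibre_hom, THEN conjunct1]
        \<theta>x(1)[unfolded fibre_hom, THEN conjunct1] \<theta>y(1)[unfolded fibre_hom, THEN conjunct1]
      show ?thesis
      proof (rule push_pull_cancel[OF \<sigma>' \<tau> x0(4) y3(4) Fc.Cmp_in[OF \<theta>x(1) l2(1), simplified]
              Fc.Cmp_in[OF l1(1) \<theta>y(1), simplified]])
        let ?e = "cart_lift p \<tau> (FO (push p \<sigma>) y)" and ?c = "cocart_lift p \<sigma>' (FO (pull p \<tau>') x)"
        have "?e \<odot>\<^bsub>X\<^esub> (FA (pull p \<tau>) (FA (push p \<sigma>) l) \<odot>\<^bsub>X\<^esub> ?\<theta> x) \<odot>\<^bsub>X\<^esub> ?c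
            = FA (push p \<sigma>) l \<odot>\<^bsub>X\<^esub> (cart_lift p \<tau> (FO (push p \<sigma>) x) \<odot>\<^bsub>X\<^esub> ?\<theta> x \<odot>\<^bsub>X\<^esub> ?c)"
          using l2(2) X.assoc[OF X.Cmp_in[OF x1(2) h(6)] h(4) y2(2)] X.assoc[OF x1(2) h(6,4)]
            X.assoc[OF X.Cmp_in[OF x1(2) h(6)] x2(2) h(5)] by metis
        also have "\<dots> = (FA (push p \<sigma>) l \<odot>\<^bsub>X\<^esub> cocart_lift p \<sigma> x) \<odot>\<^bsub>X\<^esub> cart_lift p \<tau>' x"
          using \<theta>x(2) X.assoc[OF x0(2) x3(2) h(5)] by metis
        also have "\<dots> = (cocart_lift p \<sigma> y \<odot>\<^bsub>X\<^esub> cart_lift p \<tau>' y) \<odot>\<^bsub>X\<^esub> FA (pull p \<tau>') l"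
          using l3(2) l0(2) X.assoc[OF x0(2) h(1) y3(2)] X.assoc[OF h(2) y0(2) y3(2)] by metis
        also have "\<dots> = (?e \<odot>\<^bsub>X\<^esub> ?\<theta> y \<odot>\<^bsub>X\<^esub> cocart_lift p \<sigma>' (FO (pull p \<tau>') y)) \<odot>\<^bsub>X\<^esub> FA (pull p \<tau>') l"
          using \<theta>y(2) by simp
        also have "\<dots> = ?e \<odot>\<^bsub>X\<^esub> (?\<theta> y \<odot>\<^bsub>X\<^esub> FA (push p \<sigma>') (FA (pull p \<tau>') l)) \<odot>\<^bsub>X\<^esub> ?c"
          using l1(2) X.assoc[OF h(2) X.Cmp_in[OF y1(2) h(7)] y2(2)] X.assoc[OF h(2) y1(2) h(7)]
            X.assoc[OF x1(2) h(3,7)] by metis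
        finally show "?e \<odot>\<^bsub>X\<^esub> (FA (pull p \<tau>) (FA (push p \<sigma>) l) \<odot>\<^bsub>X\<^esub> ?\<theta> x) \<odot>\<^bsub>X\<^esub> ?c
          = ?e \<odot>\<^bsub>X\<^esub> (?\<theta> y \<odot>\<^bsub>X\<^esub> FA (push p \<sigma>') (FA (pull p \<tau>') l)) \<odot>\<^bsub>X\<^esub> ?c" .
      qed
    qed
    show "iso_arrow (fibre p c) (?\<theta> x)" if "x \<in> Ob (fibre p b)" for x
      using fibre_iso[OF bc_comparison(1)[OF that] B.hom_Ob1[OF \<tau>(1)] iso[OF that]] .
    show "is_functor (push p \<sigma>' \<circ>\<^sub>F pull p \<tau>')"
      by (rule is_functor_comp[OF is_functor_pull[OF \<tau>'] is_functor_push[OF \<sigma>']]) (simp only: simps)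
    show "is_functor (pull p \<tau> \<circ>\<^sub>F push p \<sigma>)"
      by (rule is_functor_comp[OF is_functor_push[OF \<sigma>] is_functor_pull[OF \<tau>]]) (simp only: simps)
  qed (fact bc_comparison(1))
qed

end

end

section \<open>Finite injections and monotone maps\<close>

lemma FinInj_hom: "f \<in> hom FinInj A B \<longleftrightarrow> src f = A \<and> tgt f = B \<and> finite A \<and> finite B \<and>
    dat f \<in> A \<rightarrow>\<^sub>E B \<and> inj_on (dat f) A"
  by (cases f) (auto simp: FinInj_def hom_def)

lemma FinInj_Ob: "A \<in> Ob FinInj \<longleftrightarrow> finite A"
  by (simp add: FinInj_def)

lemma FinInj_Cmp: "src (g \<odot>\<^bsub>FinInj\<^esub> f) = src f" "tgt (g \<odot>\<^bsub>FinInj\<^esub> f) = tgt g"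
  "dat (g \<odot>\<^bsub>FinInj\<^esub> f) = compose (src f) (dat g) (dat f)"
  by (auto simp: FinInj_def)

lemma FinInj_Idn: "Idn FinInj A = Arrow A (\<lambda>x\<in>A. x) A"
  by (simp add: FinInj_def)

lemma FinInj_eqI:
  assumes "f \<in> hom FinInj A B" "g \<in> hom FinInj A B" "\<And>x. x \<in> A \<Longrightarrow> dat f x = dat g x"
  shows "f = g"
proof -
  have "dat f = dat g"
    using assms by (intro PiE_ext[of "dat f" A "\<lambda>_. B"]) (auto simp: FinInj_hom)
  then show ?thesis
    using assms(1,2) by (auto simp: FinInj_hom intro: arrow.expand)
qed

lemma FinInj_app: "f \<in> hom FinInj A B \<Longrightarrow> x \<in> A \<Longrightarrow> dat f x \<in> B"
  unfolding FinInj_hom by blast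

lemma FinInj_inj: "f \<in> hom FinInj A B \<Longrightarrow> x \<in> A \<Longrightarrow> y \<in> A \<Longrightarrow> dat f x = dat f y \<Longrightarrow> x = y"
  unfolding FinInj_hom by (meson inj_onD)

lemma FinInj_Cmp_apply:
  "f \<in> hom FinInj A B \<Longrightarrow> x \<in> A \<Longrightarrow> dat (g \<odot>\<^bsub>FinInj\<^esub> f) x = dat g (dat f x)"
  unfolding FinInj_Cmp FinInj_hom compose_def by simp

lemma FinInj_homI:
  assumes "finite A" "finite B" "\<And>x. x \<in> A \<Longrightarrow> h x \<in> B"
    "\<And>x y. x \<in> A \<Longrightarrow> y \<in> A \<Longrightarrow> h x = h y \<Longrightarrow> x = y"
  shows "Arrow A (\<lambda>x\<in>A. h x) B \<in> hom FinInj A B"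
  using assms by (simp add: FinInj_hom restrict_PiE_iff inj_on_def)

lemma category_FinInj: "category FinInj"
proof
  show Cmp: "g \<odot>\<^bsub>FinInj\<^esub> f \<in> hom FinInj x z"
    if f: "f \<in> hom FinInj x y" and g: "g \<in> hom FinInj y z" for f g x y z
  proof -
    have "Arrow x (\<lambda>a\<in>x. dat g (dat f a)) z \<in> hom FinInj x z"
    proof (rule FinInj_homI)
      show "a = b" if "a \<in> x" "b \<in> x" "dat g (dat f a) = dat g (dat f b)" for a b
        using FinInj_inj[OF f that(1,2)] FinInj_inj[OF g FinInj_app[OF f that(1)] FinInj_app[OF f that(2)]]
          that(3) by blast
      show "dat g (dat f a) \<in> z" if "a \<in> x" for a
        using FinInj_app[OF g FinInj_app[OF f that]] .
    qed (use f g in \<open>simp_all add: FinInj_hom\<close>)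
    moreover have "g \<odot>\<^bsub>FinInj\<^esub> f = Arrow x (\<lambda>a\<in>x. dat g (dat f a)) z"
      using f g by (intro arrow.expand) (simp add: FinInj_Cmp FinInj_hom compose_def)
    ultimately show ?thesis by simp
  qed
  show Idn: "Idn FinInj x \<in> hom FinInj x x" if "x \<in> Ob FinInj" for x
    using that FinInj_homI[of x x "\<lambda>a. a"] by (simp add: FinInj_Ob FinInj_Idn)
  show "Idn FinInj y \<odot>\<^bsub>FinInj\<^esub> f = f" if f: "f \<in> hom FinInj x y" for f x y
  proof (rule FinInj_eqI[OF Cmp[OF f Idn] f])
    show "dat (Idn FinInj y \<odot>\<^bsub>FinInj\<^esub> f) a = dat f a" if "a \<in> x" for a
      using FinInj_Cmp_apply[OF f that] FinInj_app[OF f that] by (simp add: FinInj_Idn)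
  qed (use f in \<open>simp add: FinInj_hom FinInj_Ob\<close>)
  show "f \<odot>\<^bsub>FinInj\<^esub> Idn FinInj x = f" if f: "f \<in> hom FinInj x y" for f x y
  proof -
    have I: "Idn FinInj x \<in> hom FinInj x x"
      using f by (intro Idn) (simp add: FinInj_hom FinInj_Ob)
    show ?thesis
      by (rule FinInj_eqI[OF Cmp[OF I f] f]) (simp add: FinInj_Cmp_apply[OF I], simp add: FinInj_Idn)
  qed
  show "h \<odot>\<^bsub>FinInj\<^esub> (g \<odot>\<^bsub>FinInj\<^esub> f) = (h \<odot>\<^bsub>FinInj\<^esub> g) \<odot>\<^bsub>FinInj\<^esub> f"
    if f: "f \<in> hom FinInj w x" and g: "g \<in> hom FinInj x y" and h: "h \<in> hom FinInj y z" for f g h w x y z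
    by (rule FinInj_eqI[OF Cmp[OF Cmp[OF f g] h] Cmp[OF f Cmp[OF g h]]])
      (simp add: FinInj_Cmp_apply[OF f] FinInj_Cmp_apply[OF Cmp[OF f g]]
        FinInj_Cmp_apply[OF g FinInj_app[OF f]])
qed (auto simp: FinInj_def)

interpretation FinInj: category FinInj
  by (rule category_FinInj)

text \<open>The factorization sends \<open>x\<close> to the preimage of its value under the
  injection \<open>e\<close>. Together with \<open>FinInj_cancel\<close> it lets arrows of
  \<open>FinInj\<close> be handled like subset inclusions.\<close>

lemma FinInj_factor:
  assumes e: "e \<in> hom FinInj B C" and g: "g \<in> hom FinInj A C" and sub: "dat g ` A \<subseteq> dat e ` B"
  shows "\<exists>v \<in> hom FinInj A B. e \<odot>\<^bsub>FinInj\<^esub> v = g"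
proof -
  let ?v = "Arrow A (\<lambda>x\<in>A. inv_into B (dat e) (dat g x)) B"
  have *: "dat e (inv_into B (dat e) (dat g x)) = dat g x" "inv_into B (dat e) (dat g x) \<in> B"
    if "x \<in> A" for x
    using sub that by (auto intro!: f_inv_into_f inv_into_into)
  have v: "?v \<in> hom FinInj A B"
  proof (rule FinInj_homI)
    show "x = y" if "x \<in> A" "y \<in> A" "inv_into B (dat e) (dat g x) = inv_into B (dat e) (dat g y)" for x y
      using FinInj_inj[OF g that(1,2)] *(1)[OF that(1)] *(1)[OF that(2)] that(3) by metis
  qed (use e g *(2) in \<open>simp_all add: FinInj_hom\<close>)
  moreover have "e \<odot>\<^bsub>FinInj\<^esub> ?v = g"
    by (rule FinInj_eqI[OF FinInj.Cmp_in[OF v e] g]) (simp add: FinInj_Cmp_apply[OF v] *)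
  ultimately show ?thesis by blast
qed

lemma FinInj_cancel:
  assumes e: "e \<in> hom FinInj B C" and h: "h \<in> hom FinInj A B" "h' \<in> hom FinInj A B"
    and eq: "e \<odot>\<^bsub>FinInj\<^esub> h = e \<odot>\<^bsub>FinInj\<^esub> h'"
  shows "h = h'"
proof (rule FinInj_eqI[OF h])
  fix x assume x: "x \<in> A"
  then have "dat e (dat h x) = dat e (dat h' x)"
    using eq FinInj_Cmp_apply[OF h(1) x] FinInj_Cmp_apply[OF h(2) x] by metis
  then show "dat h x = dat h' x"
    by (rule FinInj_inj[OF e FinInj_app[OF h(1) x] FinInj_app[OF h(2) x]])
qed

section \<open>Monotone maps and convex maps\<close>

lemma Simplex_hom: "f \<in> hom Simplex m n \<longleftrightarrow> src f = m \<and> tgt f = n \<and>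
    dat f \<in> {1..m} \<rightarrow>\<^sub>E {1..n} \<and> mono_on {1..m} (dat f)"
  by (cases f) (auto simp: Simplex_def hom_def)

lemma Simplex_Ob [simp]: "n \<in> Ob Simplex"
  by (simp add: Simplex_def)

lemma Simplex_Cmp: "src (g \<odot>\<^bsub>Simplex\<^esub> f) = src f" "tgt (g \<odot>\<^bsub>Simplex\<^esub> f) = tgt g"
  "dat (g \<odot>\<^bsub>Simplex\<^esub> f) = compose {1..src f} (dat g) (dat f)"
  by (auto simp: Simplex_def)

lemma Simplex_Idn: "Idn Simplex n = Arrow n (\<lambda>x\<in>{1..n}. x) n"
  by (simp add: Simplex_def)

lemma Simplex_eqI:
  assumes "f \<in> hom Simplex m n" "g \<in> hom Simplex m n" "\<And>x. x \<in> {1..m} \<Longrightarrow> dat f x = dat g x"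
  shows "f = g"
proof -
  have "dat f = dat g"
    using assms by (intro PiE_ext[of "dat f" "{1..m}" "\<lambda>_. {1..n}"]) (auto simp: Simplex_hom)
  then show ?thesis
    using assms(1,2) by (auto simp: Simplex_hom intro: arrow.expand)
qed

lemma Simplex_app: "f \<in> hom Simplex m n \<Longrightarrow> x \<in> {1..m} \<Longrightarrow> dat f x \<in> {1..n}"
  unfolding Simplex_hom by blast

lemma Simplex_Cmp_apply:
  "f \<in> hom Simplex m n \<Longrightarrow> x \<in> {1..m} \<Longrightarrow> dat (g \<odot>\<^bsub>Simplex\<^esub> f) x = dat g (dat f x)"
  unfolding Simplex_Cmp Simplex_hom compose_def by simp

lemma Simplex_Idn_apply: "x \<in> {1..n} \<Longrightarrow> dat (Idn Simplex n) x = x"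
  by (simp add: Simplex_Idn)

lemma category_Simplex: "category Simplex"
proof
  show Cmp: "g \<odot>\<^bsub>Simplex\<^esub> f \<in> hom Simplex x z"
    if f: "f \<in> hom Simplex x y" and g: "g \<in> hom Simplex y z" for f g x y z
  proof -
    have "compose {1..x} (dat g) (dat f) \<in> {1..x} \<rightarrow>\<^sub>E {1..z}"
      unfolding compose_def using Simplex_app[OF f] Simplex_app[OF g] by (intro restrict_PiE_iff[THEN iffD2]) blast
    moreover have "mono_on {1..x} (compose {1..x} (dat g) (dat f))"
    proof (rule mono_onI)
      fix r s assume rs: "r \<in> {1..x}" "s \<in> {1..x}" "r \<le> s"
      then have "dat f r \<le> dat f s"
        using f unfolding Simplex_hom by (meson mono_onD)
      then have "dat g (dat f r) \<le> dat g (dat f s)"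
        using g Simplex_app[OF f] rs unfolding Simplex_hom by (meson mono_onD)
      then show "compose {1..x} (dat g) (dat f) r \<le> compose {1..x} (dat g) (dat f) s"
        unfolding compose_def restrict_apply'[OF rs(1)] restrict_apply'[OF rs(2)] .
    qed
    ultimately show ?thesis
      using f g by (simp add: Simplex_hom Simplex_Cmp)
  qed
  show Idn: "Idn Simplex x \<in> hom Simplex x x" for x
    by (auto simp: Simplex_hom Simplex_Idn mono_on_def)
  show "Idn Simplex y \<odot>\<^bsub>Simplex\<^esub> f = f" if f: "f \<in> hom Simplex x y" for f x y
    by (rule Simplex_eqI[OF Cmp[OF f Idn] f])
      (simp only: Simplex_Cmp_apply[OF f] Simplex_Idn_apply Simplex_app[OF f])
  show "f \<odot>\<^bsub>Simplex\<^esub> Idn Simplex x = f" if f: "f \<in> hom Simplex x y" for f x y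
    by (rule Simplex_eqI[OF Cmp[OF Idn f] f])
      (simp only: Simplex_Cmp_apply[OF Idn] Simplex_Idn_apply)
  show "h \<odot>\<^bsub>Simplex\<^esub> (g \<odot>\<^bsub>Simplex\<^esub> f) = (h \<odot>\<^bsub>Simplex\<^esub> g) \<odot>\<^bsub>Simplex\<^esub> f"
    if f: "f \<in> hom Simplex w x" and g: "g \<in> hom Simplex x y" and h: "h \<in> hom Simplex y z" for f g h w x y z
    by (rule Simplex_eqI[OF Cmp[OF Cmp[OF f g] h] Cmp[OF f Cmp[OF g h]]])
      (simp only: Simplex_Cmp_apply[OF f] Simplex_Cmp_apply[OF Cmp[OF f g]]
        Simplex_Cmp_apply[OF g Simplex_app[OF f]])
qed (auto simp: Simplex_def)

interpretation Simplex: category Simplex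
  by (rule category_Simplex)

lemma Simplex_mono:
  "f \<in> hom Simplex m n \<Longrightarrow> x \<in> {1..m} \<Longrightarrow> y \<in> {1..m} \<Longrightarrow> x \<le> y \<Longrightarrow> dat f x \<le> dat f y"
  unfolding Simplex_hom by (meson mono_onD)

text \<open>A convex map is a translation. The index is written \<open>Suc y\<close> because objects
  start at 1, so the first value serves as base point.\<close>

lemma convex_maps_apply:
  assumes "j \<in> convex_maps" "Suc y \<le> src j"
  shows "dat j (Suc y) = dat j (Suc 0) + y"
  using assms(2)
proof (induction y)
  case (Suc y)
  have "dat j (Suc y + 1) = dat j (Suc y) + 1"
    using assms(1) Suc.prems unfolding convex_maps_def by simp
  then show ?case using Suc by simp
qed simp

lemma convex_maps_inj:
  assumes "j \<in> convex_maps"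
  shows "inj_on (dat j) {1..src j}"
proof (rule inj_onI)
  fix x y assume xy: "x \<in> {1..src j}" "y \<in> {1..src j}" and eq: "dat j x = dat j y"
  obtain x' y' where "x = Suc x'" "y = Suc y'"
    using xy by (metis atLeastAtMost_iff not0_implies_Suc not_one_le_zero)
  then show "x = y"
    using convex_maps_apply[OF assms, of x'] convex_maps_apply[OF assms, of y'] xy eq
    by (metis add_left_cancel atLeastAtMost_iff)
qed

section \<open>The comma category of a right fibration\<close>

text \<open>Abstracts the Grothendieck construction to the two properties used from here on. That
  every arrow is cartesian expresses the groupoid fibres.\<close>

locale right_fibration =
  fixes U :: "('e, 'n, 'a set, ('a set, 'a \<Rightarrow> 'a) arrow) fctr"
  assumes U_functor: "is_functor U"
    and U_Tgt: "Tgt U = FinInj"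
    and U_lift: "f \<in> Ar FinInj \<Longrightarrow> c \<in> Ob (Src U) \<Longrightarrow> FO U c = Cod FinInj f \<Longrightarrow>
      \<exists>e \<in> Ar (Src U). Cod (Src U) e = c \<and> FA U e = f"
    and U_cartesian: "e \<in> Ar (Src U) \<Longrightarrow> cartesian_arrow U e"
begin

abbreviation (input) "E \<equiv> Src U"

sublocale E: category E
  using U_functor by (rule is_functor_category_Src)

sublocale U: base_functor U
  using U_functor by unfold_locales

section \<open>Arrows of the total category and their underlying injections\<close>

definition und :: "'n \<Rightarrow> 'a \<Rightarrow> 'a" where
  "und \<rho> = dat (FA U \<rho>)"

lemma U_hom: "\<rho> \<in> hom E c c' \<Longrightarrow> FA U \<rho> \<in> hom FinInj (FO U c) (FO U c')"
  using U.FA_hom U_Tgt by simp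

lemma finite_FO: "c \<in> Ob E \<Longrightarrow> finite (FO U c)"
  using U.FO_Ob[of c] U_Tgt by (simp add: FinInj_Ob)

lemma und_in: "\<rho> \<in> hom E c c' \<Longrightarrow> a \<in> FO U c \<Longrightarrow> und \<rho> a \<in> FO U c'"
  unfolding und_def using U_hom by (rule FinInj_app)

lemma und_inj: "\<rho> \<in> hom E c c' \<Longrightarrow> inj_on (und \<rho>) (FO U c)"
  unfolding und_def using U_hom FinInj_hom by metis

lemma und_Cmp: "\<rho> \<in> hom E c c' \<Longrightarrow> \<rho>' \<in> hom E c' c'' \<Longrightarrow> a \<in> FO U c \<Longrightarrow> und (\<rho>' \<odot>\<^bsub>E\<^esub> \<rho>) a = und \<rho>' (und \<rho> a)"
  unfolding und_def using U.FA_Cmp[of \<rho> c c' \<rho>' c''] FinInj_Cmp_apply[OF U_hom] U_Tgt by simp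

lemma und_Idn: "c \<in> Ob E \<Longrightarrow> a \<in> FO U c \<Longrightarrow> und (Idn E c) a = a"
  unfolding und_def using U.FA_Idn[of c] U_Tgt by (simp add: FinInj_Idn)

text \<open>Since \<open>e\<close> is cartesian, a factorization of underlying injections lifts, and
  for injections inclusion of images is enough.\<close>

lemma E_factor:
  assumes e: "e \<in> hom E c' c''" and g: "g \<in> hom E c c''" and sub: "und g ` FO U c \<subseteq> und e ` FO U c'"
  shows "\<exists>h \<in> hom E c c'. e \<odot>\<^bsub>E\<^esub> h = g"
proof -
  obtain v where v: "v \<in> hom FinInj (FO U c) (FO U c')" "FA U e \<odot>\<^bsub>FinInj\<^esub> v = FA U g"
    using FinInj_factor[OF U_hom[OF e] U_hom[OF g]] sub unfolding und_def by blast
  show ?thesis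
    using U.cartesian_factor[OF U_cartesian[OF hom_Ar[OF e]] e g, of v] v U_Tgt by auto
qed

text \<open>Every arrow of the total category is monic: underlying injections cancel, and the
  cartesian property lifts the equality.\<close>

lemma E_cancel:
  assumes e: "e \<in> hom E c' c''" and h: "h \<in> hom E c c'" "h' \<in> hom E c c'"
    and eq: "e \<odot>\<^bsub>E\<^esub> h = e \<odot>\<^bsub>E\<^esub> h'"
  shows "h = h'"
proof (rule U.cartesian_cancel[OF U_cartesian[OF hom_Ar[OF e]] e h _ eq])
  have "FA U e \<odot>\<^bsub>FinInj\<^esub> FA U h = FA U e \<odot>\<^bsub>FinInj\<^esub> FA U h'"
    using eq U.FA_Cmp[OF h(1) e] U.FA_Cmp[OF h(2) e] U_Tgt by simp
  then show "FA U h = FA U h'"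
    by (rule FinInj_cancel[OF U_hom[OF e] U_hom[OF h(1)] U_hom[OF h(2)]])
qed

text \<open>A surjective underlying map lets the identity of the target factor through
  \<open>e\<close>, giving a right inverse; monicity of \<open>e\<close> makes it two-sided.
  Invertibility thus becomes a statement about elements.\<close>

lemma E_iso_iff:
  assumes e: "e \<in> hom E c c'"
  shows "iso_arrow E e \<longleftrightarrow> FO U c' \<subseteq> und e ` FO U c"
proof
  assume iso: "iso_arrow E e"
  obtain g where g: "g \<in> hom E c' c" "e \<odot>\<^bsub>E\<^esub> g = Idn E c'"
    using iso_arrow_inverse[OF iso e] by blast
  have "b = und e (und g b)" if "b \<in> FO U c'" for b
    using und_Cmp[OF g(1) e that] und_Idn[OF E.hom_Ob2[OF e] that] g(2) by simp
  then show "FO U c' \<subseteq> und e ` FO U c"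
    using und_in[OF g(1)] by blast
next
  assume sub: "FO U c' \<subseteq> und e ` FO U c"
  note Id = E.Idn_in[OF E.hom_Ob2[OF e]] and Id' = E.Idn_in[OF E.hom_Ob1[OF e]]
  have "und (Idn E c') ` FO U c' \<subseteq> und e ` FO U c"
    using sub und_Idn[OF E.hom_Ob2[OF e]] by auto
  then obtain h where h: "h \<in> hom E c' c" "e \<odot>\<^bsub>E\<^esub> h = Idn E c'"
    using E_factor[OF e Id] by blast
  have "h \<odot>\<^bsub>E\<^esub> e = Idn E c"
    by (rule E_cancel[OF e E.Cmp_in[OF e h(1)] Id'])
      (simp only: E.assoc[OF e h(1) e] h(2) E.Idn_left[OF e] E.Idn_right[OF e])
  then show "iso_arrow E e"
    using h iso_arrow_iff[OF e] by blast
qed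

text \<open>Lifting the literal inclusion of \<open>A\<close> keeps \<open>A\<close> as underlying
  set, so labels can be restricted without renaming elements.\<close>

lemma E_restrict:
  assumes c: "c \<in> Ob E" and A: "A \<subseteq> FO U c"
  shows "\<exists>c' e. e \<in> hom E c' c \<and> FO U c' = A \<and> (\<forall>a \<in> A. und e a = a)"
proof -
  let ?f = "Arrow A (\<lambda>a\<in>A. a) (FO U c)"
  have f: "?f \<in> hom FinInj A (FO U c)"
    using finite_FO[OF c] A finite_subset[OF A] by (intro FinInj_homI) auto
  obtain e where e: "e \<in> Ar E" "Cod E e = c" "FA U e = ?f"
    using U_lift[OF hom_Ar[OF f] c] hom_Cod[OF f] by auto
  then have eh: "e \<in> hom E (Dom E e) c"
    by (auto simp: hom_def)
  moreover have "FO U (Dom E e) = A"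
    using U_hom[OF eh] e(3) f by (simp add: FinInj_hom)
  ultimately show ?thesis
    using e(3) by (intro exI[of _ "Dom E e"] exI[of _ e]) (auto simp: und_def)
qed

section \<open>The comma category of labelled objects and its projection\<close>

abbreviation (input) "K \<equiv> comma_simplex U"
abbreviation (input) "proj \<equiv> comma_simplex_proj U"

abbreviation ob :: "'e \<times> nat \<times> ('a \<Rightarrow> nat) \<Rightarrow> 'e" where "ob x \<equiv> fst x"
abbreviation deg :: "'e \<times> nat \<times> ('a \<Rightarrow> nat) \<Rightarrow> nat" where "deg x \<equiv> fst (snd x)"
abbreviation lab :: "'e \<times> nat \<times> ('a \<Rightarrow> nat) \<Rightarrow> 'a \<Rightarrow> nat" where "lab x \<equiv> snd (snd x)"
abbreviation rho :: "('e \<times> nat \<times> ('a \<Rightarrow> nat), 'n \<times> (nat, nat \<Rightarrow> nat) arrow) arrow \<Rightarrow> 'n" where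
  "rho s \<equiv> fst (dat s)"
abbreviation ord :: "('e \<times> nat \<times> ('a \<Rightarrow> nat), 'n \<times> (nat, nat \<Rightarrow> nat) arrow) arrow \<Rightarrow>
    (nat, nat \<Rightarrow> nat) arrow" where
  "ord s \<equiv> snd (dat s)"

lemma K_Ob: "x \<in> Ob K \<longleftrightarrow> ob x \<in> Ob E \<and> lab x \<in> FO U (ob x) \<rightarrow>\<^sub>E {1..deg x}"
  by (cases x) (simp add: comma_simplex_def Let_def)

lemma K_hom: "s \<in> hom K x y \<longleftrightarrow> src s = x \<and> tgt s = y \<and> x \<in> Ob K \<and> y \<in> Ob K \<and>
    rho s \<in> hom E (ob x) (ob y) \<and> ord s \<in> hom Simplex (deg x) (deg y) \<and>
    (\<forall>a \<in> FO U (ob x). lab y (und (rho s) a) = dat (ord s) (lab x a))"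
  unfolding hom_def[of "comma_simplex U"] und_def
  by (cases s; cases x; cases y) (auto simp: comma_simplex_def Let_def)

lemma K_homD:
  assumes "s \<in> hom K x y"
  shows "rho s \<in> hom E (ob x) (ob y)" "ord s \<in> hom Simplex (deg x) (deg y)"
    "a \<in> FO U (ob x) \<Longrightarrow> lab y (und (rho s) a) = dat (ord s) (lab x a)"
    "x \<in> Ob K" "y \<in> Ob K"
  using assms unfolding K_hom by blast+

lemma K_eqI: "s \<in> hom K x y \<Longrightarrow> t \<in> hom K x y \<Longrightarrow> rho s = rho t \<Longrightarrow> ord s = ord t \<Longrightarrow> s = t"
  by (cases s; cases t) (auto simp: K_hom prod_eq_iff)

lemma K_Cmp: "src (g \<odot>\<^bsub>K\<^esub> f) = src f" "tgt (g \<odot>\<^bsub>K\<^esub> f) = tgt g"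
  "rho (g \<odot>\<^bsub>K\<^esub> f) = rho g \<odot>\<^bsub>E\<^esub> rho f" "ord (g \<odot>\<^bsub>K\<^esub> f) = ord g \<odot>\<^bsub>Simplex\<^esub> ord f"
  by (auto simp: comma_simplex_def Let_def)

lemma K_Idn: "Idn K x = Arrow x (Idn E (ob x), Idn Simplex (deg x)) x"
  by (cases x) (simp add: comma_simplex_def Let_def)

lemma lab_in: "x \<in> Ob K \<Longrightarrow> a \<in> FO U (ob x) \<Longrightarrow> lab x a \<in> {1..deg x}"
  unfolding K_Ob by blast

lemma category_K: "category K"
proof
  show Cmp: "g \<odot>\<^bsub>K\<^esub> f \<in> hom K x z" if f: "f \<in> hom K x y" and g: "g \<in> hom K y z" for f g x y z
  proof -
    note f' = K_homD[OF f] and g' = K_homD[OF g]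
    have "lab z (und (rho g \<odot>\<^bsub>E\<^esub> rho f) a) = dat (ord g \<odot>\<^bsub>Simplex\<^esub> ord f) (lab x a)"
      if a: "a \<in> FO U (ob x)" for a
      using und_Cmp[OF f'(1) g'(1) a] Simplex_Cmp_apply[OF f'(2) lab_in[OF f'(4) a]] f'(3)[OF a]
        g'(3)[OF und_in[OF f'(1) a]] by simp
    then show ?thesis
      using f g E.Cmp_in[OF f'(1) g'(1)] Simplex.Cmp_in[OF f'(2) g'(2)] unfolding K_hom K_Cmp by blast
  qed
  show Idn: "Idn K x \<in> hom K x x" if x: "x \<in> Ob K" for x
    using x E.Idn_in Simplex.Idn_in[OF Simplex_Ob] und_Idn Simplex_Idn_apply[OF lab_in[OF x]]
    by (simp add: K_hom K_Idn K_Ob)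
  show "Dom K f \<in> Ob K" "Cod K f \<in> Ob K" if "f \<in> Ar K" for f
    using K_homD(4,5)[OF Ar_hom[OF that]] by auto
  show "Idn K y \<odot>\<^bsub>K\<^esub> f = f" if f: "f \<in> hom K x y" for f x y
    by (rule K_eqI[OF Cmp[OF f Idn[OF K_homD(5)[OF f]]] f])
      (simp_all add: K_Cmp K_Idn E.Idn_left[OF K_homD(1)[OF f]] Simplex.Idn_left[OF K_homD(2)[OF f]])
  show "f \<odot>\<^bsub>K\<^esub> Idn K x = f" if f: "f \<in> hom K x y" for f x y
    by (rule K_eqI[OF Cmp[OF Idn[OF K_homD(4)[OF f]] f] f])
      (simp_all add: K_Cmp K_Idn E.Idn_right[OF K_homD(1)[OF f]] Simplex.Idn_right[OF K_homD(2)[OF f]])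
  show "h \<odot>\<^bsub>K\<^esub> (g \<odot>\<^bsub>K\<^esub> f) = (h \<odot>\<^bsub>K\<^esub> g) \<odot>\<^bsub>K\<^esub> f"
    if f: "f \<in> hom K w x" and g: "g \<in> hom K x y" and h: "h \<in> hom K y z" for f g h w x y z
    by (rule K_eqI[OF Cmp[OF Cmp[OF f g] h] Cmp[OF f Cmp[OF g h]]])
      (simp_all add: K_Cmp E.assoc[OF K_homD(1)[OF f] K_homD(1)[OF g] K_homD(1)[OF h]]
        Simplex.assoc[OF K_homD(2)[OF f] K_homD(2)[OF g] K_homD(2)[OF h]])
qed

lemma proj_simps [simp]: "Src proj = K" "Tgt proj = Simplex" "FO proj x = deg x" "FA proj s = ord s"
  by (auto simp: comma_simplex_proj_def split: prod.split)

lemma is_functor_proj: "is_functor proj"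
  by (rule is_functorI) (auto simp: category_K category_Simplex K_Cmp K_Idn K_homD(2))

sublocale K: category K
  by (rule category_K)

sublocale proj: base_functor proj
  rewrites "Src proj = K" and "Tgt proj = Simplex"
    and "FO proj = (\<lambda>x. deg x)" and "FA proj = (\<lambda>s. ord s)"
  using is_functor_proj by unfold_locales auto

text \<open>Invertibility of \<open>rho s\<close> determines the component of the factorization in
  the total category. Its labels need checking only at elements \<open>und (rho s) a\<close>, which
  exhaust the target.\<close>

lemma proj_cocartesianI:
  assumes s: "s \<in> hom K x y" and iso: "iso_arrow E (rho s)"
  shows "cocartesian_arrow proj s"
  unfolding cocartesian_arrow_def proj_simps
proof (intro conjI ballI impI)
  note s' = K_homD[OF s]
  show "s \<in> Ar K" using s by (rule hom_Ar)
  fix g v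
  assume g0: "g \<in> Ar K" and "Dom K g = Dom K s"
    and v0: "v \<in> hom Simplex (deg (Cod K s)) (deg (Cod K g))" and eq: "v \<odot>\<^bsub>Simplex\<^esub> ord s = ord g"
  define z where "z = Cod K g"
  have g: "g \<in> hom K x z"
    using Ar_hom[OF g0] \<open>Dom K g = Dom K s\<close> hom_Dom[OF s] by (simp add: z_def)
  note g' = K_homD[OF g]
  have v: "v \<in> hom Simplex (deg y) (deg z)"
    using v0 hom_Cod[OF s] by (simp add: z_def)
  obtain r where r: "r \<in> hom E (ob y) (ob z)" "r \<odot>\<^bsub>E\<^esub> rho s = rho g"
    using E.iso_factor_right[OF iso s'(1) g'(1)] by blast
  have "lab z (und r b) = dat v (lab y b)" if "b \<in> FO U (ob y)" for b
  proof -
    obtain a where a: "a \<in> FO U (ob x)" "b = und (rho s) a"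
      using iso \<open>b \<in> FO U (ob y)\<close> unfolding E_iso_iff[OF s'(1)] by blast
    show ?thesis
      using a(2) und_Cmp[OF s'(1) r(1) a(1)] r(2) g'(3)[OF a(1)] s'(3)[OF a(1)] eq
        Simplex_Cmp_apply[OF s'(2) lab_in[OF s'(4) a(1)]] by metis
  qed
  then have h: "Arrow y (r, v) z \<in> hom K y z"
    using r v s' g' by (simp add: K_hom)
  moreover have "Arrow y (r, v) z \<odot>\<^bsub>K\<^esub> s = g"
    by (rule K_eqI[OF K.Cmp_in[OF s h] g]) (simp_all add: K_Cmp r eq)
  moreover have "h = Arrow y (r, v) z"
    if "h \<in> hom K y z" "ord h = v" "h \<odot>\<^bsub>K\<^esub> s = g" for h
  proof (rule K_eqI[OF that(1) h])
    have "rho h \<odot>\<^bsub>E\<^esub> rho s = r \<odot>\<^bsub>E\<^esub> rho s"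
      using that(3) r(2) K_Cmp(3)[of h s] by simp
    then show "rho h = rho (Arrow y (r, v) z)"
      using E.iso_cancel_right[OF iso s'(1) K_homD(1)[OF that(1)] r(1)] by simp
  qed (simp add: that)
  ultimately have "\<exists>!h. h \<in> hom K y z \<and> ord h = v \<and> h \<odot>\<^bsub>K\<^esub> s = g"
    by (metis arrow.sel(2) snd_conv)
  then show "\<exists>!h. h \<in> hom K (Cod K s) (Cod K g) \<and> ord h = v \<and> h \<odot>\<^bsub>K\<^esub> s = g"
    unfolding z_def hom_Cod[OF s] .
qed

text \<open>Elements hit by \<open>g\<close> carry labels in the image of \<open>ord s\<close>, so
  the image condition provides the factorization in the total category. Injectivity of
  \<open>ord s\<close> then forces this factorization to respect labels.\<close>

lemma proj_cartesianI:
  assumes s: "s \<in> hom K x y" and inj: "inj_on (dat (ord s)) {1..deg x}"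
    and image: "\<And>b. b \<in> FO U (ob y) \<Longrightarrow> lab y b \<in> dat (ord s) ` {1..deg x} \<Longrightarrow> b \<in> und (rho s) ` FO U (ob x)"
  shows "cartesian_arrow proj s"
  unfolding cartesian_arrow_def proj_simps
proof (intro conjI ballI impI)
  note s' = K_homD[OF s]
  show "s \<in> Ar K" using s by (rule hom_Ar)
  fix g v
  assume g0: "g \<in> Ar K" and "Cod K g = Cod K s"
    and v0: "v \<in> hom Simplex (deg (Dom K g)) (deg (Dom K s))" and eq: "ord s \<odot>\<^bsub>Simplex\<^esub> v = ord g"
  define w where "w = Dom K g"
  have g: "g \<in> hom K w y"
    using Ar_hom[OF g0] \<open>Cod K g = Cod K s\<close> hom_Cod[OF s] by (simp add: w_def)
  note g' = K_homD[OF g]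
  have v: "v \<in> hom Simplex (deg w) (deg x)"
    using v0 hom_Dom[OF s] by (simp add: w_def)
  have lab_g: "lab y (und (rho g) a) = dat (ord s) (dat v (lab w a))" if "a \<in> FO U (ob w)" for a
    using g'(3)[OF that] eq Simplex_Cmp_apply[OF v lab_in[OF g'(4) that]] by metis
  have "und (rho g) ` FO U (ob w) \<subseteq> und (rho s) ` FO U (ob x)"
    using image[OF und_in[OF g'(1)]] lab_g Simplex_app[OF v lab_in[OF g'(4)]] by auto
  then obtain r where r: "r \<in> hom E (ob w) (ob x)" "rho s \<odot>\<^bsub>E\<^esub> r = rho g"
    using E_factor[OF s'(1) g'(1)] by blast
  have "lab x (und r a) = dat v (lab w a)" if a: "a \<in> FO U (ob w)" for a
  proof (rule inj_onD[OF inj])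
    show "dat (ord s) (lab x (und r a)) = dat (ord s) (dat v (lab w a))"
      using lab_g[OF a] s'(3)[OF und_in[OF r(1) a]] und_Cmp[OF r(1) s'(1) a] r(2) by simp
    show "lab x (und r a) \<in> {1..deg x}"
      using lab_in[OF s'(4) und_in[OF r(1) a]] .
    show "dat v (lab w a) \<in> {1..deg x}"
      using Simplex_app[OF v lab_in[OF g'(4) a]] .
  qed
  then have h: "Arrow w (r, v) x \<in> hom K w x"
    using r v s' g' by (simp add: K_hom)
  moreover have "s \<odot>\<^bsub>K\<^esub> Arrow w (r, v) x = g"
    by (rule K_eqI[OF K.Cmp_in[OF h s] g]) (simp_all add: K_Cmp r eq)
  moreover have "h = Arrow w (r, v) x"
    if "h \<in> hom K w x" "ord h = v" "s \<odot>\<^bsub>K\<^esub> h = g" for h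
  proof (rule K_eqI[OF that(1) h])
    have "rho s \<odot>\<^bsub>E\<^esub> rho h = rho s \<odot>\<^bsub>E\<^esub> r"
      using that(3) r(2) K_Cmp(3)[of s h] by simp
    then show "rho h = rho (Arrow w (r, v) x)"
      using E_cancel[OF s'(1) K_homD(1)[OF that(1)] r(1)] by simp
  qed (simp add: that)
  ultimately have "\<exists>!h. h \<in> hom K w x \<and> ord h = v \<and> s \<odot>\<^bsub>K\<^esub> h = g"
    by (metis arrow.sel(2) snd_conv)
  then show "\<exists>!h. h \<in> hom K (Dom K g) (Dom K s) \<and> ord h = v \<and> s \<odot>\<^bsub>K\<^esub> h = g"
    unfolding w_def hom_Dom[OF s] .
qed

text \<open>The underlying object is kept and its labels are postcomposed with \<open>f\<close>.
  Invertibility of \<open>rho s\<close> is recorded so that it can be transported to an arbitrary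
  lift.\<close>

lemma cocartesian_lift_ex:
  assumes f: "f \<in> hom Simplex m n" and x: "x \<in> Ob K" "deg x = m"
  shows "\<exists>y. \<exists>s \<in> hom K x y. cocartesian_arrow proj s \<and> ord s = f \<and> iso_arrow E (rho s)"
proof -
  define y where "y = (ob x, n, \<lambda>a\<in>FO U (ob x). dat f (lab x a))"
  have xE: "ob x \<in> Ob E" using x by (simp add: K_Ob)
  have "y \<in> Ob K"
    using xE Simplex_app[OF f] lab_in[OF x(1)] x(2) unfolding K_Ob y_def
    by (simp add: restrict_PiE_iff)
  then have s: "Arrow x (Idn E (ob x), f) y \<in> hom K x y"
    using x f xE E.Idn_in[OF xE] und_Idn[OF xE] by (simp add: K_hom y_def)
  then show ?thesis
    using proj_cocartesianI[OF s] E.iso_Idn[OF xE] by (intro exI[of _ y] bexI[OF _ s]) simp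
qed

lemma cocartesian_fibration_proj: "cocartesian_fibration proj"
  unfolding cocartesian_fibration_def
proof (intro conjI ballI impI)
  fix f x assume f: "f \<in> Ar (Tgt proj)" and x: "x \<in> Ob (Src proj)" "FO proj x = Dom (Tgt proj) f"
  obtain y s where "s \<in> hom K x y" "cocartesian_arrow proj s" "ord s = f"
    using cocartesian_lift_ex[OF Ar_hom, of f x] f x by auto
  then show "\<exists>e. cocartesian_arrow proj e \<and> Dom (Src proj) e = x \<and> FA proj e = f"
    using hom_Dom by fastforce
qed (rule is_functor_proj)

text \<open>The source is cut down to the elements whose label lies in the image of
  \<open>f\<close>, relabelled by the inverse of \<open>f\<close>. The last clause records the image
  for transport to an arbitrary lift.\<close>

lemma cartesian_lift_ex:
  assumes f: "f \<in> hom Simplex m n" "inj_on (dat f) {1..m}" and y: "y \<in> Ob K" "deg y = n"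
  shows "\<exists>x. \<exists>s \<in> hom K x y. cartesian_arrow proj s \<and> ord s = f \<and>
    (\<forall>b \<in> FO U (ob y). lab y b \<in> dat f ` {1..m} \<longrightarrow> b \<in> und (rho s) ` FO U (ob x))"
proof -
  define A where "A = {b \<in> FO U (ob y). lab y b \<in> dat f ` {1..m}}"
  have yE: "ob y \<in> Ob E" using y by (simp add: K_Ob)
  obtain c e where e: "e \<in> hom E c (ob y)" "FO U c = A" "\<And>a. a \<in> A \<Longrightarrow> und e a = a"
    using E_restrict[OF yE, of A] by (auto simp: A_def)
  define x where "x = (c, m, \<lambda>a\<in>A. inv_into {1..m} (dat f) (lab y a))"
  have A: "inv_into {1..m} (dat f) (lab y a) \<in> {1..m}"
    "dat f (inv_into {1..m} (dat f) (lab y a)) = lab y a" if "a \<in> A" for a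
  proof -
    have "lab y a \<in> dat f ` {1..m}" using that by (simp add: A_def)
    then show "inv_into {1..m} (dat f) (lab y a) \<in> {1..m}"
      "dat f (inv_into {1..m} (dat f) (lab y a)) = lab y a"
      by (rule inv_into_into, rule f_inv_into_f)
  qed
  have xK: "x \<in> Ob K"
    unfolding K_Ob x_def using E.hom_Ob1[OF e(1)] e(2) A(1) by (simp add: restrict_PiE_iff)
  then have s: "Arrow x (e, f) y \<in> hom K x y"
    using e f y A by (simp add: K_hom x_def)
  have image: "b \<in> und e ` FO U c" if "b \<in> FO U (ob y)" "lab y b \<in> dat f ` {1..m}" for b
    using that e(3)[of b] unfolding e(2) by (force simp: A_def)
  have "cartesian_arrow proj (Arrow x (e, f) y)"
    by (rule proj_cartesianI[OF s]) (use f image in \<open>auto simp: x_def\<close>)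
  then show ?thesis
    using s image by (intro exI[of _ x] bexI[OF _ s]) (auto simp: x_def)
qed

lemma cartesian_over_proj: "cartesian_over proj convex_maps"
  unfolding cartesian_over_def
proof (intro ballI impI)
  fix f y assume f: "f \<in> convex_maps" and y: "y \<in> Ob (Src proj)" "FO proj y = Cod (Tgt proj) f"
  have "f \<in> hom Simplex (src f) (tgt f)"
    using f by (auto simp: convex_maps_def hom_def Simplex_def)
  moreover have "deg y = tgt f" using y by (simp add: Simplex_def)
  ultimately obtain x s where "s \<in> hom K x y" "cartesian_arrow proj s" "ord s = f"
    using cartesian_lift_ex convex_maps_inj[OF f] y(1) by (metis proj_simps(1))
  then show "\<exists>e. cartesian_arrow proj e \<and> Cod (Src proj) e = y \<and> FA proj e = f"
    using hom_Cod by fastforce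
qed

sublocale lifts proj convex_maps
  rewrites "Src proj = K" and "Tgt proj = Simplex"
    and "FO proj = (\<lambda>x. deg x)" and "FA proj = (\<lambda>s. ord s)"
  using cocartesian_fibration_proj cartesian_over_proj by unfold_locales auto

section \<open>Concrete features of arbitrary cocartesian and cartesian lifts\<close>

lemma iso_K_rho:
  assumes s: "s \<in> hom K x y" and iso: "iso_arrow K s"
  shows "iso_arrow E (rho s)"
proof -
  obtain t where t: "t \<in> hom K y x" "t \<odot>\<^bsub>K\<^esub> s = Idn K x" "s \<odot>\<^bsub>K\<^esub> t = Idn K y"
    using iso_arrow_inverse[OF iso s] by blast
  have "rho t \<odot>\<^bsub>E\<^esub> rho s = Idn E (ob x)" "rho s \<odot>\<^bsub>E\<^esub> rho t = Idn E (ob y)"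
    unfolding K_Cmp(3)[symmetric] t(2,3) by (simp_all add: K_Idn)
  then show ?thesis
    using iso_arrow_iff[OF K_homD(1)[OF s]] K_homD(1)[OF t(1)] by blast
qed

text \<open>The given arrow is an explicit lift with invertible \<open>rho\<close> followed by a
  vertical isomorphism. This reverses \<open>proj_cocartesianI\<close> for the unspecified lifts
  behind \<open>push\<close>.\<close>

lemma cocartesian_rho_iso:
  assumes s: "s \<in> hom K x y" "cocartesian_arrow proj s"
  shows "iso_arrow E (rho s)"
proof -
  note s' = K_homD[OF s(1)]
  obtain z t where t: "t \<in> hom K x z" "cocartesian_arrow proj t" "ord t = ord s" "iso_arrow E (rho t)"
    using cocartesian_lift_ex[OF s'(2,4)] by auto
  obtain h where h: "h \<in> hom (fibre proj (deg y)) z y" "h \<odot>\<^bsub>K\<^esub> t = s" "iso_arrow K h"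
    using proj.cocartesian_unique[OF t(2,1) s(2,1) t(3) refl s'(2)] by blast
  then have hK: "h \<in> hom K z y" by (simp add: fibre_hom)
  show ?thesis
    using E.iso_Cmp[OF K_homD(1)[OF t(1)] t(4) K_homD(1)[OF hK] iso_K_rho[OF hK h(3)]] h(2) K_Cmp(3)
    by metis
qed

text \<open>The explicit lift over the same map hits \<open>b\<close> and factors through
  \<open>s\<close>, so \<open>s\<close> hits \<open>b\<close> as well. Convexity supplies the
  injectivity that the explicit lift requires.\<close>

lemma cartesian_image:
  assumes s: "s \<in> hom K x y" "cartesian_arrow proj s" "ord s \<in> convex_maps"
    and b: "b \<in> FO U (ob y)" "lab y b \<in> dat (ord s) ` {1..deg x}"
  shows "b \<in> und (rho s) ` FO U (ob x)"
proof -
  note s' = K_homD[OF s(1)]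
  have "src (ord s) = deg x" using s'(2) by (simp add: Simplex_hom)
  then have inj: "inj_on (dat (ord s)) {1..deg x}"
    using convex_maps_inj[OF s(3)] by simp
  obtain z t where t: "t \<in> hom K z y" "cartesian_arrow proj t" "ord t = ord s"
    "b \<in> und (rho t) ` FO U (ob z)"
    using cartesian_lift_ex[OF s'(2) inj s'(5)] b by auto
  obtain h where h: "h \<in> hom (fibre proj (deg x)) z x" "s \<odot>\<^bsub>K\<^esub> h = t"
    using proj.cartesian_unique[OF s(2,1) t(2,1) refl t(3) s'(2)] by blast
  then have hK: "h \<in> hom K z x" by (simp add: fibre_hom)
  obtain a where a: "a \<in> FO U (ob z)" "b = und (rho t) a"
    using t(4) by blast
  have "b = und (rho s) (und (rho h) a)"
    using und_Cmp[OF K_homD(1)[OF hK] s'(1) a(1)] a(2) h(2) K_Cmp(3) by metis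
  then show ?thesis
    using und_in[OF K_homD(1)[OF hK] a(1)] by blast
qed

text \<open>Both \<open>s\<close> and the identity of \<open>x\<close> are cocartesian over an
  identity, so uniqueness of lifts yields the inverse without constructing it.\<close>

lemma fibre_iso_if_rho_iso:
  assumes s: "s \<in> hom (fibre proj n) x y" and iso: "iso_arrow E (rho s)"
  shows "iso_arrow K s"
proof -
  have sK: "s \<in> hom K x y" "ord s = Idn Simplex n"
    using s by (auto simp: fibre_hom)
  have n: "deg x = n"
    using proj.FO_fibre[OF s] by simp
  note x = K_homD(4)[OF sK(1)]
  have "iso_arrow E (rho (Idn K x))"
    using x E.iso_Idn by (simp add: K_Idn K_Ob)
  then obtain h where h: "h \<in> hom (fibre proj n) x y" "h \<odot>\<^bsub>K\<^esub> Idn K x = s" "iso_arrow K h"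
    using proj.cocartesian_unique[OF proj_cocartesianI[OF K.Idn_in[OF x]] K.Idn_in[OF x]
        proj_cocartesianI[OF sK(1) iso] sK(1) _ sK(2) Simplex.Idn_in[OF Simplex_Ob]] n
    by (auto simp: K_Idn)
  moreover have "h \<odot>\<^bsub>K\<^esub> Idn K x = h"
    using K.Idn_right[of h x y] h(1) by (simp add: fibre_hom)
  ultimately show ?thesis by simp
qed

end

section \<open>The Grothendieck construction\<close>

context grpd_pseudofunctor
begin

sublocale B: category B
  by (rule base)

abbreviation (input) "G \<equiv> grothendieck B R"

lemma category_Val: "A \<in> Ob B \<Longrightarrow> category (Val R A)"
  using groupoid_val by (simp add: groupoid_def)

lemma Val_iso: "A \<in> Ob B \<Longrightarrow> \<phi> \<in> hom (Val R A) X Y \<Longrightarrow> iso_arrow (Val R A) \<phi>"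
  using groupoid_val hom_Ar unfolding groupoid_def by metis

lemma Res_Ob: "f \<in> hom B A' A \<Longrightarrow> X \<in> Ob (Val R A) \<Longrightarrow> FO (Res R f) X \<in> Ob (Val R A')"
  using restr[of f A' A] is_functor_Ob[of "Res R f" X] by simp

lemma Res_hom: "f \<in> hom B A' A \<Longrightarrow> \<phi> \<in> hom (Val R A) X Y \<Longrightarrow>
    FA (Res R f) \<phi> \<in> hom (Val R A') (FO (Res R f) X) (FO (Res R f) Y)"
  using restr[of f A' A] is_functor_hom[of "Res R f" \<phi> X Y] by simp

lemma Res_Cmp: "f \<in> hom B A' A \<Longrightarrow> \<phi> \<in> hom (Val R A) X Y \<Longrightarrow> \<psi> \<in> hom (Val R A) Y Z \<Longrightarrow>
    FA (Res R f) (\<psi> \<odot>\<^bsub>Val R A\<^esub> \<phi>) = FA (Res R f) \<psi> \<odot>\<^bsub>Val R A'\<^esub> FA (Res R f) \<phi>"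
  using restr[of f A' A] is_functor_Cmp[of "Res R f" \<phi> X Y \<psi> Z] by simp

lemma Unt_hom:
  assumes "A \<in> Ob B" "X \<in> Ob (Val R A)"
  shows "Unt R A X \<in> hom (Val R A) X (FO (Res R (Idn B A)) X)"
  using nat_iso_hom[OF unit[OF assms(1)]] assms(2) by simp

lemma Unt_natural:
  assumes "A \<in> Ob B" "\<phi> \<in> hom (Val R A) X Y"
  shows "FA (Res R (Idn B A)) \<phi> \<odot>\<^bsub>Val R A\<^esub> Unt R A X = Unt R A Y \<odot>\<^bsub>Val R A\<^esub> \<phi>"
  using nat_iso_natural[OF unit[OF assms(1)]] assms(2) by simp

lemma Mul_hom:
  assumes f: "f \<in> hom B A'' A'" and g: "g \<in> hom B A' A" and X: "X \<in> Ob (Val R A)"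
  shows "Mul R g f X \<in> hom (Val R A'') (FO (Res R f) (FO (Res R g) X)) (FO (Res R (g \<odot>\<^bsub>B\<^esub> f)) X)"
  using nat_iso_hom[OF mult[OF f g]] restr[OF f] restr[OF g] X by simp

lemma Mul_natural:
  assumes f: "f \<in> hom B A'' A'" and g: "g \<in> hom B A' A" and \<phi>: "\<phi> \<in> hom (Val R A) X Y"
  shows "FA (Res R (g \<odot>\<^bsub>B\<^esub> f)) \<phi> \<odot>\<^bsub>Val R A''\<^esub> Mul R g f X
    = Mul R g f Y \<odot>\<^bsub>Val R A''\<^esub> FA (Res R f) (FA (Res R g) \<phi>)"
  using nat_iso_natural[OF mult[OF f g]] restr[OF f] restr[OF g] \<phi> by simp

lemma G_Ob: "x \<in> Ob G \<longleftrightarrow> fst x \<in> Ob B \<and> snd x \<in> Ob (Val R (fst x))"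
  by (cases x) (simp add: grothendieck_def Let_def)

lemma G_hom: "s \<in> hom G x y \<longleftrightarrow> src s = x \<and> tgt s = y \<and> x \<in> Ob G \<and> y \<in> Ob G \<and>
    fst (dat s) \<in> hom B (fst x) (fst y) \<and>
    snd (dat s) \<in> hom (Val R (fst x)) (snd x) (FO (Res R (fst (dat s))) (snd y))"
  unfolding hom_def[of "grothendieck B R"]
  by (cases s; cases x; cases y) (auto simp: grothendieck_def Let_def)

lemma G_homD:
  assumes "s \<in> hom G x y"
  shows "fst (dat s) \<in> hom B (fst x) (fst y)"
    "snd (dat s) \<in> hom (Val R (fst x)) (snd x) (FO (Res R (fst (dat s))) (snd y))"
    "x \<in> Ob G" "y \<in> Ob G" "fst x \<in> Ob B" "snd x \<in> Ob (Val R (fst x))"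
    "fst y \<in> Ob B" "snd y \<in> Ob (Val R (fst y))" "src s = x" "tgt s = y"
  using assms unfolding G_hom G_Ob by blast+

lemma G_eqI: "s \<in> hom G x y \<Longrightarrow> t \<in> hom G x y \<Longrightarrow> fst (dat s) = fst (dat t) \<Longrightarrow>
    snd (dat s) = snd (dat t) \<Longrightarrow> s = t"
  by (cases s; cases t) (auto simp: G_hom prod_eq_iff)

lemma G_Cmp: "src (t \<odot>\<^bsub>G\<^esub> s) = src s" "tgt (t \<odot>\<^bsub>G\<^esub> s) = tgt t"
  "fst (dat (t \<odot>\<^bsub>G\<^esub> s)) = fst (dat t) \<odot>\<^bsub>B\<^esub> fst (dat s)"
  "snd (dat (t \<odot>\<^bsub>G\<^esub> s)) = Mul R (fst (dat t)) (fst (dat s)) (snd (tgt t))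
     \<odot>\<^bsub>Val R (fst (src s))\<^esub> FA (Res R (fst (dat s))) (snd (dat t)) \<odot>\<^bsub>Val R (fst (src s))\<^esub> snd (dat s)"
  by (auto simp: grothendieck_def Let_def split: arrow.split prod.split)

lemma G_Idn: "Idn G x = Arrow x (Idn B (fst x), Unt R (fst x) (snd x)) x"
  by (cases x) (simp add: grothendieck_def Let_def)

text \<open>The identity laws come from the unit coherences, the right one also using naturality of
  \<open>Unt\<close>. Associativity combines naturality of \<open>Mul\<close>, its coherence and
  functoriality of restriction; the rest is rebracketing.\<close>

lemma category_grothendieck: "category G"
proof
  show Cmp: "t \<odot>\<^bsub>G\<^esub> s \<in> hom G x z" if s: "s \<in> hom G x y" and t: "t \<in> hom G y z" for s t x y z
  proof -
    note s' = G_homD[OF s] and t' = G_homD[OF t]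
    interpret V: category "Val R (fst x)" by (rule category_Val[OF s'(5)])
    have "snd (dat (t \<odot>\<^bsub>G\<^esub> s)) \<in> hom (Val R (fst x)) (snd x) (FO (Res R (fst (dat (t \<odot>\<^bsub>G\<^esub> s)))) (snd z))"
      unfolding G_Cmp s'(9) t'(10)
      by (rule V.Cmp_in[OF V.Cmp_in[OF s'(2) Res_hom[OF s'(1) t'(2)]] Mul_hom[OF s'(1) t'(1,8)]])
    moreover have "fst (dat (t \<odot>\<^bsub>G\<^esub> s)) \<in> hom B (fst x) (fst z)"
      unfolding G_Cmp by (rule B.Cmp_in[OF s'(1) t'(1)])
    ultimately show ?thesis
      unfolding G_hom[of "t \<odot>\<^bsub>G\<^esub> s"] using s' t' by (simp only: G_Cmp(1,2) simp_thms)
  qed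
  show Idn: "Idn G x \<in> hom G x x" if "x \<in> Ob G" for x
    using that Unt_hom B.Idn_in unfolding G_hom G_Idn by (simp add: G_Ob)
  show "Dom G s \<in> Ob G" "Cod G s \<in> Ob G" if "s \<in> Ar G" for s
    using G_homD(3,4)[OF Ar_hom[OF that]] by auto
  show "Idn G y \<odot>\<^bsub>G\<^esub> s = s" if s: "s \<in> hom G x y" for s x y
  proof (rule G_eqI[OF Cmp[OF s Idn[OF G_homD(4)[OF s]]] s])
    note s' = G_homD[OF s]
    interpret V: category "Val R (fst x)" by (rule category_Val[OF s'(5)])
    show "fst (dat (Idn G y \<odot>\<^bsub>G\<^esub> s)) = fst (dat s)"
      by (simp add: G_Cmp G_Idn B.Idn_left[OF s'(1)])
    \<comment> \<open>\<open>Mul_hom\<close> gives a target restricted along the composite with an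
      identity; it is rewritten so that this arrow ends at the target of
      \<open>snd (dat s)\<close>.\<close>
    have "Mul R (Idn B (fst y)) (fst (dat s)) (snd y)
        \<in> hom (Val R (fst x)) (FO (Res R (fst (dat s))) (FO (Res R (Idn B (fst y))) (snd y)))
            (FO (Res R (fst (dat s))) (snd y))"
      using Mul_hom[OF s'(1) B.Idn_in[OF s'(7)] s'(8)] B.Idn_left[OF s'(1)] by simp
    then show "snd (dat (Idn G y \<odot>\<^bsub>G\<^esub> s)) = snd (dat s)"
      using V.assoc[OF s'(2) Res_hom[OF s'(1) Unt_hom[OF s'(7,8)]]] unit_left[OF s'(1,8)]
        V.Idn_left[OF s'(2)] by (simp add: G_Cmp G_Idn s'(9))
  qed
  show "s \<odot>\<^bsub>G\<^esub> Idn G x = s" if s: "s \<in> hom G x y" for s x y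
  proof (rule G_eqI[OF Cmp[OF Idn[OF G_homD(3)[OF s]] s] s])
    note s' = G_homD[OF s]
    interpret V: category "Val R (fst x)" by (rule category_Val[OF s'(5)])
    show "fst (dat (s \<odot>\<^bsub>G\<^esub> Idn G x)) = fst (dat s)"
      by (simp add: G_Cmp G_Idn B.Idn_right[OF s'(1)])
    have "Mul R (fst (dat s)) (Idn B (fst x)) (snd y)
        \<in> hom (Val R (fst x)) (FO (Res R (Idn B (fst x))) (FO (Res R (fst (dat s))) (snd y)))
            (FO (Res R (fst (dat s))) (snd y))"
      using Mul_hom[OF B.Idn_in[OF s'(5)] s'(1,8)] B.Idn_right[OF s'(1)] by simp
    then show "snd (dat (s \<odot>\<^bsub>G\<^esub> Idn G x)) = snd (dat s)"
      using V.assoc[OF s'(2) Unt_hom[OF s'(5) Res_Ob[OF s'(1,8)]]] unit_right[OF s'(1,8)]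
        Unt_natural[OF s'(5,2)] V.Idn_left[OF s'(2)] by (simp add: G_Cmp G_Idn s'(10))
  qed
  show "u \<odot>\<^bsub>G\<^esub> (t \<odot>\<^bsub>G\<^esub> s) = (u \<odot>\<^bsub>G\<^esub> t) \<odot>\<^bsub>G\<^esub> s"
    if s: "s \<in> hom G w x" and t: "t \<in> hom G x y" and u: "u \<in> hom G y z" for s t u w x y z
  proof (rule G_eqI[OF Cmp[OF Cmp[OF s t] u] Cmp[OF s Cmp[OF t u]]])
    note s' = G_homD[OF s] and t' = G_homD[OF t] and u' = G_homD[OF u]
    interpret V: category "Val R (fst w)" by (rule category_Val[OF s'(5)])
    interpret V': category "Val R (fst x)" by (rule category_Val[OF t'(5)])
    define f g h \<phi> \<psi> \<chi> where defs: "f = fst (dat s)" "g = fst (dat t)" "h = fst (dat u)"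
      "\<phi> = snd (dat s)" "\<psi> = snd (dat t)" "\<chi> = snd (dat u)"
    note s' = s'[folded defs] and t' = t'[folded defs] and u' = u'[folded defs]
    let ?V = "Val R (fst w)"
    let ?Z = "snd z" and ?Y = "snd y"
    have hZ: "FO (Res R h) ?Z \<in> Ob (Val R (fst y))"
      by (rule Res_Ob[OF u'(1,8)])
    define p1 p2 m1 m1' r m2 n1 n2 where d: "p1 = FA (Res R f) \<psi>" "p2 = FA (Res R f) (FA (Res R g) \<chi>)"
      "m1 = Mul R g f (FO (Res R h) ?Z)" "m1' = Mul R g f ?Y" "r = FA (Res R (g \<odot>\<^bsub>B\<^esub> f)) \<chi>"
      "m2 = Mul R h (g \<odot>\<^bsub>B\<^esub> f) ?Z" "n1 = FA (Res R f) (Mul R h g ?Z)" "n2 = Mul R (h \<odot>\<^bsub>B\<^esub> g) f ?Z"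
    note homs = s'(2) Res_hom[OF s'(1) t'(2), folded d] Res_hom[OF s'(1) Res_hom[OF t'(1) u'(2)], folded d]
      Mul_hom[OF s'(1) t'(1) hZ, folded d] Mul_hom[OF s'(1) t'(1) t'(8), folded d]
      Res_hom[OF B.Cmp_in[OF s'(1) t'(1)] u'(2), folded d]
      Mul_hom[OF B.Cmp_in[OF s'(1) t'(1)] u'(1,8), folded d]
      Res_hom[OF s'(1) Mul_hom[OF t'(1) u'(1,8)], folded d]
      Mul_hom[OF s'(1) B.Cmp_in[OF t'(1) u'(1)] u'(8), folded d]
    \<comment> \<open>Naturality moves \<chi> past the multiplication for \<open>g\<close> and
      \<open>f\<close>; \<open>ass\<close> then exchanges the two ways of merging three
      restrictions.\<close>
    have nat: "r \<odot>\<^bsub>?V\<^esub> m1' = m1 \<odot>\<^bsub>?V\<^esub> p2"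
      using Mul_natural[OF s'(1) t'(1) u'(2), folded d] .
    have ass: "m2 \<odot>\<^bsub>?V\<^esub> m1 = n2 \<odot>\<^bsub>?V\<^esub> n1"
      using mult_assoc[OF s'(1) t'(1) u'(1,8), folded d] .
    have B_assoc: "(h \<odot>\<^bsub>B\<^esub> g) \<odot>\<^bsub>B\<^esub> f = h \<odot>\<^bsub>B\<^esub> (g \<odot>\<^bsub>B\<^esub> f)"
      using B.assoc[OF s'(1) t'(1) u'(1)] by simp
    \<comment> \<open>\<open>m2\<close> and \<open>n2\<close> end at restrictions along differently
      bracketed composites; rewriting makes the two targets literally equal.\<close>
    note homs = homs[unfolded B_assoc]
    have fst: "fst (dat (t \<odot>\<^bsub>G\<^esub> s)) = g \<odot>\<^bsub>B\<^esub> f" "fst (dat (u \<odot>\<^bsub>G\<^esub> t)) = h \<odot>\<^bsub>B\<^esub> g"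
      by (simp_all add: G_Cmp defs)
    show "fst (dat (u \<odot>\<^bsub>G\<^esub> (t \<odot>\<^bsub>G\<^esub> s))) = fst (dat ((u \<odot>\<^bsub>G\<^esub> t) \<odot>\<^bsub>G\<^esub> s))"
      using B_assoc by (simp add: G_Cmp defs)
    have "snd (dat (u \<odot>\<^bsub>G\<^esub> (t \<odot>\<^bsub>G\<^esub> s))) = m2 \<odot>\<^bsub>?V\<^esub> (r \<odot>\<^bsub>?V\<^esub> (m1' \<odot>\<^bsub>?V\<^esub> (p1 \<odot>\<^bsub>?V\<^esub> \<phi>)))"
      unfolding G_Cmp s'(9) t'(10) u'(10) fst by (simp only: d defs)
    also have "\<dots> = (m2 \<odot>\<^bsub>?V\<^esub> m1) \<odot>\<^bsub>?V\<^esub> (p2 \<odot>\<^bsub>?V\<^esub> (p1 \<odot>\<^bsub>?V\<^esub> \<phi>))"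
      using V.assoc[OF V.Cmp_in[OF homs(1,2)] homs(5,6)] nat
        V.assoc[OF V.Cmp_in[OF homs(1,2)] homs(3,4)]
        V.assoc[OF V.Cmp_in[OF V.Cmp_in[OF homs(1,2)] homs(3)] homs(4,7)] by metis
    also have "\<dots> = n2 \<odot>\<^bsub>?V\<^esub> (n1 \<odot>\<^bsub>?V\<^esub> (p2 \<odot>\<^bsub>?V\<^esub> (p1 \<odot>\<^bsub>?V\<^esub> \<phi>)))"
      unfolding ass by (rule V.assoc[OF V.Cmp_in[OF V.Cmp_in[OF homs(1,2)] homs(3)] homs(8,9), symmetric])
    also have "\<dots> = n2 \<odot>\<^bsub>?V\<^esub> ((n1 \<odot>\<^bsub>?V\<^esub> (p2 \<odot>\<^bsub>?V\<^esub> p1)) \<odot>\<^bsub>?V\<^esub> \<phi>)"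
      unfolding V.assoc[OF homs(1-3)] V.assoc[OF homs(1) V.Cmp_in[OF homs(2,3)] homs(8)] ..
    also have "n1 \<odot>\<^bsub>?V\<^esub> (p2 \<odot>\<^bsub>?V\<^esub> p1) = FA (Res R f) (snd (dat (u \<odot>\<^bsub>G\<^esub> t)))"
      unfolding G_Cmp t'(9) u'(10) defs[symmetric] d
      by (simp only: Res_Cmp[OF s'(1) t'(2) Res_hom[OF t'(1) u'(2)]]
          Res_Cmp[OF s'(1) V'.Cmp_in[OF t'(2) Res_hom[OF t'(1) u'(2)]] Mul_hom[OF t'(1) u'(1,8)]])
    also have "n2 \<odot>\<^bsub>?V\<^esub> (FA (Res R f) (snd (dat (u \<odot>\<^bsub>G\<^esub> t))) \<odot>\<^bsub>?V\<^esub> \<phi>) = snd (dat ((u \<odot>\<^bsub>G\<^esub> t) \<odot>\<^bsub>G\<^esub> s))"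
      unfolding G_Cmp(2) G_Cmp(4)[of "u \<odot>\<^bsub>G\<^esub> t" s] s'(9) u'(10) fst by (simp only: d defs)
    finally show "snd (dat (u \<odot>\<^bsub>G\<^esub> (t \<odot>\<^bsub>G\<^esub> s))) = snd (dat ((u \<odot>\<^bsub>G\<^esub> t) \<odot>\<^bsub>G\<^esub> s))" .
  qed
qed

section \<open>The Grothendieck projection as a right fibration\<close>

abbreviation (input) "Gproj \<equiv> grothendieck_proj B R"

lemma Gproj_simps: "Src Gproj = G" "Tgt Gproj = B" "FO Gproj x = fst x" "FA Gproj s = fst (dat s)"
  by (simp_all add: grothendieck_proj_def)

lemma is_functor_Gproj: "is_functor Gproj"
  by (rule is_functorI)
    (auto simp: Gproj_simps category_grothendieck base G_Ob G_Idn G_Cmp G_homD(1))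

text \<open>The source of the lift is the restriction of \<open>c\<close> along \<open>f\<close>
  itself, with an identity as second component.\<close>

lemma Gproj_lift:
  assumes f: "f \<in> Ar B" and c: "c \<in> Ob G" "fst c = Cod B f"
  shows "\<exists>e \<in> Ar G. Cod G e = c \<and> fst (dat e) = f"
proof -
  have fh: "f \<in> hom B (Dom B f) (fst c)"
    using f c by (simp add: hom_def)
  have X: "FO (Res R f) (snd c) \<in> Ob (Val R (Dom B f))"
    using Res_Ob[OF fh] c by (simp add: G_Ob)
  interpret V: category "Val R (Dom B f)"
    by (rule category_Val[OF B.hom_Ob1[OF fh]])
  let ?x = "(Dom B f, FO (Res R f) (snd c))"
  have "Arrow ?x (f, Idn (Val R (Dom B f)) (FO (Res R f) (snd c))) c \<in> hom G ?x c"
    using fh c X V.Idn_in[OF X] B.hom_Ob1[OF fh] by (simp add: G_hom G_Ob)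
  then show ?thesis
    using hom_Ar hom_Cod by fastforce
qed

text \<open>The second component of a factorization solves an equation whose coefficients, a
  multiplication and a restricted arrow, are invertible because the values are groupoids. Hence
  there is exactly one solution.\<close>

lemma Gproj_cartesian:
  assumes "e \<in> Ar G"
  shows "cartesian_arrow Gproj e"
  unfolding cartesian_arrow_def Gproj_simps
proof (intro conjI ballI impI)
  show "e \<in> Ar G" by fact
  fix g v
  assume g0: "g \<in> Ar G" and v: "v \<in> hom B (fst (Dom G g)) (fst (Dom G e))"
    and "Cod G g = Cod G e" and eq: "fst (dat e) \<odot>\<^bsub>B\<^esub> v = fst (dat g)"
  define x y z where defs: "x = Dom G g" "y = Dom G e" "z = Cod G e"
  have e: "e \<in> hom G y z" and g: "g \<in> hom G x z"
    using Ar_hom[OF assms] Ar_hom[OF g0] \<open>Cod G g = Cod G e\<close> by (simp_all add: defs)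
  note v = v[folded defs]
  note e' = G_homD[OF e] and g' = G_homD[OF g]
  interpret V: category "Val R (fst x)" by (rule category_Val[OF g'(5)])
  let ?m = "Mul R (fst (dat e)) v (snd z)" and ?r = "FA (Res R v) (snd (dat e))"
  note m = Mul_hom[OF v e'(1,8), unfolded eq] and r = Res_hom[OF v e'(2)]
  obtain \<psi>' where \<psi>': "\<psi>' \<in> hom (Val R (fst x)) (snd x) (FO (Res R v) (FO (Res R (fst (dat e))) (snd z)))"
    "?m \<odot>\<^bsub>Val R (fst x)\<^esub> \<psi>' = snd (dat g)"
    using V.iso_factor_left[OF Val_iso[OF g'(5) m] m g'(2)] by blast
  obtain \<psi> where \<psi>: "\<psi> \<in> hom (Val R (fst x)) (snd x) (FO (Res R v) (snd y))"
    "?r \<odot>\<^bsub>Val R (fst x)\<^esub> \<psi> = \<psi>'"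
    using V.iso_factor_left[OF Val_iso[OF g'(5) r] r \<psi>'(1)] by blast
  interpret G: category G by (rule category_grothendieck)
  have h: "Arrow x (v, \<psi>) y \<in> hom G x y"
    using v \<psi>(1) e' g' by (simp add: G_hom)
  moreover have "e \<odot>\<^bsub>G\<^esub> Arrow x (v, \<psi>) y = g"
    by (rule G_eqI[OF G.Cmp_in[OF h e] g]) (simp_all add: G_Cmp eq e'(10) \<psi>(2) \<psi>'(2))
  moreover have "k = Arrow x (v, \<psi>) y"
    if k: "k \<in> hom G x y" "fst (dat k) = v" "e \<odot>\<^bsub>G\<^esub> k = g" for k
  proof (rule G_eqI[OF k(1) h])
    note k' = G_homD[OF k(1), unfolded k(2)]
    have "snd (dat g) = ?m \<odot>\<^bsub>Val R (fst x)\<^esub> ?r \<odot>\<^bsub>Val R (fst x)\<^esub> snd (dat k)"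
      using G_Cmp(4)[of e k] unfolding k(2,3) k'(9) e'(10) .
    then have "?r \<odot>\<^bsub>Val R (fst x)\<^esub> snd (dat k) = \<psi>'"
      using V.iso_cancel_left[OF Val_iso[OF g'(5) m] m V.Cmp_in[OF k'(2) r] \<psi>'(1)] \<psi>'(2) by metis
    then show "snd (dat k) = snd (dat (Arrow x (v, \<psi>) y))"
      using V.iso_cancel_left[OF Val_iso[OF g'(5) r] r k'(2) \<psi>(1)] \<psi>(2) by simp
  qed (simp add: k)
  ultimately have "\<exists>!h. h \<in> hom G x y \<and> fst (dat h) = v \<and> e \<odot>\<^bsub>G\<^esub> h = g"
    by (metis arrow.sel(2) fst_conv)
  then show "\<exists>!h. h \<in> hom G (Dom G g) (Dom G e) \<and> fst (dat h) = v \<and> e \<odot>\<^bsub>G\<^esub> h = g"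
    unfolding defs .
qed

end

lemma right_fibration_grothendieck_proj:
  assumes "grpd_pseudofunctor FinInj R"
  shows "right_fibration (grothendieck_proj FinInj R)"
proof -
  interpret grpd_pseudofunctor FinInj R by fact
  show ?thesis
    by unfold_locales
      (auto simp: is_functor_Gproj Gproj_simps Gproj_cartesian intro: Gproj_lift)
qed

section \<open>Squares in the simplex category\<close>

text \<open>The image of a translation of an interval is again an interval, so it contains
  everything between two of its members.\<close>

lemma convex_maps_interval:
  assumes j: "j \<in> convex_maps" and xy: "x \<in> {1..src j}" "y \<in> {1..src j}"
    and z: "dat j x \<le> z" "z \<le> dat j y"
  shows "z \<in> dat j ` {1..src j}"
proof -
  obtain x' y' where [simp]: "x = Suc x'" "y = Suc y'"
    using xy by (metis atLeastAtMost_iff not0_implies_Suc not_one_le_zero)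
  \<comment> \<open>The preimage is found from the offset to the first value; the second bound makes
    the subtraction of natural numbers exact.\<close>
  have "Suc (z - dat j (Suc 0)) \<le> src j" "dat j (Suc 0) \<le> z"
    using convex_maps_apply[OF j, of x'] convex_maps_apply[OF j, of y'] xy z by auto
  then have "z = dat j (Suc (z - dat j (Suc 0)))"
    using convex_maps_apply[OF j, of "z - dat j (Suc 0)"] by simp
  then show ?thesis
    using \<open>Suc (z - dat j (Suc 0)) \<le> src j\<close> by (intro image_eqI) auto
qed

text \<open>Elements become maps out of the one-element ordinal, so that a universal property can be
  evaluated on elements.\<close>

definition point :: "nat \<Rightarrow> nat \<Rightarrow> (nat, nat \<Rightarrow> nat) arrow" where
  "point n x = Arrow 1 (\<lambda>_\<in>{1..1}. x) n"

lemma point_hom: "x \<in> {1..n} \<Longrightarrow> point n x \<in> hom Simplex 1 n"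
  by (auto simp: point_def Simplex_hom mono_on_def)

lemma dat_point: "dat (point n x) 1 = x"
  by (simp add: point_def)

lemma Simplex_eq_pointI:
  assumes "f \<in> hom Simplex 1 n" "g \<in> hom Simplex 1 n" "dat f 1 = dat g 1"
  shows "f = g"
  using assms by (intro Simplex_eqI[OF assms(1,2)]) simp

text \<open>Testing the universal property against the one-element ordinal shows that a pullback in
  \<open>Simplex\<close> has the fibre product as underlying set.\<close>

lemma pullback_point:
  assumes pb: "is_pullback Simplex \<tau>' \<sigma>' \<tau> \<sigma>"
    and \<tau>': "\<tau>' \<in> hom Simplex a b" and \<sigma>': "\<sigma>' \<in> hom Simplex a c"
    and \<tau>: "\<tau> \<in> hom Simplex c d" and \<sigma>: "\<sigma> \<in> hom Simplex b d"
    and y: "y \<in> {1..c}" and z: "z \<in> {1..b}" and eq: "dat \<tau> y = dat \<sigma> z"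
  shows "\<exists>!w. w \<in> {1..a} \<and> dat \<sigma>' w = y \<and> dat \<tau>' w = z"
proof -
  have one: "(1::nat) \<in> {1..1}" by simp
  note py = point_hom[OF y] and pz = point_hom[OF z]
  have apply_pt: "(f \<odot>\<^bsub>Simplex\<^esub> h = point n x) = (dat f (dat h 1) = x)"
    if "h \<in> hom Simplex 1 m" "f \<in> hom Simplex m n" "x \<in> {1..n}" for f h m n x
    using Simplex_eq_pointI[OF Simplex.Cmp_in[OF that(1,2)] point_hom[OF that(3)]]
      Simplex_Cmp_apply[OF that(1) one] dat_point by metis
  have "\<tau> \<odot>\<^bsub>Simplex\<^esub> point c y = \<sigma> \<odot>\<^bsub>Simplex\<^esub> point b z"
    using Simplex_Cmp_apply[OF py one] Simplex_Cmp_apply[OF pz one] eq dat_point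
    by (intro Simplex_eq_pointI[OF Simplex.Cmp_in[OF py \<tau>] Simplex.Cmp_in[OF pz \<sigma>]]) metis
  then have "\<exists>!h. h \<in> hom Simplex 1 a \<and> \<sigma>' \<odot>\<^bsub>Simplex\<^esub> h = point c y \<and> \<tau>' \<odot>\<^bsub>Simplex\<^esub> h = point b z"
    using pb py pz unfolding is_pullback_def hom_Dom[OF \<tau>'] hom_Dom[OF \<tau>] hom_Dom[OF \<sigma>]
    using Simplex_Ob by blast
  then obtain h where h: "h \<in> hom Simplex 1 a" "\<sigma>' \<odot>\<^bsub>Simplex\<^esub> h = point c y" "\<tau>' \<odot>\<^bsub>Simplex\<^esub> h = point b z"
    and unique: "\<And>k. k \<in> hom Simplex 1 a \<Longrightarrow> \<sigma>' \<odot>\<^bsub>Simplex\<^esub> k = point c y \<Longrightarrow>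
      \<tau>' \<odot>\<^bsub>Simplex\<^esub> k = point b z \<Longrightarrow> k = h"
    by blast
  show ?thesis
  proof (rule ex1I)
    show "dat h 1 \<in> {1..a} \<and> dat \<sigma>' (dat h 1) = y \<and> dat \<tau>' (dat h 1) = z"
      using Simplex_app[OF h(1) one] apply_pt[OF h(1) \<sigma>' y] apply_pt[OF h(1) \<tau>' z] h(2,3) by blast
  next
    fix w assume w: "w \<in> {1..a} \<and> dat \<sigma>' w = y \<and> dat \<tau>' w = z"
    then have pw: "point a w \<in> hom Simplex 1 a"
      by (intro point_hom) simp
    have "point a w = h"
      using apply_pt[OF pw \<sigma>' y] apply_pt[OF pw \<tau>' z] w dat_point by (intro unique[OF pw]) metis+
    then show "w = dat h 1"
      using dat_point by metis
  qed
qed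

text \<open>Needed because cartesian lifts are provided along convex maps. Uniqueness of points of
  the pullback makes \<tau>' injective, and a gap in its values is excluded because the image of
  \<tau> is an interval.\<close>

lemma pullback_convex:
  assumes pb: "is_pullback Simplex \<tau>' \<sigma>' \<tau> \<sigma>"
    and \<tau>': "\<tau>' \<in> hom Simplex a b" and \<sigma>': "\<sigma>' \<in> hom Simplex a c"
    and \<tau>: "\<tau> \<in> hom Simplex c d" "\<tau> \<in> convex_maps" and \<sigma>: "\<sigma> \<in> hom Simplex b d"
  shows "\<tau>' \<in> convex_maps"
proof -
  have src: "src \<tau>' = a" "src \<tau> = c"
    using \<tau>' \<tau>(1) by (auto simp: Simplex_hom)
  note point = pullback_point[OF pb \<tau>' \<sigma>' \<tau>(1) \<sigma>]
  have square: "dat \<tau> (dat \<sigma>' w) = dat \<sigma> (dat \<tau>' w)" if "w \<in> {1..a}" for w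
    using Simplex_Cmp_apply[OF \<sigma>' that] Simplex_Cmp_apply[OF \<tau>' that] pb unfolding is_pullback_def by metis
  have inj: "v = w" if vw: "v \<in> {1..a}" "w \<in> {1..a}" "dat \<tau>' v = dat \<tau>' w" for v w
  proof -
    have "dat \<sigma>' v = dat \<sigma>' w"
      using convex_maps_inj[OF \<tau>(2)] square[OF vw(1)] square[OF vw(2)] vw(3)
        Simplex_app[OF \<sigma>' vw(1)] Simplex_app[OF \<sigma>' vw(2)] unfolding src by (metis inj_onD)
    then show ?thesis
      using point[OF Simplex_app[OF \<sigma>' vw(1)] Simplex_app[OF \<tau>' vw(1)] square[OF vw(1)]] vw by metis
  qed
  have "dat \<tau>' (x + 1) = dat \<tau>' x + 1" if x: "1 \<le> x" "x + 1 \<le> a" for x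
  proof (rule ccontr)
    assume neq: "dat \<tau>' (x + 1) \<noteq> dat \<tau>' x + 1"
    have xa: "x \<in> {1..a}" "x + 1 \<in> {1..a}" using x by auto
    have "dat \<tau>' x \<le> dat \<tau>' (x + 1)" "dat \<tau>' x \<noteq> dat \<tau>' (x + 1)"
      using Simplex_mono[OF \<tau>' xa] inj[OF xa] by auto
    \<comment> \<open>\<open>z\<close> is a skipped value. Its image under \<sigma> is squeezed
      between two values of \<tau>, hence is itself one, so the pullback has a point over
      \<open>z\<close>; by monotonicity that point would lie strictly between \<open>x\<close> and
      \<open>x + 1\<close>.\<close>
    define z where "z = dat \<tau>' x + 1"
    have z: "dat \<tau>' x < z" "z < dat \<tau>' (x + 1)"
      using neq \<open>dat \<tau>' x \<le> dat \<tau>' (x + 1)\<close> \<open>dat \<tau>' x \<noteq> dat \<tau>' (x + 1)\<close> by (auto simp: z_def)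
    have zb: "z \<in> {1..b}"
      using z Simplex_app[OF \<tau>' xa(1)] Simplex_app[OF \<tau>' xa(2)] by auto
    have "dat \<tau> (dat \<sigma>' x) \<le> dat \<sigma> z" "dat \<sigma> z \<le> dat \<tau> (dat \<sigma>' (x + 1))"
      using Simplex_mono[OF \<sigma> Simplex_app[OF \<tau>' xa(1)] zb] Simplex_mono[OF \<sigma> zb Simplex_app[OF \<tau>' xa(2)]]
        z square[OF xa(1)] square[OF xa(2)] by auto
    then have "dat \<sigma> z \<in> dat \<tau> ` {1..c}"
      using convex_maps_interval[OF \<tau>(2), unfolded src] Simplex_app[OF \<sigma>' xa(1)] Simplex_app[OF \<sigma>' xa(2)]
      by blast
    then obtain y where y: "y \<in> {1..c}" "dat \<tau> y = dat \<sigma> z" by (metis imageE)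
    obtain w where w: "w \<in> {1..a}" "dat \<tau>' w = z"
      using point[OF y(1) zb y(2)] by blast
    have "\<not> w \<le> x" "\<not> x + 1 \<le> w"
      using Simplex_mono[OF \<tau>' w(1) xa(1)] Simplex_mono[OF \<tau>' xa(2) w(1)] z w(2) by auto
    then show False by simp
  qed
  then show ?thesis
    using hom_Ar[OF \<tau>'] src by (simp add: convex_maps_def)
qed

section \<open>Block inclusions and identity extensions\<close>

lemma block_inclusion_hom: "block_inclusion a n b \<in> hom Simplex n (a + n + b)"
  by (auto simp: block_inclusion_def Simplex_hom mono_on_def)

lemma block_inclusion_convex: "block_inclusion a n b \<in> convex_maps"
  using hom_Ar[OF block_inclusion_hom[of a n b]] by (simp add: convex_maps_def block_inclusion_def)

lemma block_inclusion_apply: "x \<in> {1..n} \<Longrightarrow> dat (block_inclusion a n b) x = a + x"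
  by (simp add: block_inclusion_def)

lemma block_inclusion_image: "dat (block_inclusion a n b) ` {1..n} = {a<..a + n}"
proof (intro equalityI subsetI)
  fix x assume "x \<in> {a<..a + n}"
  then show "x \<in> dat (block_inclusion a n b) ` {1..n}"
    by (intro image_eqI[of _ _ "x - a"]) (auto simp: block_inclusion_def)
qed (auto simp: block_inclusion_def)

lemma identity_extension_apply:
  assumes "f \<in> hom Simplex m k"
  shows "x \<in> {1..a} \<Longrightarrow> dat (identity_extension a f b) x = x"
    and "x \<in> {1..m} \<Longrightarrow> dat (identity_extension a f b) (a + x) = a + dat f x"
    and "x \<in> {1..b} \<Longrightarrow> dat (identity_extension a f b) (a + m + x) = a + k + x"
  using assms unfolding identity_extension_def Simplex_hom by auto

text \<open>Each block is parametrized from 1, the form in which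
  \<open>identity_extension_apply\<close> computes.\<close>

lemma identity_extension_cases:
  assumes "x \<in> {1..a + m + b}"
  obtains "x \<in> {1..a}" | y where "y \<in> {1..m}" "x = a + y" | y where "y \<in> {1..b}" "x = a + m + (y::nat)"
proof -
  consider "x \<le> a" | "a < x \<and> x \<le> a + m" | "a + m < x" by linarith
  then show thesis
  proof cases
    case 1 then show ?thesis using that(1) assms by auto
  next
    case 2 then show ?thesis using that(2)[of "x - a"] assms by auto
  next
    case 3 then show ?thesis using that(3)[of "x - (a + m)"] assms by auto
  qed
qed

lemma identity_extension_hom:
  assumes f: "f \<in> hom Simplex m k"
  shows "identity_extension a f b \<in> hom Simplex (a + m + b) (a + k + b)"
proof -
  let ?g = "identity_extension a f b"
  note ap = identity_extension_apply[OF f]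
  have src: "src f = m" "tgt f = k" using f by (auto simp: Simplex_hom)
  have "dat ?g x \<in> {1..a + k + b}" if "x \<in> {1..a + m + b}" for x
    using that
  proof (cases rule: identity_extension_cases)
    case 1 then show ?thesis using ap(1) by auto
  next
    case (2 y) then show ?thesis using ap(2)[of y] Simplex_app[OF f, of y] by auto
  next
    case (3 y) then show ?thesis using ap(3)[of y] by auto
  qed
  moreover have "dat ?g x = undefined" if "x \<notin> {1..a + m + b}" for x
    using that src by (auto simp: identity_extension_def)
  ultimately have 1: "dat ?g \<in> {1..a + m + b} \<rightarrow>\<^sub>E {1..a + k + b}"
    by (intro PiE_I)
  have "mono_on {1..a + m + b} (dat ?g)"
  proof (rule mono_onI)
    fix x y assume x: "x \<in> {1..a + m + b}" and y: "y \<in> {1..a + m + b}" and "x \<le> y"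
    show "dat ?g x \<le> dat ?g y"
      using x
    proof (cases rule: identity_extension_cases)
      case x: 1
      show ?thesis using y
      proof (cases rule: identity_extension_cases)
        case 1 then show ?thesis using x ap(1) \<open>x \<le> y\<close> by simp
      next
        case (2 y') then show ?thesis using x ap(1)[of x] ap(2)[of y'] by auto
      next
        case (3 y') then show ?thesis using x ap(1)[of x] ap(3)[of y'] by auto
      qed
    next
      case x: (2 x')
      show ?thesis using y
      proof (cases rule: identity_extension_cases)
        case 1 then show ?thesis using x \<open>x \<le> y\<close> by auto
      next
        case (2 y') then show ?thesis using x ap(2)[of x'] ap(2)[of y'] Simplex_mono[OF f, of x' y'] \<open>x \<le> y\<close> by auto
      next
        case (3 y') then show ?thesis using x ap(2)[of x'] ap(3)[of y'] Simplex_app[OF f, of x'] by auto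
      qed
    next
      case x: (3 x')
      show ?thesis using y
      proof (cases rule: identity_extension_cases)
        case 1 then show ?thesis using x \<open>x \<le> y\<close> by auto
      next
        case (2 y') then show ?thesis using x \<open>x \<le> y\<close> by auto
      next
        case (3 y') then show ?thesis using x ap(3)[of x'] ap(3)[of y'] \<open>x \<le> y\<close> by auto
      qed
    qed
  qed
  then show ?thesis
    using 1 src by (simp add: Simplex_hom) (simp add: identity_extension_def)
qed

lemma identity_extension_square:
  assumes f: "f \<in> hom Simplex m k"
  shows "block_inclusion a k b \<odot>\<^bsub>Simplex\<^esub> f = identity_extension a f b \<odot>\<^bsub>Simplex\<^esub> block_inclusion a m b"
proof (rule Simplex_eqI[OF Simplex.Cmp_in[OF f block_inclusion_hom]
      Simplex.Cmp_in[OF block_inclusion_hom identity_extension_hom[OF f]]])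
  fix x assume x: "x \<in> {1..m}"
  show "dat (block_inclusion a k b \<odot>\<^bsub>Simplex\<^esub> f) x
      = dat (identity_extension a f b \<odot>\<^bsub>Simplex\<^esub> block_inclusion a m b) x"
    unfolding Simplex_Cmp_apply[OF f x] Simplex_Cmp_apply[OF block_inclusion_hom x]
      block_inclusion_apply[OF x] block_inclusion_apply[OF Simplex_app[OF f x]]
      identity_extension_apply(2)[OF f x] ..
qed

text \<open>The outer blocks are moved rigidly and the three blocks have disjoint images, so values
  can collide only inside the middle block. Fullness uses this to recover labels from their images
  under the extension.\<close>

lemma identity_extension_outside:
  assumes f: "f \<in> hom Simplex m k" and x: "x \<in> {1..a + m + b}" and y: "y \<in> {1..a + m + b}"
    and eq: "dat (identity_extension a f b) x = dat (identity_extension a f b) y"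
  shows "x = y \<or> x \<in> {a<..a + m} \<and> y \<in> {a<..a + m}"
proof -
  note ap = identity_extension_apply[OF f]
  show ?thesis using x
  proof (cases rule: identity_extension_cases)
    case x: 1
    show ?thesis using y
    proof (cases rule: identity_extension_cases)
      case 1 then show ?thesis using x ap(1) eq by simp
    next
      case (2 y') then show ?thesis using x ap(1)[of x] ap(2)[of y'] eq Simplex_app[OF f, of y'] by auto
    next
      case (3 y') then show ?thesis using x ap(1)[of x] ap(3)[of y'] eq by auto
    qed
  next
    case x: (2 x')
    show ?thesis using y
    proof (cases rule: identity_extension_cases)
      case 1 then show ?thesis using x ap(1)[of y] ap(2)[of x'] eq Simplex_app[OF f, of x'] by auto
    next
      case (2 y') then show ?thesis using x by auto
    next
      case (3 y') then show ?thesis using x ap(2)[of x'] ap(3)[of y'] eq Simplex_app[OF f, of x'] by auto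
    qed
  next
    case x: (3 x')
    show ?thesis using y
    proof (cases rule: identity_extension_cases)
      case 1 then show ?thesis using x ap(1)[of y] ap(3)[of x'] eq by auto
    next
      case (2 y') then show ?thesis using x ap(3)[of x'] ap(2)[of y'] eq Simplex_app[OF f, of y'] by auto
    next
      case (3 y') then show ?thesis using x ap(3)[of x'] ap(3)[of y'] eq by auto
    qed
  qed
qed

text \<open>The image condition of \<open>iso_bc_comparison\<close>: the common value lies in
  \<open>{a<..a + k}\<close>, which the outer blocks avoid.\<close>

lemma identity_extension_pullback:
  assumes f: "f \<in> hom Simplex m k" and y: "y \<in> {1..k}" and z: "z \<in> {1..a + m + b}"
    and eq: "dat (block_inclusion a k b) y = dat (identity_extension a f b) z"
  shows "z \<in> dat (block_inclusion a m b) ` {1..m}"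
  unfolding block_inclusion_image using z
proof (cases rule: identity_extension_cases)
  case 1 then show "z \<in> {a<..a + m}"
    using identity_extension_apply(1)[OF f] eq block_inclusion_apply[OF y] y by auto
next
  case (2 z') then show "z \<in> {a<..a + m}" by auto
next
  case (3 z') then show "z \<in> {a<..a + m}"
    using identity_extension_apply(3)[OF f, of z'] eq block_inclusion_apply[OF y] y by auto
qed

section \<open>The Beck--Chevalley condition\<close>

context right_fibration
begin

lemma K_fibre_hom: "s \<in> hom (fibre proj n) x y \<longleftrightarrow> s \<in> hom K x y \<and> ord s = Idn Simplex n"
  by (simp add: fibre_hom)

lemma K_fibre_Ob: "x \<in> Ob (fibre proj n) \<longleftrightarrow> x \<in> Ob K \<and> deg x = n"
  by (simp add: fibre_Ob)

text \<open>By \<open>fibre_iso_if_rho_iso\<close> and \<open>E_iso_iff\<close> it suffices that the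
  underlying injection of the comparison is surjective, which is an element chase through the four
  lifts.\<close>

lemma iso_bc_comparison:
  assumes \<tau>': "\<tau>' \<in> hom Simplex a b" "\<tau>' \<in> convex_maps" and \<sigma>': "\<sigma>' \<in> hom Simplex a c"
    and \<tau>: "\<tau> \<in> hom Simplex c d" "\<tau> \<in> convex_maps" and \<sigma>: "\<sigma> \<in> hom Simplex b d"
    and square: "\<tau> \<odot>\<^bsub>Simplex\<^esub> \<sigma>' = \<sigma> \<odot>\<^bsub>Simplex\<^esub> \<tau>'"
    and image: "\<And>y z. y \<in> {1..c} \<Longrightarrow> z \<in> {1..b} \<Longrightarrow> dat \<tau> y = dat \<sigma> z \<Longrightarrow> z \<in> dat \<tau>' ` {1..a}"
    and x: "x \<in> Ob (fibre proj b)"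
  shows "iso_arrow K (bc_comparison proj \<tau>' \<sigma>' \<tau> \<sigma> x)"
proof -
  note 0 = cart_lift[OF \<tau>' x] and 3 = cocart_lift[OF \<sigma> x]
  note 1 = cocart_lift[OF \<sigma>' 0(4)] and 2 = cart_lift[OF \<tau> 3(4)]
  note \<theta> = bc_comparison[OF \<tau>' \<sigma>' \<tau> \<sigma> square x]
  let ?\<theta> = "bc_comparison proj \<tau>' \<sigma>' \<tau> \<sigma> x"
  let ?P = "FO (pull proj \<tau>) (FO (push proj \<sigma>) x)"
  let ?e = "cart_lift proj \<tau> (FO (push proj \<sigma>) x)" and ?e' = "cart_lift proj \<tau>' x"
  let ?c = "cocart_lift proj \<sigma> x" and ?c' = "cocart_lift proj \<sigma>' (FO (pull proj \<tau>') x)"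
  have \<theta>K: "?\<theta> \<in> hom K (FO (push proj \<sigma>') (FO (pull proj \<tau>') x)) ?P"
    using \<theta>(1) unfolding K_fibre_hom by blast
  note c = K_homD[OF 3(2)] and e = K_homD[OF 2(2)] and e' = K_homD[OF 0(2)] and c' = K_homD[OF 1(2)]
    and \<theta>' = K_homD[OF \<theta>K]
  have deg: "deg x = b" "deg ?P = c" "deg (FO (pull proj \<tau>') x) = a"
    using x 2(4) 0(4) unfolding K_fibre_Ob by blast+
  have "FO U (ob ?P) \<subseteq> und (rho ?\<theta>) ` FO U (ob (FO (push proj \<sigma>') (FO (pull proj \<tau>') x)))"
  proof
    fix p assume p: "p \<in> FO U (ob ?P)"
    \<comment> \<open>The lift over \<sigma> has invertible \<open>rho\<close>, so the image of
      \<open>p\<close> in the pushforward comes from an element of \<open>x\<close>.\<close>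
    obtain q where q: "q \<in> FO U (ob x)" "und (rho ?e) p = und (rho ?c) q"
      using cocartesian_rho_iso[OF 3(2,1)] und_in[OF e(1) p] unfolding E_iso_iff[OF c(1)] by blast
    \<comment> \<open>Comparing labels puts \<open>lab x q\<close> into the image of \<tau>', so
      \<open>q\<close> survives in the pullback along \<tau>'.\<close>
    have "dat \<tau> (lab ?P p) = dat \<sigma> (lab x q)"
      using c(3)[OF q(1)] e(3)[OF p] q(2) 2(3) 3(3) by simp
    then have "lab x q \<in> dat \<tau>' ` {1..a}"
      using image lab_in[OF e(4) p] lab_in[OF c(4) q(1)] deg by metis
    then have "q \<in> und (rho ?e') ` FO U (ob (FO (pull proj \<tau>') x))"
      using cartesian_image[OF 0(2,1) _ q(1), unfolded 0(3) deg] \<tau>'(2) by blast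
    then obtain r where r: "r \<in> FO U (ob (FO (pull proj \<tau>') x))" "q = und (rho ?e') r"
      by blast
    have "und (rho ?e) p = und (rho (?c \<odot>\<^bsub>K\<^esub> ?e')) r"
      unfolding K_Cmp und_Cmp[OF e'(1) c(1) r(1)] q(2) r(2) ..
    also have "\<dots> = und (rho ?e) (und (rho ?\<theta>) (und (rho ?c') r))"
      unfolding \<theta>(2)[symmetric] K_Cmp und_Cmp[OF E.Cmp_in[OF c'(1) \<theta>'(1)] e(1) r(1)]
        und_Cmp[OF c'(1) \<theta>'(1) r(1)] ..
    finally have "p = und (rho ?\<theta>) (und (rho ?c') r)"
      by (rule inj_onD[OF und_inj[OF e(1)] _ p und_in[OF \<theta>'(1) und_in[OF c'(1) r(1)]]])
    then show "p \<in> und (rho ?\<theta>) ` FO U (ob (FO (push proj \<sigma>') (FO (pull proj \<tau>') x)))"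
      using und_in[OF c'(1) r(1)] by blast
  qed
  then show ?thesis
    using fibre_iso_if_rho_iso[OF \<theta>(1)] E_iso_iff[OF \<theta>'(1)] by blast
qed

lemma beck_chevalley_proj: "beck_chevalley proj"
  unfolding beck_chevalley_def
proof (intro allI impI, elim conjE)
  fix \<tau>' \<sigma>' \<tau> \<sigma>
  assume pb: "is_pullback Simplex \<tau>' \<sigma>' \<tau> \<sigma>" and convex: "\<tau> \<in> convex_maps"
  define a b c d where "a = Dom Simplex \<tau>'" "b = Cod Simplex \<tau>'" "c = Dom Simplex \<tau>" "d = Cod Simplex \<tau>"
  then have \<tau>': "\<tau>' \<in> hom Simplex a b" and \<sigma>': "\<sigma>' \<in> hom Simplex a c"
    and \<tau>: "\<tau> \<in> hom Simplex c d" and \<sigma>: "\<sigma> \<in> hom Simplex b d"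
    and square: "\<tau> \<odot>\<^bsub>Simplex\<^esub> \<sigma>' = \<sigma> \<odot>\<^bsub>Simplex\<^esub> \<tau>'"
    using pb unfolding is_pullback_def hom_def by simp_all
  note convex' = pullback_convex[OF pb \<tau>' \<sigma>' \<tau> convex \<sigma>]
  show "nat_iso (push proj \<sigma>' \<circ>\<^sub>F pull proj \<tau>') (pull proj \<tau> \<circ>\<^sub>F push proj \<sigma>)
      (bc_comparison proj \<tau>' \<sigma>' \<tau> \<sigma>)"
  proof (rule nat_iso_bc_comparison[OF \<tau>' convex' \<sigma>' \<tau> convex \<sigma> square])
    show "iso_arrow K (bc_comparison proj \<tau>' \<sigma>' \<tau> \<sigma> x)" if "x \<in> Ob (fibre proj b)" for x
    proof (rule iso_bc_comparison[OF \<tau>' convex' \<sigma>' \<tau> convex \<sigma> square _ that])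
      show "z \<in> dat \<tau>' ` {1..a}" if "y \<in> {1..c}" "z \<in> {1..b}" "dat \<tau> y = dat \<sigma> z" for y z
        using pullback_point[OF pb \<tau>' \<sigma>' \<tau> \<sigma> that] by blast
    qed
  qed
qed

lemma sesquicartesian_fibration_proj: "sesquicartesian_fibration proj"
  by (simp add: sesquicartesian_fibration_def cocartesian_fibration_proj cartesian_over_proj
      beck_chevalley_proj)

end

section \<open>Identity-extension squares\<close>

context right_fibration
begin

context
  fixes f :: "(nat, nat \<Rightarrow> nat) arrow" and m k a b :: nat
    and i j g :: "(nat, nat \<Rightarrow> nat) arrow"
  assumes f: "f \<in> hom Simplex m k"
    and j_def: "j = block_inclusion a m b" and i_def: "i = block_inclusion a k b"
    and g_def: "g = identity_extension a f b"
begin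

private abbreviation (input) "\<theta> \<equiv> bc_comparison proj j f i g"
private abbreviation (input) "pairing \<equiv> isocomma_pairing (pull proj j) (push proj g) (push proj f) (pull proj i) \<theta>"
private abbreviation (input) "IC \<equiv> isocomma (push proj f) (pull proj i)"

private lemma j: "j \<in> hom Simplex m (a + m + b)" "j \<in> convex_maps"
  and i: "i \<in> hom Simplex k (a + k + b)" "i \<in> convex_maps"
  and g: "g \<in> hom Simplex (a + m + b) (a + k + b)"
  and square: "i \<odot>\<^bsub>Simplex\<^esub> f = g \<odot>\<^bsub>Simplex\<^esub> j"
  unfolding i_def j_def g_def
  by (rule block_inclusion_hom block_inclusion_convex identity_extension_hom[OF f]
      identity_extension_square[OF f])+

private lemma j_image: "dat j ` {1..m} = {a<..a + m}"
  and i_image: "dat i ` {1..k} = {a<..a + k}"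
  unfolding j_def i_def by (rule block_inclusion_image)+

private lemma nat_iso_iesq: "nat_iso (push proj f \<circ>\<^sub>F pull proj j) (pull proj i \<circ>\<^sub>F push proj g) \<theta>"
proof (rule nat_iso_bc_comparison[OF j f i g square])
  show "iso_arrow K (\<theta> x)" if "x \<in> Ob (fibre proj (a + m + b))" for x
    using iso_bc_comparison[OF j f i g square _ that] identity_extension_pullback[OF f]
    unfolding i_def j_def g_def by blast
qed

private lemmas iesq_simps = push_simps(1,2)[OF f] push_simps(1,2)[OF g] pull_simps(1,2)[OF j(1)] pull_simps(1,2)[OF i(1)]

private lemma push_f_pull_i: "is_functor (push proj f)" "is_functor (pull proj i)" "Tgt (push proj f) = Tgt (pull proj i)"
  using is_functor_push[OF f] is_functor_pull[OF i] by (simp_all add: iesq_simps)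

private lemmas IC_Ob = isocomma_Ob[OF push_f_pull_i, unfolded iesq_simps]
  and IC_hom = isocomma_hom[OF push_f_pull_i, unfolded iesq_simps fibre_Cmp]
  and IC_iso = isocomma_iso[OF push_f_pull_i, unfolded iesq_simps]

private lemma is_functor_pairing: "is_functor pairing"
  by (rule is_functor_isocomma_pairing[OF push_f_pull_i is_functor_pull[OF j] _ is_functor_push[OF g] _ _ nat_iso_iesq])
    (simp_all only: iesq_simps)

private lemma pairing_simps:
  "Src pairing = fibre proj (a + m + b)" "Tgt pairing = IC"
  "FO pairing w = (FO (pull proj j) w, FO (push proj g) w, \<theta> w)"
  "l \<in> hom (fibre proj (a + m + b)) w w' \<Longrightarrow> FA pairing l =
    Arrow (FO (pull proj j) w, FO (push proj g) w, \<theta> w) (FA (pull proj j) l, FA (push proj g) l)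
      (FO (pull proj j) w', FO (push proj g) w', \<theta> w')"
  by (simp_all add: isocomma_pairing_simps[OF push_f_pull_i] iesq_simps)

interpretation N: category "fibre proj (a + m + b)" by (rule proj.category_fibre) simp
interpretation Fk: category "fibre proj k" by (rule proj.category_fibre) simp

text \<open>The pushforward component alone suffices: \<open>rho l\<close> is recovered by
  cancelling the monic \<open>rho\<close> of the lift along \<open>g\<close>, while
  \<open>ord l\<close> is fixed in a fibre.\<close>

private lemma pairing_faithful:
  assumes l: "l \<in> hom (fibre proj (a + m + b)) x y" "l' \<in> hom (fibre proj (a + m + b)) x y"
    and eq: "FA pairing l = FA pairing l'"
  shows "l = l'"
proof -
  have lK: "l \<in> hom K x y" "l' \<in> hom K x y" "ord l = ord l'"
    using l by (auto simp: K_fibre_hom)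
  have "FA (push proj g) l = FA (push proj g) l'"
    using eq pairing_simps(4)[OF l(1)] pairing_simps(4)[OF l(2)] by simp
  then have "cocart_lift proj g y \<odot>\<^bsub>K\<^esub> l = cocart_lift proj g y \<odot>\<^bsub>K\<^esub> l'"
    using push_FA(2)[OF g l(1)] push_FA(2)[OF g l(2)] by metis
  then have "rho (cocart_lift proj g y) \<odot>\<^bsub>E\<^esub> rho l = rho (cocart_lift proj g y) \<odot>\<^bsub>E\<^esub> rho l'"
    using K_Cmp(3) by metis
  then have "rho l = rho l'"
    using E_cancel[OF K_homD(1)[OF cocart_lift(2)[OF g N.hom_Ob2[OF l(1)]]] K_homD(1)[OF lK(1)] K_homD(1)[OF lK(2)]]
    by blast
  then show ?thesis
    using K_eqI[OF lK(1,2) _ lK(3)] by blast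
qed

text \<open>The underlying arrow \<open>r\<close> is dictated by \<open>v\<close>. The difficulty is
  that \<open>r\<close> must preserve labels: \<open>v\<close> controls them only after applying
  \<open>g\<close>, and in the middle block, where \<open>g\<close> may identify labels,
  \<open>u\<close> supplies the missing information.\<close>

private lemma pairing_full:
  assumes x: "x \<in> Ob (fibre proj (a + m + b))" and y: "y \<in> Ob (fibre proj (a + m + b))"
    and h: "h \<in> hom IC (FO pairing x) (FO pairing y)"
  shows "\<exists>l \<in> hom (fibre proj (a + m + b)) x y. FA pairing l = h"
proof -
  let ?N = "a + m + b"
  obtain u v where uv: "h = Arrow (FO pairing x) (u, v) (FO pairing y)"
    "u \<in> hom (fibre proj m) (FO (pull proj j) x) (FO (pull proj j) y)"
    "v \<in> hom (fibre proj (a + k + b)) (FO (push proj g) x) (FO (push proj g) y)"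
    "FA (pull proj i) v \<odot>\<^bsub>K\<^esub> \<theta> x = \<theta> y \<odot>\<^bsub>K\<^esub> FA (push proj f) u"
    using h unfolding pairing_simps(3) IC_hom proj_simps by blast
  have uK: "u \<in> hom K (FO (pull proj j) x) (FO (pull proj j) y)" "ord u = Idn Simplex m"
    and vK: "v \<in> hom K (FO (push proj g) x) (FO (push proj g) y)" "ord v = Idn Simplex (a + k + b)"
    using uv by (auto simp: K_fibre_hom)
  define ex ey cx cy where d: "ex = cart_lift proj j x" "ey = cart_lift proj j y"
    "cx = cocart_lift proj g x" "cy = cocart_lift proj g y"
  note ex = cart_lift[OF j x, folded d] and ey = cart_lift[OF j y, folded d]
    and cx = cocart_lift[OF g x, folded d] and cy = cocart_lift[OF g y, folded d]
  note ex' = K_homD[OF ex(2)] and ey' = K_homD[OF ey(2)] and cx' = K_homD[OF cx(2)] and cy' = K_homD[OF cy(2)]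
    and u' = K_homD[OF uK(1)] and v' = K_homD[OF vK(1)]
  have deg: "deg x = ?N" "deg y = ?N" "deg (FO (pull proj j) x) = m"
    using x y ex(4) unfolding K_fibre_Ob by blast+
  have cy_iso: "iso_arrow E (rho cy)"
    by (rule cocartesian_rho_iso[OF cy(2,1)])
  \<comment> \<open>\<open>v\<close> is transported back along the lifts over \<open>g\<close>,
    using that \<open>rho cy\<close> is invertible.\<close>
  obtain r where r: "r \<in> hom E (ob x) (ob y)" "rho cy \<odot>\<^bsub>E\<^esub> r = rho v \<odot>\<^bsub>E\<^esub> rho cx"
    using E.iso_factor_left[OF cy_iso cy'(1) E.Cmp_in[OF cx'(1) v'(1)]] by blast
  define iy where "iy = cart_lift proj i (FO (push proj g) y)"
  define ix where "ix = cart_lift proj i (FO (push proj g) x)"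
  define fx where "fx = cocart_lift proj f (FO (pull proj j) x)"
  define fy where "fy = cocart_lift proj f (FO (pull proj j) y)"
  note ix = cart_lift[OF i cx(4), folded ix_def] and iy = cart_lift[OF i cy(4), folded iy_def]
    and fx = cocart_lift[OF f ex(4), folded fx_def] and fy = cocart_lift[OF f ey(4), folded fy_def]
  note \<theta>x = bc_comparison[OF j f i g square x, folded d ix_def fx_def]
    and \<theta>y = bc_comparison[OF j f i g square y, folded d iy_def fy_def]
  note pv = pull_FA[OF i uv(3), folded ix_def iy_def] and pu = push_FA[OF f uv(2), folded fx_def fy_def]
  have \<theta>K: "\<theta> x \<in> hom K (FO (push proj f) (FO (pull proj j) x)) (FO (pull proj i) (FO (push proj g) x))"
    "\<theta> y \<in> hom K (FO (push proj f) (FO (pull proj j) y)) (FO (pull proj i) (FO (push proj g) y))"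
    "FA (pull proj i) v \<in> hom K (FO (pull proj i) (FO (push proj g) x)) (FO (pull proj i) (FO (push proj g) y))"
    "FA (push proj f) u \<in> hom K (FO (push proj f) (FO (pull proj j) x)) (FO (push proj f) (FO (pull proj j) y))"
    using \<theta>x(1) \<theta>y(1) pv(1) pu(1) unfolding K_fibre_hom by blast+
  \<comment> \<open>Pasting the compatibility of \<open>u\<close> and \<open>v\<close> with the two
    comparison squares shows that \<open>r\<close> restricts to \<open>u\<close> on the parts pulled
    back along \<open>j\<close>.\<close>
  have "cy \<odot>\<^bsub>K\<^esub> (ey \<odot>\<^bsub>K\<^esub> u) = (iy \<odot>\<^bsub>K\<^esub> (\<theta> y \<odot>\<^bsub>K\<^esub> fy)) \<odot>\<^bsub>K\<^esub> u"
    unfolding \<theta>y(2) by (rule K.assoc[OF uK(1) ey(2) cy(2)])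
  also have "\<dots> = iy \<odot>\<^bsub>K\<^esub> (\<theta> y \<odot>\<^bsub>K\<^esub> (FA (push proj f) u \<odot>\<^bsub>K\<^esub> fx))"
    unfolding pu(2) K.assoc[OF uK(1) K.Cmp_in[OF fy(2) \<theta>K(2)] iy(2), symmetric]
      K.assoc[OF uK(1) fy(2) \<theta>K(2), symmetric] ..
  also have "\<dots> = iy \<odot>\<^bsub>K\<^esub> (FA (pull proj i) v \<odot>\<^bsub>K\<^esub> (\<theta> x \<odot>\<^bsub>K\<^esub> fx))"
    unfolding K.assoc[OF fx(2) \<theta>K(4,2)] K.assoc[OF fx(2) \<theta>K(1,3)] uv(4) ..
  also have "\<dots> = v \<odot>\<^bsub>K\<^esub> (cx \<odot>\<^bsub>K\<^esub> ex)"
    unfolding K.assoc[OF K.Cmp_in[OF fx(2) \<theta>K(1)] \<theta>K(3) iy(2)] pv(2)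
      K.assoc[OF K.Cmp_in[OF fx(2) \<theta>K(1)] ix(2) vK(1), symmetric] \<theta>x(2) ..
  finally have "rho cy \<odot>\<^bsub>E\<^esub> (rho ey \<odot>\<^bsub>E\<^esub> rho u) = rho v \<odot>\<^bsub>E\<^esub> (rho cx \<odot>\<^bsub>E\<^esub> rho ex)"
    unfolding K_Cmp(3)[symmetric] by simp
  also have "\<dots> = rho cy \<odot>\<^bsub>E\<^esub> (r \<odot>\<^bsub>E\<^esub> rho ex)"
    unfolding E.assoc[OF ex'(1) cx'(1) v'(1)] E.assoc[OF ex'(1) r(1) cy'(1)] r(2) ..
  finally have restr: "rho ey \<odot>\<^bsub>E\<^esub> rho u = r \<odot>\<^bsub>E\<^esub> rho ex"
    by (rule E_cancel[OF cy'(1) E.Cmp_in[OF u'(1) ey'(1)] E.Cmp_in[OF ex'(1) r(1)]])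
  have lab: "lab y (und r p) = lab x p" if p: "p \<in> FO U (ob x)" for p
  proof -
    have rp: "und r p \<in> FO U (ob y)" by (rule und_in[OF r(1) p])
    have "dat g (lab y (und r p)) = lab (FO (push proj g) y) (und (rho v \<odot>\<^bsub>E\<^esub> rho cx) p)"
      using cy'(3)[OF rp] und_Cmp[OF r(1) cy'(1) p] r(2) cy(3) by simp
    also have "\<dots> = dat g (lab x p)"
      using und_Cmp[OF cx'(1) v'(1) p] v'(3)[OF und_in[OF cx'(1) p]] cx'(3)[OF p] cx(3) vK(2)
        Simplex_Idn_apply[OF lab_in[OF cx'(5) und_in[OF cx'(1) p]]] cx(4) unfolding K_fibre_Ob by simp
    finally have gg: "dat g (lab x p) = dat g (lab y (und r p))" by simp
    consider "lab x p = lab y (und r p)" | "lab x p \<in> {a<..a + m}"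
      using identity_extension_outside[OF f _ _ gg[unfolded g_def]] lab_in[OF ex'(5) p] lab_in[OF ey'(5) rp]
      unfolding deg by blast
    then show ?thesis
    proof cases
      \<comment> \<open>A middle label means that \<open>p\<close> comes from the pullback along
        \<open>j\<close>, where \<open>restr\<close> identifies \<open>r\<close> with
        \<open>u\<close>; and \<open>u\<close>, being vertical, preserves labels.\<close>
      case 2
      then have "lab x p \<in> dat (ord ex) ` {1..deg (FO (pull proj j) x)}"
        unfolding ex(3) deg j_image .
      then have "p \<in> und (rho ex) ` FO U (ob (FO (pull proj j) x))"
        using cartesian_image[OF ex(2,1) _ p] j(2) unfolding ex(3) by blast
      then obtain q where q: "q \<in> FO U (ob (FO (pull proj j) x))" "p = und (rho ex) q"
        by blast
      have "lab y (und r p) = lab y (und (rho ey) (und (rho u) q))"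
        unfolding q(2) und_Cmp[OF ex'(1) r(1) q(1), symmetric] restr[symmetric] und_Cmp[OF u'(1) ey'(1) q(1)] ..
      also have "\<dots> = dat j (lab (FO (pull proj j) x) q)"
        unfolding ey'(3)[OF und_in[OF u'(1) q(1)]] u'(3)[OF q(1)] ey(3) uK(2)
        using Simplex_Idn_apply[OF lab_in[OF ex'(4) q(1), unfolded deg]] by simp
      also have "\<dots> = lab x p"
        unfolding q(2) ex'(3)[OF q(1)] ex(3) ..
      finally show ?thesis .
    qed simp
  qed
  define l where "l = Arrow x (r, Idn Simplex ?N) y"
  have l: "l \<in> hom K x y"
    using r(1) lab ex'(5) ey'(5) Simplex.Idn_in[OF Simplex_Ob, of ?N]
      Simplex_Idn_apply[OF lab_in[OF ex'(5), unfolded deg]] deg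
    by (simp add: l_def K_hom)
  have lN: "l \<in> hom (fibre proj ?N) x y"
    using l by (simp add: K_fibre_hom l_def)
  have "FA (pull proj j) l = u"
  proof (rule pull_FA_eqI[OF j lN uv(2), folded d])
    show "ey \<odot>\<^bsub>K\<^esub> u = l \<odot>\<^bsub>K\<^esub> ex"
      by (rule K_eqI[OF K.Cmp_in[OF uK(1) ey(2)] K.Cmp_in[OF ex(2) l]])
        (simp_all add: K_Cmp restr l_def ey(3) ex(3) uK(2) Simplex.Idn_left[OF j(1)] Simplex.Idn_right[OF j(1)])
  qed
  moreover have "FA (push proj g) l = v"
  proof (rule push_FA_eqI[OF g lN uv(3), folded d])
    show "v \<odot>\<^bsub>K\<^esub> cx = cy \<odot>\<^bsub>K\<^esub> l"
      by (rule K_eqI[OF K.Cmp_in[OF cx(2) vK(1)] K.Cmp_in[OF l cy(2)]])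
        (simp_all add: K_Cmp r(2) l_def cx(3) cy(3) vK(2) Simplex.Idn_left[OF g] Simplex.Idn_right[OF g])
  qed
  ultimately show ?thesis
    using lN pairing_simps(4)[OF lN] uv(1) unfolding pairing_simps(3) by metis
qed

text \<open>An object \<open>(c0, d, t)\<close> is glued to \<open>w\<close>: the underlying object
  is that of \<open>d\<close>; elements coming from \<open>c0\<close> take its labels shifted by
  \<open>a\<close>, and the others keep their labels in \<open>d\<close> up to the change in length
  of the middle block.\<close>

private lemma pairing_ess_surj:
  assumes z: "z \<in> Ob IC"
  shows "\<exists>w \<in> Ob (fibre proj (a + m + b)). \<exists>h \<in> hom IC (FO pairing w) z. iso_arrow IC h"
proof -
  let ?N = "a + m + b"
  obtain c0 d t where [simp]: "z = (c0, d, t)" by (metis prod_cases3)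
  have c0: "c0 \<in> Ob (fibre proj m)" and d: "d \<in> Ob (fibre proj (a + k + b))"
    and t: "t \<in> hom (fibre proj k) (FO (push proj f) c0) (FO (pull proj i) d)" "iso_arrow (fibre proj k) t"
    using z by (simp_all add: IC_Ob)
  have tK: "t \<in> hom K (FO (push proj f) c0) (FO (pull proj i) d)" "ord t = Idn Simplex k"
    using t by (auto simp: K_fibre_hom)
  define e where "e = cart_lift proj i d"
  define c where "c = cocart_lift proj f c0"
  note e = cart_lift[OF i d, folded e_def] and c = cocart_lift[OF f c0, folded c_def]
  note e' = K_homD[OF e(2)] and c' = K_homD[OF c(2)] and t' = K_homD[OF tK(1)]
  have deg: "deg c0 = m" "deg d = a + k + b" "deg (FO (pull proj i) d) = k"
    using c0 d e(4) unfolding K_fibre_Ob by blast+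
  \<comment> \<open>Embeds \<open>c0\<close> into \<open>d\<close>. This composite will factor as a
    cartesian arrow over \<open>j\<close> followed by a cocartesian one over
    \<open>g\<close>.\<close>
  define m0 where "m0 = e \<odot>\<^bsub>K\<^esub> t \<odot>\<^bsub>K\<^esub> c"
  have m0: "m0 \<in> hom K c0 d" "ord m0 = i \<odot>\<^bsub>Simplex\<^esub> f"
    using K.Cmp_in[OF K.Cmp_in[OF c(2) tK(1)] e(2)] e(3) c(3) tK(2) Simplex.Idn_left[OF f]
    by (simp_all add: m0_def K_Cmp)
  note m0' = K_homD[OF m0(1)]
  define A where "A = FO U (ob c0)"
  define \<mu> where "\<mu> = und (rho m0)"
  have \<mu>_inj: "inj_on \<mu> A"
    unfolding \<mu>_def A_def by (rule und_inj[OF m0'(1)])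
  have \<mu>_in: "\<mu> p \<in> FO U (ob d)" if "p \<in> A" for p
    using und_in[OF m0'(1)] that unfolding \<mu>_def A_def .
  have lab_\<mu>: "lab d (\<mu> p) = a + dat f (lab c0 p)" if p: "p \<in> A" for p
  proof -
    have "lab c0 p \<in> {1..m}" using lab_in[OF m0'(4) p[unfolded A_def]] deg by simp
    then show ?thesis
      using m0'(3)[OF p[unfolded A_def]] Simplex_Cmp_apply[OF f] block_inclusion_apply[OF Simplex_app[OF f]]
      unfolding \<mu>_def m0(2) i_def by metis
  qed
  \<comment> \<open>Elements of \<open>d\<close> labelled in the middle block come from the pullback
    along \<open>i\<close>; the underlying maps of \<open>t\<close> and \<open>c\<close> are
    surjective, so these elements all come from \<open>c0\<close>.\<close>
  have \<mu>_image: "q \<in> \<mu> ` A" if q: "q \<in> FO U (ob d)" "lab d q \<in> {a<..a + k}" for q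
  proof -
    have "lab d q \<in> dat (ord e) ` {1..deg (FO (pull proj i) d)}"
      unfolding e(3) deg i_image using q(2) .
    then have "q \<in> und (rho e) ` FO U (ob (FO (pull proj i) d))"
      using cartesian_image[OF e(2,1) _ q(1)] i(2) unfolding e(3) by blast
    then obtain q1 where q1: "q1 \<in> FO U (ob (FO (pull proj i) d))" "q = und (rho e) q1"
      by blast
    obtain q2 where q2: "q2 \<in> FO U (ob (FO (push proj f) c0))" "q1 = und (rho t) q2"
      using iso_K_rho[OF tK(1) proj.iso_of_fibre_iso[OF t]] q1(1) unfolding E_iso_iff[OF t'(1)] by blast
    obtain q3 where q3: "q3 \<in> FO U (ob c0)" "q2 = und (rho c) q3"
      using cocartesian_rho_iso[OF c(2,1)] q2(1) unfolding E_iso_iff[OF c'(1)] by blast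
    have "q = \<mu> q3"
      unfolding \<mu>_def m0_def K_Cmp und_Cmp[OF E.Cmp_in[OF c'(1) t'(1)] e'(1) q3(1)]
        und_Cmp[OF c'(1) t'(1) q3(1)] q1(2) q2(2) q3(2) ..
    then show ?thesis using q3(1) by (auto simp: A_def)
  qed
  \<comment> \<open>Off the image of \<mu>, a label above \<open>a\<close> is even above
    \<open>a + k\<close> by \<open>\<mu>_image\<close>, so subtracting \<open>k\<close> is exact and
    the new label lies in the last block of \<open>a + m + b\<close>.\<close>
  define \<gamma> where "\<gamma> q = (if q \<in> \<mu> ` A then a + lab c0 (inv_into A \<mu> q)
    else if lab d q \<le> a then lab d q else lab d q - k + m)" for q
  have \<gamma>_\<mu>: "\<gamma> (\<mu> p) = a + lab c0 p" if "p \<in> A" for p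
    using that inv_into_f_f[OF \<mu>_inj that] by (simp add: \<gamma>_def)
  have lab_c0: "lab c0 p \<in> {1..m}" if "p \<in> A" for p
    using lab_in[OF m0'(4)] that deg unfolding A_def by metis
  have \<gamma>_cases: "(\<exists>p \<in> A. q = \<mu> p) \<or> q \<notin> \<mu> ` A \<and> \<gamma> q = lab d q \<and> lab d q \<in> {1..a} \<or>
      q \<notin> \<mu> ` A \<and> (\<exists>s \<in> {1..b}. \<gamma> q = a + m + s \<and> lab d q = a + k + s)" if q: "q \<in> FO U (ob d)" for q
  proof (cases "q \<in> \<mu> ` A")
    case False
    then have out: "lab d q \<notin> {a<..a + k}" using \<mu>_image[OF q] by blast
    have range: "lab d q \<in> {1..a + k + b}" using lab_in[OF m0'(5) q] deg by simp
    show ?thesis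
    proof (cases "lab d q \<le> a")
      case True then show ?thesis using False range by (simp add: \<gamma>_def)
    next
      case gt: False
      then have "lab d q = a + k + (lab d q - (a + k))" "lab d q - (a + k) \<in> {1..b}"
        "\<gamma> q = a + m + (lab d q - (a + k))"
        using False range out by (auto simp: \<gamma>_def)
      then show ?thesis using False by blast
    qed
  qed auto
  have \<gamma>_in: "\<gamma> q \<in> {1..?N}" if q: "q \<in> FO U (ob d)" for q
    using \<gamma>_cases[OF q] \<gamma>_\<mu> lab_c0 by fastforce
  have g_\<gamma>: "dat g (\<gamma> q) = lab d q" if q: "q \<in> FO U (ob d)" for q
  proof -
    note ap = identity_extension_apply[OF f, where a = a and b = b, folded g_def]
    consider (mid) p where "p \<in> A" "q = \<mu> p" | (low) "\<gamma> q = lab d q" "lab d q \<in> {1..a}"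
      | (high) s where "s \<in> {1..b}" "\<gamma> q = a + m + s" "lab d q = a + k + s"
      using \<gamma>_cases[OF q] by blast
    then show ?thesis
    proof cases
      case mid
      show ?thesis
        unfolding mid(2) \<gamma>_\<mu>[OF mid(1)] lab_\<mu>[OF mid(1)] by (rule ap(2)[OF lab_c0[OF mid(1)]])
    next
      case low
      show ?thesis
        unfolding low(1) by (rule ap(1)[OF low(2)])
    next
      case high
      show ?thesis
        unfolding high(2,3) by (rule ap(3)[OF high(1)])
    qed
  qed
  have dE: "ob d \<in> Ob E" using m0'(5) by (simp add: K_Ob)
  define w where "w = (ob d, ?N, \<lambda>q\<in>FO U (ob d). \<gamma> q)"
  have wK: "w \<in> Ob K"
    unfolding K_Ob w_def using dE \<gamma>_in by (simp add: restrict_PiE_iff)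
  then have w: "w \<in> Ob (fibre proj ?N)"
    by (simp add: K_fibre_Ob w_def)
  \<comment> \<open>Cocartesian over \<open>g\<close> because its underlying arrow is an identity,
    so \<open>d\<close> is a pushforward of \<open>w\<close>.\<close>
  define cw where "cw = Arrow w (Idn E (ob d), g) d"
  have cw: "cw \<in> hom K w d"
    using wK m0'(5) E.Idn_in[OF dE] und_Idn[OF dE] g g_\<gamma> deg by (simp add: cw_def K_hom w_def)
  have cw_cocart: "cocartesian_arrow proj cw"
    by (rule proj_cocartesianI[OF cw]) (simp add: cw_def E.iso_Idn[OF dE])
  \<comment> \<open>Cartesian over \<open>j\<close> because elements labelled in the middle block by
    \<gamma> lie in the image of \<mu>, so \<open>c0\<close> is a pullback of
    \<open>w\<close>.\<close>
  define mw where "mw = Arrow c0 (rho m0, j) w"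
  have mw: "mw \<in> hom K c0 w"
  proof -
    have "lab w (\<mu> p) = dat j (lab c0 p)" if "p \<in> A" for p
      using \<gamma>_\<mu>[OF that] \<mu>_in[OF that] block_inclusion_apply[OF lab_c0[OF that]] by (simp add: w_def j_def)
    then show ?thesis
      using m0' wK j(1) deg unfolding K_hom mw_def A_def \<mu>_def by (simp add: w_def)
  qed
  have mw_cart: "cartesian_arrow proj mw"
  proof (rule proj_cartesianI[OF mw])
    show "inj_on (dat (ord mw)) {1..deg c0}"
      using convex_maps_inj[OF j(2)] j(1) deg by (simp add: mw_def Simplex_hom)
    show "q \<in> und (rho mw) ` FO U (ob c0)"
      if q: "q \<in> FO U (ob w)" and im: "lab w q \<in> dat (ord mw) ` {1..deg c0}" for q
    proof -
      have qd: "q \<in> FO U (ob d)" using q by (simp add: w_def)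
      have "\<gamma> q \<in> dat j ` {1..m}"
        using im qd unfolding mw_def w_def deg by simp
      then have "\<gamma> q \<in> {a<..a + m}"
        unfolding j_image .
      then have "q \<in> \<mu> ` A"
        using \<gamma>_cases[OF qd] by auto
      then show ?thesis by (simp add: mw_def \<mu>_def A_def)
    qed
  qed
  have cw_mw: "cw \<odot>\<^bsub>K\<^esub> mw = m0"
    by (rule K_eqI[OF K.Cmp_in[OF mw cw] m0(1)])
      (simp_all add: K_Cmp cw_def mw_def E.Idn_left[OF m0'(1)] m0(2) square)
  define lw where "lw = cocart_lift proj g w"
  define ew where "ew = cart_lift proj j w"
  note lw = cocart_lift[OF g w, folded lw_def] and ew = cart_lift[OF j w, folded ew_def]
  \<comment> \<open>Comparing the chosen lifts at \<open>w\<close> with \<open>cw\<close> and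
    \<open>mw\<close> yields the two components of the required isomorphism.\<close>
  obtain v where v: "v \<in> hom (fibre proj (a + k + b)) (FO (push proj g) w) d" "v \<odot>\<^bsub>K\<^esub> lw = cw" "iso_arrow K v"
    using proj.cocartesian_unique[OF lw(1,2) cw_cocart cw lw(3) _ g] by (auto simp: cw_def)
  obtain u where u: "u \<in> hom (fibre proj m) (FO (pull proj j) w) c0" "mw \<odot>\<^bsub>K\<^esub> u = ew" "iso_arrow K u"
    using proj.cartesian_unique[OF mw_cart mw ew(1,2) _ ew(3) j(1)] by (auto simp: mw_def)
  define iw where "iw = cart_lift proj i (FO (push proj g) w)"
  define fw where "fw = cocart_lift proj f (FO (pull proj j) w)"
  note iw = cart_lift[OF i lw(4), folded iw_def] and fw = cocart_lift[OF f ew(4), folded fw_def]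
  note \<theta> = bc_comparison[OF j f i g square w, folded lw_def ew_def iw_def fw_def]
  note pv = pull_FA[OF i v(1), folded iw_def e_def] and pu = push_FA[OF f u(1), folded fw_def c_def]
  have K: "u \<in> hom K (FO (pull proj j) w) c0" "v \<in> hom K (FO (push proj g) w) d"
    "\<theta> w \<in> hom K (FO (push proj f) (FO (pull proj j) w)) (FO (pull proj i) (FO (push proj g) w))"
    "FA (pull proj i) v \<in> hom K (FO (pull proj i) (FO (push proj g) w)) (FO (pull proj i) d)"
    "FA (push proj f) u \<in> hom K (FO (push proj f) (FO (pull proj j) w)) (FO (push proj f) c0)"
    using u(1) v(1) \<theta>(1) pv(1) pu(1) unfolding K_fibre_hom by blast+
  \<comment> \<open>Compatibility of \<open>u\<close> and \<open>v\<close> with \<theta> and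
    \<open>t\<close> is tested after composing with the lifts, where both sides become
    \<open>m0 \<odot> u\<close>.\<close>
  have "FA (pull proj i) v \<odot>\<^bsub>K\<^esub> \<theta> w = t \<odot>\<^bsub>K\<^esub> FA (push proj f) u"
  proof (rule push_pull_cancel[OF f i ew(4) d, folded e_def fw_def])
    have "e \<odot>\<^bsub>K\<^esub> ((FA (pull proj i) v \<odot>\<^bsub>K\<^esub> \<theta> w) \<odot>\<^bsub>K\<^esub> fw) = v \<odot>\<^bsub>K\<^esub> (iw \<odot>\<^bsub>K\<^esub> (\<theta> w \<odot>\<^bsub>K\<^esub> fw))"
      unfolding K.assoc[OF fw(2) K(3,4), symmetric] K.assoc[OF K.Cmp_in[OF fw(2) K(3)] K(4) e(2)] pv(2)
      by (rule K.assoc[OF K.Cmp_in[OF fw(2) K(3)] iw(2) K(2), symmetric])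
    also have "\<dots> = cw \<odot>\<^bsub>K\<^esub> (mw \<odot>\<^bsub>K\<^esub> u)"
      unfolding \<theta>(2) K.assoc[OF ew(2) lw(2) K(2)] v(2) u(2) ..
    also have "\<dots> = (e \<odot>\<^bsub>K\<^esub> (t \<odot>\<^bsub>K\<^esub> c)) \<odot>\<^bsub>K\<^esub> u"
      unfolding K.assoc[OF K(1) mw cw] cw_mw m0_def ..
    also have "\<dots> = e \<odot>\<^bsub>K\<^esub> ((t \<odot>\<^bsub>K\<^esub> FA (push proj f) u) \<odot>\<^bsub>K\<^esub> fw)"
      unfolding K.assoc[OF K(1) K.Cmp_in[OF c(2) tK(1)] e(2), symmetric] K.assoc[OF K(1) c(2) tK(1), symmetric]
        K.assoc[OF fw(2) K(5) tK(1), symmetric] pu(2) ..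
    finally show "e \<odot>\<^bsub>K\<^esub> ((FA (pull proj i) v \<odot>\<^bsub>K\<^esub> \<theta> w) \<odot>\<^bsub>K\<^esub> fw) = e \<odot>\<^bsub>K\<^esub> ((t \<odot>\<^bsub>K\<^esub> FA (push proj f) u) \<odot>\<^bsub>K\<^esub> fw)" .
    show "FA (pull proj i) v \<odot>\<^bsub>K\<^esub> \<theta> w \<in> hom (fibre proj k) (FO (push proj f) (FO (pull proj j) w)) (FO (pull proj i) d)"
      using Fk.Cmp_in[OF \<theta>(1) pv(1)] by simp
    show "t \<odot>\<^bsub>K\<^esub> FA (push proj f) u \<in> hom (fibre proj k) (FO (push proj f) (FO (pull proj j) w)) (FO (pull proj i) d)"
      using Fk.Cmp_in[OF pu(1) t(1)] by simp
  qed
  moreover have "FO pairing w \<in> Ob IC"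
    using is_functor_Ob[OF is_functor_pairing] w unfolding pairing_simps by blast
  ultimately have h: "Arrow (FO pairing w) (u, v) z \<in> hom IC (FO pairing w) z"
    using z u(1) v(1) unfolding pairing_simps(3) \<open>z = (c0, d, t)\<close> IC_hom proj_simps by blast
  moreover have "iso_arrow IC (Arrow (FO pairing w) (u, v) z)"
    using IC_iso h proj.fibre_iso[OF u(1) Simplex_Ob u(3)] proj.fibre_iso[OF v(1) Simplex_Ob v(3)]
    unfolding pairing_simps(3) \<open>z = (c0, d, t)\<close> by blast
  ultimately show ?thesis using w by blast
qed

lemma homotopy_pullback_iesq:
  "homotopy_pullback (pull proj j) (push proj g) (push proj f) (pull proj i) \<theta>"
proof -
  have "is_equivalence pairing"
    by (rule is_equivalence_if_fully_faithful_ess_surj[OF is_functor_pairing]; unfold pairing_simps(1,2))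
      (use pairing_faithful pairing_full pairing_ess_surj in blast)+
  then show ?thesis
    unfolding homotopy_pullback_def
    using nat_iso_iesq is_functor_pull[OF j] is_functor_push[OF g] push_f_pull_i
    by (simp add: iesq_simps)
qed

end

lemma iesq_proj: "iesq proj"
  unfolding iesq_def Let_def
proof (intro allI ballI)
  fix a b f assume "f \<in> Ar Simplex"
  then have "f \<in> hom Simplex (src f) (tgt f)"
    by (simp add: hom_def Simplex_def)
  then show "homotopy_pullback (pull proj (block_inclusion a (src f) b)) (push proj (identity_extension a f b))
      (push proj f) (pull proj (block_inclusion a (tgt f) b))
      (bc_comparison proj (block_inclusion a (src f) b) f (block_inclusion a (tgt f) b) (identity_extension a f b))"
    by (rule homotopy_pullback_iesq) simp_all
qed

end

theorem corollary10p8: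
  fixes R :: "('a set, ('a set, 'a \<Rightarrow> 'a) arrow, 'o, 'm) pseudofctr"
  assumes "infinite (UNIV :: 'a set)"
    and "restriction_species R"
  shows "sesquicartesian_fibration (comma_simplex_proj (grothendieck_proj FinInj R)) \<and>
         iesq (comma_simplex_proj (grothendieck_proj FinInj R))"
proof -
  interpret right_fibration "grothendieck_proj FinInj R"
    using assms(2) by (intro right_fibration_grothendieck_proj) (simp add: restriction_species_def)
  show ?thesis
    using sesquicartesian_fibration_proj iesq_proj by blast
qed

end
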